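(* Let $2\le s\le r\le\rho$ be integers, and consider the cross-neighborhood growth dynamics of range $\rho$ with the line growth zero-set $\mathcal Z=([0,r-1]\times[0,s-1])\cap\mathbb Z_+^2$. Then the critical power of $\mathcal Z$ exists and equals $$\gamma_c=\frac{(r-1)s}{r}.$$
   Context: Let $\mathbb Z_+=\{0,1,2,\dots\}$. A zero-set is a set $\mathcal Z\subseteq\mathbb Z_+^2$ such that $(u,v)\in\mathcal Z$ implies $([0,u]\times[0,v])\cap\mathbb Z_+^2\subseteq\mathcal Z$. Given an integer range $\rho$, for $x\in\mathbb Z^2$ let $\mathcal N^h_x=x+([-\rho,\rho]\cap\mathbb Z)\times\{0\}$ and $\mathcal N^v_x=x+\{0\}\times([-\rho,\rho]\cap\mathbb Z)$. Given $\xi_0\subseteq\mathbb Z^2$, define recursively, for $t\in\mathbb Z_+$, $$\xi_{t+1}=\xi_t\cup\{x\in\mathbb Z^2:(|\mathcal N_x^h\cap\xi_t|,|\mathcal N_x^v\cap\xi_t|)\notin\mathcal Z\}.$$ Each $x\in\mathbb Z^2$ is included in $\xi_0$ independently with probability $p\in[0,1]$, and $T=\inf\{t\ge0:(0,0)\in\xi_t\}$. For a deterministic $a=a(p)$ and nonnegative random variables $X=X(p)$: $X\lesssim a$ means $\lim_{\lambda\to\infty}\limsup_{p\to0}\mathbb P(X\ge\lambda a)=0$; $X\gtrsim a$ means $\lim_{\lambda\to0}\limsup_{p\to0}\mathbb P(X\le\lambda a)=0$. A number $\gamma>0$ is a lower power (resp. upper power) for $\mathcal Z$ if for every $\epsilon>0$,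 $T\gtrsim p^{-(\gamma-\epsilon)}$ (resp. $T\lesssim p^{-(\gamma+\epsilon)}$). The critical power $\gamma_c=\gamma_c(\mathcal Z)$ is a number that is both a lower and an upper power. *)

theory Defs
  imports "HOL-Probability.Probability"
begin

definition zero_set :: "(nat \<times> nat) set \<Rightarrow> bool" where
  "zero_set Z \<longleftrightarrow> (\<forall>u v. (u, v) \<in> Z \<longrightarrow> {0..u} \<times> {0..v} \<subseteq> Z)"

definition nbhd_h :: "nat \<Rightarrow> int \<times> int \<Rightarrow> (int \<times> int) set" where
  "nbhd_h \<rho> x = {(fst x + k, snd x) | k. k \<in> {- int \<rho>..int \<rho>}}"

definition nbhd_v :: "nat \<Rightarrow> int \<times> int \<Rightarrow> (int \<times> int) set" where
  "nbhd_v \<rho> x = {(fst x, snd x + k) | k. k \<in> {- int \<rho>..int \<rho>}}"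

primrec growth :: "nat \<Rightarrow> (nat \<times> nat) set \<Rightarrow> (int \<times> int) set \<Rightarrow> nat \<Rightarrow> (int \<times> int) set" where
  "growth \<rho> Z A 0 = A"
| "growth \<rho> Z A (Suc t) = growth \<rho> Z A t \<union>
     {x. (card (nbhd_h \<rho> x \<inter> growth \<rho> Z A t), card (nbhd_v \<rho> x \<inter> growth \<rho> Z A t)) \<notin> Z}"

text \<open>The infimum of the empty set is \<open>\<infinity>\<close>: the origin may never become occupied.\<close>

definition hit_time :: "nat \<Rightarrow> (nat \<times> nat) set \<Rightarrow> (int \<times> int) set \<Rightarrow> enat" where
  "hit_time \<rho> Z A = Inf {enat t | t. (0, 0) \<in> growth \<rho> Z A t}"

text \<open>A configuration \<open>\<omega>\<close> stands for the initial set \<open>{x. \<omega> x}\<close>. Only \<open>p \<in> {0..1}\<close> is meaningful.\<close>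

definition init_measure :: "real \<Rightarrow> (int \<times> int \<Rightarrow> bool) measure" where
  "init_measure p = (\<Pi>\<^sub>M x\<in>UNIV. measure_pmf (bernoulli_pmf p))"

definition T :: "nat \<Rightarrow> (nat \<times> nat) set \<Rightarrow> (int \<times> int \<Rightarrow> bool) \<Rightarrow> ennreal" where
  "T \<rho> Z \<omega> = ennreal_of_enat (hit_time \<rho> Z {x. \<omega> x})"

text \<open>\<open>X \<lesssim> a\<close> and \<open>X \<greatersim> a\<close> as \<open>p \<rightarrow> 0\<close>, where for each \<open>p\<close> the random variable \<open>X p\<close>
  lives on the probability space \<open>M p\<close>.\<close>

definition prob_lesssim ::
  "(real \<Rightarrow> 'w measure) \<Rightarrow> (real \<Rightarrow> 'w \<Rightarrow> ennreal) \<Rightarrow> (real \<Rightarrow> real) \<Rightarrow> bool" where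
  "prob_lesssim M X a \<longleftrightarrow>
     ((\<lambda>l. Limsup (at_right 0)
        (\<lambda>p. emeasure (M p) {\<omega> \<in> space (M p). X p \<omega> \<ge> ennreal (l * a p)})) \<longlongrightarrow> 0) at_top"

definition prob_greatersim ::
  "(real \<Rightarrow> 'w measure) \<Rightarrow> (real \<Rightarrow> 'w \<Rightarrow> ennreal) \<Rightarrow> (real \<Rightarrow> real) \<Rightarrow> bool" where
  "prob_greatersim M X a \<longleftrightarrow>
     ((\<lambda>l. Limsup (at_right 0)
        (\<lambda>p. emeasure (M p) {\<omega> \<in> space (M p). X p \<omega> \<le> ennreal (l * a p)})) \<longlongrightarrow> 0) (at_right 0)"

definition lower_power :: "nat \<Rightarrow> (nat \<times> nat) set \<Rightarrow> real \<Rightarrow> bool" where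
  "lower_power \<rho> Z \<gamma> \<longleftrightarrow> \<gamma> > 0 \<and>
     (\<forall>\<epsilon>>0. prob_greatersim init_measure (\<lambda>p. T \<rho> Z) (\<lambda>p. p powr - (\<gamma> - \<epsilon>)))"

definition upper_power :: "nat \<Rightarrow> (nat \<times> nat) set \<Rightarrow> real \<Rightarrow> bool" where
  "upper_power \<rho> Z \<gamma> \<longleftrightarrow> \<gamma> > 0 \<and>
     (\<forall>\<epsilon>>0. prob_lesssim init_measure (\<lambda>p. T \<rho> Z) (\<lambda>p. p powr - (\<gamma> + \<epsilon>)))"

definition is_critical_power :: "nat \<Rightarrow> (nat \<times> nat) set \<Rightarrow> real \<Rightarrow> bool" where
  "is_critical_power \<rho> Z \<gamma> \<longleftrightarrow> lower_power \<rho> Z \<gamma> \<and> upper_power \<rho> Z \<gamma>"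

definition line_growth :: "nat \<Rightarrow> nat \<Rightarrow> (nat \<times> nat) set" where
  "line_growth r s = {0..r - 1} \<times> {0..s - 1}"

lemma zero_set_line_growth: "zero_set (line_growth r s)"
  by (auto simp: zero_set_def line_growth_def)

end

theory Submission
  imports Defs
begin

text \<open>
  Put \<open>\<gamma> = (r - 1) s / r\<close>. Within time \<open>t\<close> a given column is filled by \<open>s\<close> nearby initial sites with
  probability about \<open>t p ^ s\<close>, so groups of \<open>r - 1\<close> nearby filled columns become available at
  distance \<open>t\<close> precisely when \<open>t (t p ^ s) ^ (r - 1)\<close> is of order \<open>1\<close>, that is at \<open>t = p powr - \<gamma>\<close>.

  Below this scale there are at most \<open>r - 2\<close> nearby filled columns, so a row needs two further initial
  sites. This keeps the density of filled rows below \<open>p\<close>, and a row is then not a better resource for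
  filling columns than an initial site. Exposing the filled lines in alternating half-rounds, each
  generation of newly filled lines is smaller than the previous one by a power of \<open>p\<close>. Hence the
  cascade stops after boundedly many half-rounds, and the origin is not on any filled line. The
  unexplored sites stay dominated by independent ones because the explored history is decreasing in
  them.

  Above this scale, groups of \<open>r - 1\<close> columns together with single extra sites fill many rows; as
  \<open>s \<le> r\<close>, groups of \<open>s - 1\<close> such rows together with single extra sites fill more columns than before.
  Iterating this boundedly often produces \<open>s\<close> adjacent filled rows, which fill everything.
\<close>

section \<open>Events depending on finitely many sites\<close>

text \<open>Time enters only through distance: influence travels at most \<open>\<rho>\<close> sites
  per step, and a run of threshold length advances at least one site per step. So within a box of
  side comparable to \<open>t\<close> lines may be treated as filling instantly, and a static
  problem about two mutually feeding families of lines remains.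

  In the lower bound the obstacle is that clusters of filled lines, not their total number, drive
  the next half-round, and that the lines are dependent. The invariant therefore bounds the number
  of nearby groups of \<open>i\<close> new lines for each \<open>i \<le> r\<close> separately, and
  each half-round is a first moment estimate given the exact history. The slack \<open>e\<close>
  below \<open>\<gamma>\<close> is split: one half enters the exponent of the column density, the
  other is \<open>g ^ 2\<close> with \<open>g = p powr (e / 4)\<close>, where one \<open>g\<close>
  is the gain per half-round and one beats the combinatorial constants.\<close>

definition depends :: "'i set \<Rightarrow> ('i \<Rightarrow> bool) set \<Rightarrow> bool" where
  "depends D A \<longleftrightarrow> (\<forall>\<omega> \<omega>'. (\<forall>z\<in>D. \<omega> z = \<omega>' z) \<longrightarrow> \<omega> \<in> A \<longrightarrow> \<omega>' \<in> A)"

lemma dependsI: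
  assumes "\<And>\<omega> \<omega>'. (\<And>z. z \<in> D \<Longrightarrow> \<omega> z = \<omega>' z) \<Longrightarrow> \<omega> \<in> A \<Longrightarrow> \<omega>' \<in> A"
  shows "depends D A"
  unfolding depends_def by (intro allI impI) (rule assms, auto)

lemma depends_imp:
  assumes "depends D A" "\<And>z. z \<in> D \<Longrightarrow> \<omega> z = \<omega>' z" "\<omega> \<in> A"
  shows "\<omega>' \<in> A"
  using assms(1)[unfolded depends_def, rule_format, of \<omega> \<omega>'] assms(2,3) by auto

lemma dependsD:
  assumes "depends D A" "\<And>z. z \<in> D \<Longrightarrow> \<omega> z = \<omega>' z"
  shows "\<omega> \<in> A \<longleftrightarrow> \<omega>' \<in> A"
proof
  show "\<omega> \<in> A \<Longrightarrow> \<omega>' \<in> A" by (rule depends_imp[OF assms])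
  show "\<omega>' \<in> A \<Longrightarrow> \<omega> \<in> A" by (rule depends_imp[OF assms(1)]) (simp add: assms(2))
qed

lemma depends_mono:
  assumes "depends D A" "D \<subseteq> D'"
  shows "depends D' A"
proof (rule dependsI)
  fix \<omega> \<omega>' :: "'a \<Rightarrow> bool"
  assume eq: "\<And>z. z \<in> D' \<Longrightarrow> \<omega> z = \<omega>' z" and "\<omega> \<in> A"
  show "\<omega>' \<in> A"
    by (rule depends_imp[OF assms(1) _ \<open>\<omega> \<in> A\<close>]) (use eq assms(2) in auto)
qed

lemma depends_compl:
  assumes "depends D A"
  shows "depends D (- A)"
proof (rule dependsI)
  fix \<omega> \<omega>' :: "'a \<Rightarrow> bool"
  assume "\<And>z. z \<in> D \<Longrightarrow> \<omega> z = \<omega>' z" "\<omega> \<in> - A"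
  then show "\<omega>' \<in> - A" using dependsD[OF assms, of \<omega> \<omega>'] by simp
qed

lemma depends_INT:
  assumes "\<And>b. b \<in> B \<Longrightarrow> depends D (A b)"
  shows "depends D (\<Inter>b\<in>B. A b)"
proof (rule dependsI)
  fix \<omega> \<omega>'
  assume eq: "\<And>z. z \<in> D \<Longrightarrow> \<omega> z = \<omega>' z" and in_A: "\<omega> \<in> (\<Inter>b\<in>B. A b)"
  have "\<omega>' \<in> A b" if "b \<in> B" for b
    by (rule depends_imp[OF assms[OF that] eq]) (use in_A that in auto)
  then show "\<omega>' \<in> (\<Inter>b\<in>B. A b)" by blast
qed

lemma depends_UN:
  assumes "\<And>b. b \<in> B \<Longrightarrow> depends D (A b)"
  shows "depends D (\<Union>b\<in>B. A b)"
proof (rule dependsI)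
  fix \<omega> \<omega>'
  assume eq: "\<And>z. z \<in> D \<Longrightarrow> \<omega> z = \<omega>' z" and in_A: "\<omega> \<in> (\<Union>b\<in>B. A b)"
  then obtain b where b: "b \<in> B" "\<omega> \<in> A b" by blast
  have "\<omega>' \<in> A b" by (rule depends_imp[OF assms[OF b(1)] eq b(2)])
  with b(1) show "\<omega>' \<in> (\<Union>b\<in>B. A b)" by blast
qed

lemma depends_all_occupied: "S \<subseteq> D \<Longrightarrow> depends D {\<omega>. \<forall>z\<in>S. \<omega> z}"
  by (rule dependsI) auto

lemma depends_vimage:
  assumes "\<And>\<omega> \<omega>'. (\<And>z. z \<in> D \<Longrightarrow> \<omega> z = \<omega>' z) \<Longrightarrow> F \<omega> = F \<omega>'"
  shows "depends D {\<omega>. P (F \<omega>)}"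
proof (rule dependsI)
  fix \<omega> \<omega>' :: "'a \<Rightarrow> bool"
  assume "\<And>z. z \<in> D \<Longrightarrow> \<omega> z = \<omega>' z" "\<omega> \<in> {\<omega>. P (F \<omega>)}"
  then show "\<omega>' \<in> {\<omega>. P (F \<omega>)}" using assms[of \<omega> \<omega>'] by simp
qed

lemma finite_range_depends:
  fixes F :: "('i \<Rightarrow> bool) \<Rightarrow> 'b"
  assumes D: "finite D" and F: "\<And>\<omega> \<omega>'. (\<And>z. z \<in> D \<Longrightarrow> \<omega> z = \<omega>' z) \<Longrightarrow> F \<omega> = F \<omega>'"
  shows "finite (range F)"
proof (rule finite_subset)
  show "range F \<subseteq> (\<lambda>S. F (\<lambda>z. z \<in> S)) ` Pow D"
  proof clarify
    fix \<omega>
    have "F \<omega> = F (\<lambda>z. z \<in> {z \<in> D. \<omega> z})" by (rule F) auto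
    then show "F \<omega> \<in> (\<lambda>S. F (\<lambda>z. z \<in> S)) ` Pow D" by blast
  qed
qed (use D in auto)

section \<open>The product measure: cylinder events and independence over disjoint sites\<close>

locale bernoulli_field =
  fixes p :: real
  assumes p0: "0 \<le> p" and p1: "p \<le> 1"
begin

abbreviation \<mu> :: "(int \<times> int \<Rightarrow> bool) measure" where "\<mu> \<equiv> init_measure p"

sublocale product_prob_space "\<lambda>_. measure_pmf (bernoulli_pmf p)" "UNIV :: (int \<times> int) set"
  by (unfold_locales)

sublocale prob_space \<mu>
  unfolding init_measure_def by (rule prob_space_PiM) (rule prob_space_measure_pmf)

lemma space_mu [simp]: "space \<mu> = UNIV"
  by (simp add: init_measure_def space_PiM)

lemma coord_measurable: "(\<lambda>\<omega>. \<omega> z) \<in> measurable \<mu> (measure_pmf (bernoulli_pmf p))"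
  unfolding init_measure_def by simp

lemma indep_coords:
  "indep_vars (\<lambda>_. measure_pmf (bernoulli_pmf p)) (\<lambda>z \<omega>. \<omega> z) UNIV"
proof (subst indep_vars_iff_distr_eq_PiM')
  show "(UNIV :: (int \<times> int) set) \<noteq> {}" by simp
  show "random_variable (measure_pmf (bernoulli_pmf p)) (\<lambda>\<omega>. \<omega> z)" for z
    by (rule coord_measurable)
  have "(\<Pi>\<^sub>M i\<in>UNIV. distr \<mu> (measure_pmf (bernoulli_pmf p)) (\<lambda>\<omega>. \<omega> i)) = \<mu>"
    unfolding init_measure_def
    by (intro PiM_cong refl distr_PiM_component) (auto intro: prob_space_measure_pmf)
  moreover have "distr \<mu> (\<Pi>\<^sub>M i\<in>UNIV. measure_pmf (bernoulli_pmf p)) (\<lambda>x. restrict x UNIV) = \<mu>"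
    by (simp add: init_measure_def distr_id2 restrict_def)
  ultimately show "distr \<mu> (\<Pi>\<^sub>M i\<in>UNIV. measure_pmf (bernoulli_pmf p)) (\<lambda>x. \<lambda>i\<in>UNIV. x i)
      = (\<Pi>\<^sub>M i\<in>UNIV. distr \<mu> (measure_pmf (bernoulli_pmf p)) (\<lambda>\<omega>. \<omega> i))"
    by simp
qed

text \<open>Writes the event as a preimage under restriction to \<open>D\<close>, the form in which
  measurability and independence of restrictions apply.\<close>

lemma depends_restrict:
  fixes D :: "(int \<times> int) set"
  assumes "depends D A"
  shows "A = {\<omega>. restrict \<omega> D \<in> (\<lambda>\<omega>. restrict \<omega> D) ` A}"
proof -
  have "\<omega> \<in> A" if "restrict \<omega> D = restrict \<omega>' D" "\<omega>' \<in> A" for \<omega> \<omega>'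
  proof -
    have "\<omega> z = \<omega>' z" if "z \<in> D" for z
      using fun_cong[OF \<open>restrict \<omega> D = restrict \<omega>' D\<close>, of z] that by simp
    then show ?thesis using dependsD[OF assms, of \<omega> \<omega>'] that(2) by simp
  qed
  then show ?thesis by (auto simp: image_iff)
qed

text \<open>A finite \<open>D\<close> admits only finitely many restrictions, each a measurable
  singleton, so every set of restrictions is measurable.\<close>

lemma restrict_image_sets:
  fixes D :: "(int \<times> int) set"
  assumes "finite D"
  shows "(\<lambda>\<omega>. restrict \<omega> D) ` A \<in> sets (Pi\<^sub>M D (\<lambda>_. measure_pmf (bernoulli_pmf p)))"
proof -
  have sub: "(\<lambda>\<omega>. restrict \<omega> D) ` A \<subseteq> D \<rightarrow>\<^sub>E UNIV" by auto
  have fin: "finite ((\<lambda>\<omega>. restrict \<omega> D) ` A)"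
    by (rule finite_subset[OF sub]) (intro finite_PiE assms, simp)
  have "{a} \<in> sets (Pi\<^sub>M D (\<lambda>_. measure_pmf (bernoulli_pmf p)))"
    if "a \<in> D \<rightarrow>\<^sub>E UNIV" for a :: "int \<times> int \<Rightarrow> bool"
  proof -
    have "{a} = (\<Pi>\<^sub>E i\<in>D. {a i})" using PiE_singleton[of a D] that by (auto simp: PiE_def)
    also have "\<dots> \<in> sets (Pi\<^sub>M D (\<lambda>_. measure_pmf (bernoulli_pmf p)))"
      by (intro sets_PiM_I_finite assms) simp
    finally show ?thesis .
  qed
  then have "(\<Union>a\<in>(\<lambda>\<omega>. restrict \<omega> D) ` A. {a}) \<in> sets (Pi\<^sub>M D (\<lambda>_. measure_pmf (bernoulli_pmf p)))"
    using sub by (intro sets.finite_UN fin) blast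
  then show ?thesis by simp
qed

lemma depends_sets:
  assumes "finite D" "depends D A"
  shows "A \<in> events"
proof -
  have "(\<lambda>\<omega>. restrict \<omega> D) \<in> measurable \<mu> (Pi\<^sub>M D (\<lambda>_. measure_pmf (bernoulli_pmf p)))"
    unfolding init_measure_def by (rule measurable_restrict_subset) simp
  from measurable_sets[OF this restrict_image_sets[OF assms(1)], of A]
  have "{\<omega>. restrict \<omega> D \<in> (\<lambda>\<omega>. restrict \<omega> D) ` A} \<in> events"
    by (simp add: vimage_def)
  then show ?thesis using depends_restrict[OF assms(2)] by simp
qed

lemma prob_Int_depends:
  assumes "finite D" "finite E" "D \<inter> E = {}" "depends D A" "depends E B"
  shows "prob (A \<inter> B) = prob A * prob B"
proof -
  let ?N = "\<lambda>_. measure_pmf (bernoulli_pmf p)"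
  have ind: "indep_var (Pi\<^sub>M D ?N) (\<lambda>\<omega>. restrict (\<lambda>i. \<omega> i) D) (Pi\<^sub>M E ?N) (\<lambda>\<omega>. restrict (\<lambda>i. \<omega> i) E)"
    by (rule indep_var_restrict[OF indep_coords assms(3)]) auto
  from indep_varD[OF ind restrict_image_sets[OF assms(1), of A] restrict_image_sets[OF assms(2), of B]]
  have "prob {\<omega>. restrict \<omega> D \<in> (\<lambda>\<omega>. restrict \<omega> D) ` A \<and> restrict \<omega> E \<in> (\<lambda>\<omega>. restrict \<omega> E) ` B}
     = prob {\<omega>. restrict \<omega> D \<in> (\<lambda>\<omega>. restrict \<omega> D) ` A} * prob {\<omega>. restrict \<omega> E \<in> (\<lambda>\<omega>. restrict \<omega> E) ` B}"
    by (simp add: vimage_def)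
  moreover have "{\<omega>. restrict \<omega> D \<in> (\<lambda>\<omega>. restrict \<omega> D) ` A \<and> restrict \<omega> E \<in> (\<lambda>\<omega>. restrict \<omega> E) ` B}
     = {\<omega>. restrict \<omega> D \<in> (\<lambda>\<omega>. restrict \<omega> D) ` A} \<inter> {\<omega>. restrict \<omega> E \<in> (\<lambda>\<omega>. restrict \<omega> E) ` B}"
    by blast
  ultimately show ?thesis
    by (simp only: depends_restrict[OF assms(4), symmetric] depends_restrict[OF assms(5), symmetric])
qed

lemma prob_site: "prob {\<omega>. \<omega> z} = p"
proof -
  have "emeasure \<mu> {\<omega>\<in>space \<mu>. \<omega> z \<in> {True}} = emeasure (measure_pmf (bernoulli_pmf p)) {True}"
    unfolding init_measure_def by (rule emeasure_PiM_Collect_single) auto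
  also have "\<dots> = ennreal p" using p0 p1 by (simp add: emeasure_pmf_single)
  finally show ?thesis using p0 by (simp add: measure_def)
qed

lemma prob_INT_depends:
  assumes "finite B" "\<And>b. b \<in> B \<Longrightarrow> finite (D b)" "disjoint_family_on D B"
    "\<And>b. b \<in> B \<Longrightarrow> depends (D b) (A b)"
  shows "prob (\<Inter>b\<in>B. A b) = (\<Prod>b\<in>B. prob (A b))"
  using assms
proof (induction B rule: finite_induct)
  case empty
  then show ?case using prob_space by simp
next
  case (insert b B)
  have dis: "D b \<inter> (\<Union>b\<in>B. D b) = {}"
    using insert.prems(2) insert.hyps by (auto simp: disjoint_family_on_def)
  have "prob (A b \<inter> (\<Inter>b\<in>B. A b)) = prob (A b) * prob (\<Inter>b\<in>B. A b)"
  proof (rule prob_Int_depends[OF _ _ dis])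
    show "depends (\<Union>b\<in>B. D b) (\<Inter>b\<in>B. A b)"
      using insert.prems(3) by (intro depends_INT) (auto intro: depends_mono)
  qed (use insert in auto)
  also have "prob (\<Inter>b\<in>B. A b) = (\<Prod>b\<in>B. prob (A b))"
    using insert.prems by (intro insert.IH) (auto simp: disjoint_family_on_def)
  finally show ?case using insert.hyps by simp
qed

lemma prob_all_occupied:
  assumes "finite S"
  shows "prob {\<omega>. \<forall>z\<in>S. \<omega> z} = p ^ card S"
proof -
  have "prob (\<Inter>z\<in>S. {\<omega>. \<omega> z}) = (\<Prod>z\<in>S. prob {\<omega>. \<omega> z})"
    using assms by (intro prob_INT_depends[where D = "\<lambda>z. {z}"])
      (auto simp: disjoint_family_on_def intro!: dependsI)
  moreover have "(\<Inter>z\<in>S. {\<omega>. \<omega> z}) = {\<omega>. \<forall>z\<in>S. \<omega> z}" by auto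
  ultimately show ?thesis by (simp add: prob_site)
qed

text \<open>Total probability over the values of \<open>F\<close>, where the target event
  \<open>B v\<close> may itself change with the value. With the explored past as \<open>F\<close>, a
  bound that holds given each past becomes an unconditional one.\<close>

lemma prob_fibres:
  fixes F :: "(int \<times> int \<Rightarrow> bool) \<Rightarrow> 'b"
  assumes D: "finite D" and Fdep: "\<And>\<omega> \<omega>'. (\<And>z. z \<in> D \<Longrightarrow> \<omega> z = \<omega>' z) \<Longrightarrow> F \<omega> = F \<omega>'"
    and c: "0 \<le> c"
    and B: "\<And>v. depends E (B v)" "finite E"
    and le: "\<And>v. v \<in> V \<Longrightarrow> prob ({\<omega>. F \<omega> = v} \<inter> B v) \<le> c * prob {\<omega>. F \<omega> = v}"
  shows "prob {\<omega>. F \<omega> \<in> V \<and> \<omega> \<in> B (F \<omega>)} \<le> c"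
proof -
  have "finite (range F)"
    by (rule finite_range_depends[OF D]) (erule Fdep)
  then have fin: "finite (range F \<inter> V)" by blast
  have ev: "{\<omega>. F \<omega> = v} \<in> events" for v
    by (rule depends_sets[OF D], rule depends_vimage[where P = "\<lambda>x. x = v"]) (erule Fdep)
  have evB: "B v \<in> events" for v by (rule depends_sets[OF B(2,1)])
  have "prob {\<omega>. F \<omega> \<in> V \<and> \<omega> \<in> B (F \<omega>)} = prob (\<Union>v\<in>range F \<inter> V. {\<omega>. F \<omega> = v} \<inter> B v)"
    by (rule arg_cong[where f = prob]) auto
  also have "\<dots> \<le> (\<Sum>v\<in>range F \<inter> V. prob ({\<omega>. F \<omega> = v} \<inter> B v))"
    using ev evB by (intro finite_measure_subadditive_finite fin) auto
  also have "\<dots> \<le> (\<Sum>v\<in>range F \<inter> V. c * prob {\<omega>. F \<omega> = v})"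
    by (intro sum_mono le) auto
  also have "\<dots> = c * prob (\<Union>v\<in>range F \<inter> V. {\<omega>. F \<omega> = v})"
    using ev by (subst finite_measure_finite_Union[OF fin])
      (auto simp: disjoint_family_on_def sum_distrib_left)
  also have "\<dots> \<le> c * 1" using c by (intro mult_left_mono) auto
  finally show ?thesis by simp
qed

end

section \<open>Filled lines and the lower bound\<close>

text \<open>Rows and columns are treated uniformly by parity: lines of even index are rows and lines of odd
  index are columns. \<open>site k u v\<close> is the crossing of line \<open>u\<close> of the kind of \<open>k\<close> with line \<open>v\<close> of
  the kind of \<open>k + 1\<close>.\<close>

definition site :: "nat \<Rightarrow> int \<Rightarrow> int \<Rightarrow> int \<times> int" where
  "site k u v = (if even k then (v, u) else (u, v))"

lemma site_Suc: "site (Suc k) u v = site k v u"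
  by (simp add: site_def)

lemma site_eq_iff [simp]: "site k u v = site k u' v' \<longleftrightarrow> u = u' \<and> v = v'"
  by (auto simp: site_def)

definition on_lines :: "nat \<Rightarrow> int set \<Rightarrow> int \<times> int \<Rightarrow> bool" where
  "on_lines k A z \<longleftrightarrow> (if even k then snd z \<in> A else fst z \<in> A)"

lemma on_lines_site [simp]: "on_lines k A (site k u v) \<longleftrightarrow> u \<in> A"
  by (simp add: on_lines_def site_def)

lemma on_lines_Suc_site [simp]: "on_lines (Suc k) A (site k u v) \<longleftrightarrow> v \<in> A"
  by (simp add: on_lines_def site_def)

lemma on_lines_parity: "even j = even k \<Longrightarrow> on_lines j A z \<longleftrightarrow> on_lines k A z"
  by (simp add: on_lines_def)

lemma nbhd_h_eq: "nbhd_h \<rho> (x, y) = (\<lambda>u. (u, y)) ` {x - int \<rho>..x + int \<rho>}"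
proof -
  have "(u, y) \<in> nbhd_h \<rho> (x, y)" if "u \<in> {x - int \<rho>..x + int \<rho>}" for u
    unfolding nbhd_h_def using that by (auto intro!: exI[of _ "u - x"])
  then show ?thesis by (auto simp: nbhd_h_def)
qed

lemma nbhd_v_eq: "nbhd_v \<rho> (x, y) = (\<lambda>u. (x, u)) ` {y - int \<rho>..y + int \<rho>}"
proof -
  have "(x, u) \<in> nbhd_v \<rho> (x, y)" if "u \<in> {y - int \<rho>..y + int \<rho>}" for u
    unfolding nbhd_v_def using that by (auto intro!: exI[of _ "u - y"])
  then show ?thesis by (auto simp: nbhd_v_def)
qed

lemma card_nbhd_h: "card (nbhd_h \<rho> (x, y) \<inter> S) = card {u \<in> {x - int \<rho>..x + int \<rho>}. (u, y) \<in> S}"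
proof -
  have "nbhd_h \<rho> (x, y) \<inter> S = (\<lambda>u. (u, y)) ` {u \<in> {x - int \<rho>..x + int \<rho>}. (u, y) \<in> S}"
    by (auto simp: nbhd_h_eq)
  then show ?thesis by (simp add: card_image inj_on_def)
qed

lemma card_nbhd_v: "card (nbhd_v \<rho> (x, y) \<inter> S) = card {u \<in> {y - int \<rho>..y + int \<rho>}. (x, u) \<in> S}"
proof -
  have "nbhd_v \<rho> (x, y) \<inter> S = (\<lambda>u. (x, u)) ` {u \<in> {y - int \<rho>..y + int \<rho>}. (x, u) \<in> S}"
    by (auto simp: nbhd_v_eq)
  then show ?thesis by (simp add: card_image inj_on_def)
qed

lemma growth_Suc_iff:
  assumes "0 < r" "0 < s"
  shows "(x, y) \<in> growth \<rho> (line_growth r s) A (Suc t) \<longleftrightarrow>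
    (x, y) \<in> growth \<rho> (line_growth r s) A t \<or>
    r \<le> card {u \<in> {x - int \<rho>..x + int \<rho>}. (u, y) \<in> growth \<rho> (line_growth r s) A t} \<or>
    s \<le> card {u \<in> {y - int \<rho>..y + int \<rho>}. (x, u) \<in> growth \<rho> (line_growth r s) A t}"
  using assms by (auto simp: card_nbhd_h card_nbhd_v line_growth_def)

lemma growth_mono_time: "t \<le> t' \<Longrightarrow> growth \<rho> Z A t \<subseteq> growth \<rho> Z A t'"
  by (rule lift_Suc_mono_le[of "growth \<rho> Z A"]) auto

lemma growth_site_Suc:
  assumes "0 < r" "0 < s"
    and "(if even k then s else r) \<le>
      card {u \<in> {w - int \<rho>..w + int \<rho>}. site k u v \<in> growth \<rho> (line_growth r s) A t}"
  shows "site k w v \<in> growth \<rho> (line_growth r s) A (Suc t)"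
proof (cases "even k")
  case True
  with assms show ?thesis by (simp add: site_def growth_Suc_iff del: growth.simps)
next
  case False
  with assms show ?thesis by (simp add: site_def growth_Suc_iff del: growth.simps)
qed

section \<open>Nucleation of lines: the deterministic over-approximation\<close>

locale line_nucleation =
  fixes \<rho> L r s :: nat
begin

definition I :: "int set" where "I = {- int L..int L}"

lemma finite_I [simp]: "finite I" by (simp add: I_def)

text \<open>Two sites of one neighborhood of range \<open>\<rho>\<close> are at distance at most
  \<open>2 * \<rho>\<close>, so every set of sites that jointly fills a site projects to such a
  group.\<close>

definition grp :: "nat \<Rightarrow> int set set" where
  "grp k = {G. G \<subseteq> I \<and> card G = k \<and> (\<forall>a\<in>G. \<forall>b\<in>G. \<bar>a - b\<bar> \<le> 2 * int \<rho>)}"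

definition threshold :: "nat \<Rightarrow> nat" where "threshold k = (if even k then s else r)"

text \<open>\<open>lines k\<close> collects the lines filled after \<open>k\<close> half-rounds inside the box \<open>I \<times> I\<close>. A line is filled as
  soon as enough sites of it, pairwise within distance \<open>2\<rho>\<close>, are initially occupied or lie on lines of
  the other kind that are already filled; this over-approximates the growth.\<close>

primrec lines :: "nat \<Rightarrow> (int \<times> int \<Rightarrow> bool) \<Rightarrow> int set" where
  "lines 0 \<omega> = {}"
| "lines (Suc k) \<omega> = {v \<in> I. \<exists>V\<in>grp (threshold k). \<forall>u\<in>V. \<omega> (site k u v) \<or> u \<in> lines k \<omega>}"

lemma lines_subset_I: "lines k \<omega> \<subseteq> I"
  by (cases k) auto

lemma finite_lines [simp]: "finite (lines k \<omega>)" using lines_subset_I finite_I by (rule finite_subset)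

lemma finite_grp [simp]: "finite (grp k)"
  by (rule finite_subset[of _ "Pow I"]) (auto simp: grp_def)

lemma grpD: "V \<in> grp k \<Longrightarrow> V \<subseteq> I" "V \<in> grp k \<Longrightarrow> card V = k"
  by (auto simp: grp_def)

lemma grp_finite: "V \<in> grp k \<Longrightarrow> finite V"
  using grpD(1) finite_I finite_subset by blast

lemma grp_subset: "V \<in> grp k \<Longrightarrow> G \<subseteq> V \<Longrightarrow> G \<in> grp (card G)"
  by (auto simp: grp_def)

lemma lines_Suc_I:
  assumes "v \<in> I" "V \<in> grp (threshold k)" "\<And>u. u \<in> V \<Longrightarrow> \<omega> (site k u v) \<or> u \<in> lines k \<omega>"
  shows "v \<in> lines (Suc k) \<omega>"
  using assms by auto

lemma lines_Suc_D:
  "v \<in> lines (Suc k) \<omega> \<Longrightarrow> v \<in> I \<and> (\<exists>V\<in>grp (threshold k). \<forall>u\<in>V. \<omega> (site k u v) \<or> u \<in> lines k \<omega>)"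
  by simp

declare lines.simps(2) [simp del]

lemma lines_mono:
  assumes "\<And>z. \<omega> z \<Longrightarrow> \<omega>' z"
  shows "lines k \<omega> \<subseteq> lines k \<omega>'"
proof (induction k)
  case (Suc k)
  show ?case
  proof
    fix v assume "v \<in> lines (Suc k) \<omega>"
    then obtain V where V: "v \<in> I" "V \<in> grp (threshold k)" "\<forall>u\<in>V. \<omega> (site k u v) \<or> u \<in> lines k \<omega>"
      by (blast dest: lines_Suc_D)
    from V(1,2) show "v \<in> lines (Suc k) \<omega>'"
    proof (rule lines_Suc_I)
      fix u assume "u \<in> V"
      with V(3) Suc assms[of "site k u v"] show "\<omega>' (site k u v) \<or> u \<in> lines k \<omega>'" by blast
    qed
  qed
qed simp

lemma lines_Suc_Suc: "lines k \<omega> \<subseteq> lines (Suc (Suc k)) \<omega>"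
proof (induction k)
  case (Suc k)
  show ?case
  proof
    fix v assume "v \<in> lines (Suc k) \<omega>"
    then obtain V where V: "v \<in> I" "V \<in> grp (threshold k)" "\<forall>u\<in>V. \<omega> (site k u v) \<or> u \<in> lines k \<omega>"
      by (blast dest: lines_Suc_D)
    moreover have "threshold (Suc (Suc k)) = threshold k" "\<And>u. site (Suc (Suc k)) u v = site k u v"
      by (simp_all add: threshold_def site_Suc)
    ultimately show "v \<in> lines (Suc (Suc (Suc k))) \<omega>"
      using Suc by (intro lines_Suc_I[of v V]) auto
  qed
qed simp

lemma lines_depends:
  assumes "\<And>z. z \<in> I \<times> I \<Longrightarrow> \<omega> z = \<omega>' z"
  shows "lines k \<omega> = lines k \<omega>'"
proof (induction k)
  case (Suc k)
  have "\<omega> (site k u v) = \<omega>' (site k u v)" if "V \<in> grp (threshold k)" "u \<in> V" "v \<in> I" for u v V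
    using assms grpD(1)[OF that(1)] that by (auto simp: site_def)
  then show ?case unfolding lines.simps(2) Suc by (intro Collect_cong conj_cong bex_cong ball_cong) auto
qed simp

text \<open>Exploration principle: the history of filled lines is a decreasing function of the sites off
  these lines.\<close>

lemma lines_stable_off_lines:
  assumes le: "\<And>z. \<omega>' z \<Longrightarrow> \<omega> z"
    and eq: "\<And>z j. j \<le> k \<Longrightarrow> on_lines j (lines j \<omega>) z \<Longrightarrow> \<omega>' z = \<omega> z"
    and "j \<le> k"
  shows "lines j \<omega>' = lines j \<omega>"
  using \<open>j \<le> k\<close>
proof (induction j)
  case (Suc j)
  then have IH: "lines j \<omega>' = lines j \<omega>" by simp
  have "v \<in> lines (Suc j) \<omega>'" if v: "v \<in> lines (Suc j) \<omega>" for v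
  proof -
    \<comment> \<open>An explored line keeps all its sites when passing to \<open>\<omega>'\<close>,
      so the group that filled it still does. The converse inclusion is monotonicity.\<close>
    have *: "\<omega>' (site j u v) = \<omega> (site j u v)" for u
      using Suc.prems v by (intro eq[of "Suc j"]) auto
    from v show ?thesis by (simp add: lines.simps(2) * IH)
  qed
  with lines_mono[of \<omega>' \<omega> "Suc j"] le show ?case by blast
qed simp

text \<open>Any sets of rows and columns closed under both filling rules cover the growth. The last
  two hypotheses are a backward light cone: one step back in time looks at most
  \<open>\<rho>\<close> sites further, so sites outside the box never matter.\<close>

lemma growth_subset_lines:
  assumes rs: "0 < r" "0 < s"
    and R: "\<And>y V. y \<in> I \<Longrightarrow> V \<in> grp r \<Longrightarrow> (\<And>u. u \<in> V \<Longrightarrow> \<omega> (u, y) \<or> u \<in> Cols) \<Longrightarrow> y \<in> Rows"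
    and C: "\<And>x V. x \<in> I \<Longrightarrow> V \<in> grp s \<Longrightarrow> (\<And>u. u \<in> V \<Longrightarrow> \<omega> (x, u) \<or> u \<in> Rows) \<Longrightarrow> x \<in> Cols"
    and "(x, y) \<in> growth \<rho> (line_growth r s) {z. \<omega> z} t"
    and "\<bar>x\<bar> + int (\<rho> * t) \<le> int L" "\<bar>y\<bar> + int (\<rho> * t) \<le> int L"
  shows "\<omega> (x, y) \<or> x \<in> Cols \<or> y \<in> Rows"
  using assms(5-7)
proof (induction t arbitrary: x y)
  case (Suc t)
  let ?g = "growth \<rho> (line_growth r s) {z. \<omega> z} t"
  have bx: "\<bar>u\<bar> + int (\<rho> * t) \<le> int L" if "u \<in> {x - int \<rho>..x + int \<rho>}" for u
  proof -
    have "\<bar>u\<bar> \<le> \<bar>x\<bar> + int \<rho>" using that by auto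
    with Suc.prems(2) show ?thesis by (simp add: algebra_simps)
  qed
  have by': "\<bar>u\<bar> + int (\<rho> * t) \<le> int L" if "u \<in> {y - int \<rho>..y + int \<rho>}" for u
  proof -
    have "\<bar>u\<bar> \<le> \<bar>y\<bar> + int \<rho>" using that by auto
    with Suc.prems(3) show ?thesis by (simp add: algebra_simps)
  qed
  have wI: "u \<in> I" if "\<bar>u\<bar> + int (\<rho> * t) \<le> int L" for u
  proof -
    have "0 \<le> int (\<rho> * t)" by simp
    with that have "\<bar>u\<bar> \<le> int L" by linarith
    then show ?thesis by (auto simp: I_def)
  qed
  have small: "\<bar>x\<bar> + int (\<rho> * t) \<le> int L" "\<bar>y\<bar> + int (\<rho> * t) \<le> int L"
    by (rule bx, simp, rule by', simp)
  have xI: "x \<in> I" "y \<in> I" using wI small by auto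
  from Suc.prems(1)[unfolded growth_Suc_iff[OF rs]] consider
      (a) "(x, y) \<in> ?g"
    | (b) "r \<le> card {u \<in> {x - int \<rho>..x + int \<rho>}. (u, y) \<in> ?g}"
    | (c) "s \<le> card {u \<in> {y - int \<rho>..y + int \<rho>}. (x, u) \<in> ?g}"
    by blast
  then show ?case
  proof cases
    case a
    then show ?thesis using Suc.IH small by blast
  next
    case b
    then obtain V where V: "V \<subseteq> {u \<in> {x - int \<rho>..x + int \<rho>}. (u, y) \<in> ?g}" "card V = r"
      by (meson obtain_subset_with_card_n)
    have win: "u \<in> {x - int \<rho>..x + int \<rho>}" "(u, y) \<in> ?g" if "u \<in> V" for u
      using V(1) that by blast+
    have "\<bar>a - b\<bar> \<le> 2 * int \<rho>" if "a \<in> V" "b \<in> V" for a b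
      using win(1)[OF that(1)] win(1)[OF that(2)] by auto
    moreover have "V \<subseteq> I" using wI[OF bx[OF win(1)]] by blast
    ultimately have "V \<in> grp r" using V(2) by (simp add: grp_def)
    moreover have "\<omega> (u, y) \<or> u \<in> Cols \<or> y \<in> Rows" if "u \<in> V" for u
      by (rule Suc.IH[OF win(2)[OF that] bx[OF win(1)[OF that]] small(2)])
    ultimately show ?thesis using R[of y V] xI by blast
  next
    case c
    then obtain V where V: "V \<subseteq> {u \<in> {y - int \<rho>..y + int \<rho>}. (x, u) \<in> ?g}" "card V = s"
      by (meson obtain_subset_with_card_n)
    have win: "u \<in> {y - int \<rho>..y + int \<rho>}" "(x, u) \<in> ?g" if "u \<in> V" for u
      using V(1) that by blast+
    have "\<bar>a - b\<bar> \<le> 2 * int \<rho>" if "a \<in> V" "b \<in> V" for a b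
      using win(1)[OF that(1)] win(1)[OF that(2)] by auto
    moreover have "V \<subseteq> I" using wI[OF by'[OF win(1)]] by blast
    ultimately have "V \<in> grp s" using V(2) by (simp add: grp_def)
    moreover have "\<omega> (x, u) \<or> x \<in> Cols \<or> u \<in> Rows" if "u \<in> V" for u
      by (rule Suc.IH[OF win(2)[OF that] small(1) by'[OF win(1)[OF that]]])
    ultimately show ?thesis using C[of x V] xI by blast
  qed
qed simp

text \<open>Stability makes the pair \<open>lines k\<close>, \<open>lines (Suc k)\<close> closed:
  the second contains what the first fills by definition, and what the second fills is
  \<open>lines (Suc (Suc k))\<close>, which is the first again. The parity of \<open>k\<close>
  decides which of them are the rows.\<close>

lemma origin_not_hit:
  assumes rs: "0 < r" "0 < s" and L: "\<rho> * t \<le> L"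
    and stable: "lines (Suc (Suc k)) \<omega> = lines k \<omega>"
    and "\<not> \<omega> (0, 0)" "0 \<notin> lines k \<omega>" "0 \<notin> lines (Suc k) \<omega>"
  shows "(0, 0) \<notin> growth \<rho> (line_growth r s) {z. \<omega> z} t"
proof
  assume hit: "(0, 0) \<in> growth \<rho> (line_growth r s) {z. \<omega> z} t"
  have closed: "v \<in> lines (Suc j) \<omega>"
    if "v \<in> I" "V \<in> grp (threshold j)" "\<And>u. u \<in> V \<Longrightarrow> \<omega> (site j u v) \<or> u \<in> lines j \<omega>" for j v V
    using that by (intro lines_Suc_I[of v V]) auto
  have A: "v \<in> lines (Suc k) \<omega>"
    if "v \<in> I" "V \<in> grp (threshold k)" "\<And>u. u \<in> V \<Longrightarrow> \<omega> (site k u v) \<or> u \<in> lines k \<omega>" for v V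
    using closed that by blast
  have B: "v \<in> lines k \<omega>"
    if "v \<in> I" "V \<in> grp (threshold (Suc k))" "\<And>u. u \<in> V \<Longrightarrow> \<omega> (site (Suc k) u v) \<or> u \<in> lines (Suc k) \<omega>" for v V
    using closed[of v V "Suc k"] that unfolding stable by blast
  have L0: "\<bar>0\<bar> + int (\<rho> * t) \<le> int L" using L by linarith
  have "\<omega> (0, 0) \<or> 0 \<in> lines k \<omega> \<or> 0 \<in> lines (Suc k) \<omega>"
  proof (cases "even k")
    case True
    have "\<omega> (0, 0) \<or> 0 \<in> lines (Suc k) \<omega> \<or> 0 \<in> lines k \<omega>"
      using True A B by (intro growth_subset_lines[OF rs _ _ hit L0 L0]) (auto simp: threshold_def site_def)
    then show ?thesis by blast
  next
    case False
    show ?thesis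
      using False A B by (intro growth_subset_lines[OF rs _ _ hit L0 L0]) (auto simp: threshold_def site_def)
  qed
  with assms show False by blast
qed

section \<open>Counting groups of nearby lines\<close>

definition newgrp :: "nat \<Rightarrow> int set \<Rightarrow> int set \<Rightarrow> int set set" where
  "newgrp i A A' = {G \<in> grp i. G \<subseteq> A \<and> \<not> G \<subseteq> A'}"

lemma finite_newgrp [simp]: "finite (newgrp i A A')"
  by (simp add: newgrp_def)

text \<open>The number of subsets of an interval of \<open>4 * \<rho> + 1\<close> integers; every
  group containing a given line lies in such an interval around it.\<close>

abbreviation cst :: nat where "cst \<equiv> 2 ^ (4 * \<rho> + 1)"

lemma card_grp_containing:
  assumes "G \<noteq> {}"
  shows "card {V \<in> grp m. G \<subseteq> V} \<le> cst"
proof -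
  obtain x where x: "x \<in> G" using assms by blast
  have "{V \<in> grp m. G \<subseteq> V} \<subseteq> Pow {x - 2 * int \<rho>..x + 2 * int \<rho>}"
  proof clarify
    fix V v assume "V \<in> grp m" "G \<subseteq> V" "v \<in> V"
    with x have "\<bar>v - x\<bar> \<le> 2 * int \<rho>" by (auto simp: grp_def)
    then show "v \<in> {x - 2 * int \<rho>..x + 2 * int \<rho>}" by auto
  qed
  then have "card {V \<in> grp m. G \<subseteq> V} \<le> card (Pow {x - 2 * int \<rho>..x + 2 * int \<rho>})"
    by (intro card_mono) auto
  also have "\<dots> = cst" by (simp add: card_Pow nat_add_distrib)
  finally show ?thesis .
qed

lemma card_UN_grp_containing:
  assumes "finite \<G>" "{} \<notin> \<G>"
  shows "card (\<Union>G\<in>\<G>. {V \<in> grp m. G \<subseteq> V}) \<le> cst * card \<G>"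
proof -
  have "card (\<Union>G\<in>\<G>. {V \<in> grp m. G \<subseteq> V}) \<le> (\<Sum>G\<in>\<G>. card {V \<in> grp m. G \<subseteq> V})"
    by (rule card_UN_le[OF assms(1)])
  also have "\<dots> \<le> (\<Sum>G\<in>\<G>. cst)"
    by (intro sum_mono card_grp_containing) (use assms in auto)
  finally show ?thesis by (simp add: mult.commute)
qed

lemma card_grp: "card (grp m) \<le> cst * (2 * L + 1)"
proof (cases "m = 0")
  case True
  have "V = {}" if "V \<in> grp m" for V using grpD(2)[OF that] grp_finite[OF that] True by simp
  then have "grp m \<subseteq> {{}}" by blast
  then have "card (grp m) \<le> card {{} :: int set}" by (rule card_mono[rotated]) simp
  also have "\<dots> \<le> cst * (2 * L + 1)"
    by (rule order_trans[of _ "1 * 1"]) (simp, intro mult_le_mono, simp_all)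
  finally show ?thesis .
next
  case False
  have "grp m \<subseteq> (\<Union>G\<in>(\<lambda>x. {x}) ` I. {V \<in> grp m. G \<subseteq> V})"
  proof
    fix V assume V: "V \<in> grp m"
    with False have "V \<noteq> {}" by (auto simp: grp_def)
    with V show "V \<in> (\<Union>G\<in>(\<lambda>x. {x}) ` I. {V \<in> grp m. G \<subseteq> V})"
      using grpD(1)[OF V] by auto
  qed
  then have "card (grp m) \<le> card (\<Union>G\<in>(\<lambda>x. {x}) ` I. {V \<in> grp m. G \<subseteq> V})"
    by (intro card_mono) auto
  also have "\<dots> \<le> cst * card ((\<lambda>x. {x}) ` I)"
    by (intro card_UN_grp_containing) auto
  also have "card ((\<lambda>x. {x}) ` I) = 2 * L + 1"
    by (simp add: card_image I_def)
  finally show ?thesis .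
qed

end

text \<open>Given an event that is decreasing in the sites of \<open>S\<close>, these sites are at
  most as likely to be all occupied as without it. The event \<open>H1\<close>, that
  \<open>H\<close> survives forcing \<open>S\<close> to be occupied, is independent of
  \<open>S\<close>, agrees with \<open>H\<close> where \<open>S\<close> is occupied, and is
  contained in \<open>H\<close>.\<close>

lemma (in bernoulli_field) prob_decreasing_occupied:
  assumes D: "finite D" "depends D H" and S: "finite S"
    and dec: "\<And>\<omega> \<omega>'. \<omega> \<in> H \<Longrightarrow> (\<And>z. \<omega>' z \<Longrightarrow> \<omega> z) \<Longrightarrow> (\<And>z. z \<notin> S \<Longrightarrow> \<omega>' z = \<omega> z) \<Longrightarrow> \<omega>' \<in> H"
  shows "prob (H \<inter> {\<omega>. \<forall>z\<in>S. \<omega> z}) \<le> p ^ card S * prob H"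
proof -
  define H1 where "H1 = {\<omega>. (\<lambda>z. z \<in> S \<or> \<omega> z) \<in> H}"
  have dep: "depends (D - S) H1"
  proof (rule dependsI)
    fix \<omega> \<omega>' :: "int \<times> int \<Rightarrow> bool"
    assume "\<And>z. z \<in> D - S \<Longrightarrow> \<omega> z = \<omega>' z" "\<omega> \<in> H1"
    then show "\<omega>' \<in> H1"
      using dependsD[OF D(2), of "\<lambda>z. z \<in> S \<or> \<omega> z" "\<lambda>z. z \<in> S \<or> \<omega>' z"]
      by (auto simp: H1_def)
  qed
  have sub: "H1 \<subseteq> H"
  proof
    fix \<omega> assume "\<omega> \<in> H1"
    then show "\<omega> \<in> H" unfolding H1_def by (intro dec[of "\<lambda>z. z \<in> S \<or> \<omega> z" \<omega>]) auto
  qed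
  have "H \<inter> {\<omega>. \<forall>z\<in>S. \<omega> z} = H1 \<inter> {\<omega>. \<forall>z\<in>S. \<omega> z}"
  proof -
    have "(\<lambda>z. z \<in> S \<or> \<omega> z) = \<omega>" if "\<forall>z\<in>S. \<omega> z" for \<omega> using that by auto
    then show ?thesis unfolding H1_def by auto
  qed
  then have "prob (H \<inter> {\<omega>. \<forall>z\<in>S. \<omega> z}) = prob H1 * prob {\<omega>. \<forall>z\<in>S. \<omega> z}"
    using prob_Int_depends[OF _ S _ dep depends_all_occupied[of S S]] D by auto
  also have "\<dots> = p ^ card S * prob H1" by (simp add: prob_all_occupied[OF S])
  also have "\<dots> \<le> p ^ card S * prob H"
    using p0 sub by (intro mult_left_mono finite_measure_mono depends_sets[OF D]) auto
  finally show ?thesis .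
qed

text \<open>Markov's inequality on \<open>H\<close> for a count of events; linearity of expectation
  needs no independence of the \<open>E g\<close>.\<close>

lemma (in prob_space) card_Markov:
  assumes "finite G" "H \<in> events" "\<And>g. g \<in> G \<Longrightarrow> E g \<in> events"
    and "{\<omega> \<in> H. t \<le> real (card {g \<in> G. \<omega> \<in> E g})} \<in> events"
  shows "t * prob {\<omega> \<in> H. t \<le> real (card {g \<in> G. \<omega> \<in> E g})} \<le> (\<Sum>g\<in>G. prob (H \<inter> E g))"
proof -
  let ?A = "{\<omega> \<in> H. t \<le> real (card {g \<in> G. \<omega> \<in> E g})}"
  have "t * prob ?A = expectation (\<lambda>\<omega>. t * indicator ?A \<omega>)"
    using assms(4) by simp
  also have "\<dots> \<le> expectation (\<lambda>\<omega>. \<Sum>g\<in>G. indicator (H \<inter> E g) \<omega>)"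
  proof (rule integral_mono)
    show "integrable M (\<lambda>\<omega>. t * indicat_real ?A \<omega>)"
      using assms(4) by (intro integrable_mult_right integrable_real_indicator) (auto simp: emeasure_eq_measure)
    show "integrable M (\<lambda>\<omega>. \<Sum>g\<in>G. indicat_real (H \<inter> E g) \<omega>)"
      using assms(2,3) by (intro Bochner_Integration.integrable_sum integrable_real_indicator) (auto simp: emeasure_eq_measure)
    fix \<omega>
    have "(\<Sum>g\<in>G. indicat_real (H \<inter> E g) \<omega>) = (if \<omega> \<in> H then real (card {g \<in> G. \<omega> \<in> E g}) else 0)"
    proof (cases "\<omega> \<in> H")
      case True
      have "(\<Sum>g\<in>G. indicat_real (H \<inter> E g) \<omega>) = (\<Sum>g\<in>G. if \<omega> \<in> E g then 1 else 0)"
        using True by (intro sum.cong) (auto simp: indicator_def)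
      also have "\<dots> = real (card {g \<in> G. \<omega> \<in> E g})"
        using assms(1) by (simp flip: sum.inter_filter)
      finally show ?thesis using True by simp
    qed simp
    then show "t * indicat_real ?A \<omega> \<le> (\<Sum>g\<in>G. indicat_real (H \<inter> E g) \<omega>)"
      by (auto simp: indicator_def)
  qed
  also have "\<dots> = (\<Sum>g\<in>G. prob (H \<inter> E g))"
    using assms(2,3) by (subst Bochner_Integration.integral_sum) (auto simp: emeasure_eq_measure)
  finally show ?thesis .
qed

section \<open>One half-round given the explored history\<close>

locale random_lines = bernoulli_field p + line_nucleation \<rho> L r s for p :: real and \<rho> L r s :: nat
begin

text \<open>Cut off to \<open>{}\<close> beyond \<open>k\<close>, so that one equation
  \<open>hist k \<omega> = h\<close> records all sets explored so far and nothing later.\<close>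

definition hist :: "nat \<Rightarrow> (int \<times> int \<Rightarrow> bool) \<Rightarrow> nat \<Rightarrow> int set" where
  "hist k \<omega> = (\<lambda>j. if j \<le> k then lines j \<omega> else {})"

lemma hist_depends:
  assumes "\<And>z. z \<in> I \<times> I \<Longrightarrow> \<omega> z = \<omega>' z"
  shows "hist k \<omega> = hist k \<omega>'"
  using lines_depends[of \<omega> \<omega>'] assms unfolding hist_def by metis

lemma finite_II [simp]: "finite (I \<times> I)" by simp

lemma depends_lines: "depends (I \<times> I) {\<omega>. P (lines k \<omega>)}"
  by (rule depends_vimage) (erule lines_depends)

lemma depends_hist: "depends (I \<times> I) {\<omega>. hist k \<omega> = h}"
  by (rule depends_vimage[where P = "\<lambda>x. x = h"]) (erule hist_depends)

text \<open>A line first filled in half-round \<open>k + 1\<close> has a witness using a line of \<open>lines k\<close> that was not there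
  two half-rounds before. The truncated \<open>k - 2\<close> is harmless since \<open>lines 0 = {}\<close>; for \<open>k \<le> 1\<close> there is no
  earlier half-round and every group is a witness.\<close>

definition witnesses :: "nat \<Rightarrow> (nat \<Rightarrow> int set) \<Rightarrow> int set set" where
  "witnesses k h = {V \<in> grp (threshold k). k \<le> 1 \<or> \<not> V \<inter> h k \<subseteq> h (k - 2)}"

text \<open>The union bound for filling one line that is not yet explored: each witness
  \<open>V\<close> still lacks the sites on lines outside \<open>h k\<close>, and these are occupied
  with probability \<open>p ^ card (V - h k)\<close>.\<close>

definition \<theta> :: "nat \<Rightarrow> (nat \<Rightarrow> int set) \<Rightarrow> real" where
  "\<theta> k h = (\<Sum>V\<in>witnesses k h. p ^ card (V - h k))"

lemma finite_witnesses [simp]: "finite (witnesses k h)" by (simp add: witnesses_def)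

lemma theta_nonneg: "0 \<le> \<theta> k h"
  unfolding \<theta>_def using p0 by (intro sum_nonneg) simp

lemma new_line_witness:
  assumes "v \<in> lines (Suc k) \<omega>" "v \<notin> lines (k - 1) \<omega>"
  shows "\<exists>V\<in>witnesses k (hist k \<omega>). \<forall>u\<in>V - lines k \<omega>. \<omega> (site k u v)"
proof -
  from assms(1) obtain V where V: "v \<in> I" "V \<in> grp (threshold k)" "\<forall>u\<in>V. \<omega> (site k u v) \<or> u \<in> lines k \<omega>"
    by (blast dest: lines_Suc_D)
  \<comment> \<open>If \<open>V\<close> relied only on lines known two half-rounds before, it would
    have filled \<open>v\<close> two half-rounds before.\<close>
  have "\<not> V \<inter> lines k \<omega> \<subseteq> lines (k - 2) \<omega>" if k: "k > 1"
  proof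
    assume *: "V \<inter> lines k \<omega> \<subseteq> lines (k - 2) \<omega>"
    define j where "j = k - 2"
    have j: "k = Suc (Suc j)" using k by (simp add: j_def)
    have "V \<in> grp (threshold j)" using V(2) by (simp add: j threshold_def)
    moreover have "\<omega> (site j u v) \<or> u \<in> lines j \<omega>" if "u \<in> V" for u
      using V(3) * that by (auto simp: j site_Suc)
    ultimately have "v \<in> lines (Suc j) \<omega>" by (rule lines_Suc_I[OF V(1)])
    with assms(2) show False by (simp add: j)
  qed
  then have "V \<in> witnesses k (hist k \<omega>)"
    using V(2) by (cases "k \<le> 1") (auto simp: witnesses_def hist_def)
  with V(3) show ?thesis by blast
qed

text \<open>Different lines \<open>v\<close> inspect disjoint sites, and all these sites lie off the
  explored lines. There the history is decreasing, so \<open>prob_decreasing_occupied\<close> yields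
  the product bound that independence would give.\<close>

lemma prob_new_lines:
  assumes g: "g \<subseteq> I" "g \<inter> h (k - 1) = {}"
  shows "prob ({\<omega>. hist k \<omega> = h} \<inter> {\<omega>. g \<subseteq> lines (Suc k) \<omega>}) \<le> \<theta> k h ^ card g * prob {\<omega>. hist k \<omega> = h}"
proof (cases "\<exists>\<omega>0. hist k \<omega>0 = h")
  case False
  then show ?thesis by simp
next
  case True
  then obtain \<omega>0 where h: "h = hist k \<omega>0" by blast
  let ?H = "{\<omega>. hist k \<omega> = h}"
  let ?\<Phi> = "Pi\<^sub>E g (\<lambda>_. witnesses k h)"
  \<comment> \<open>\<open>\<phi>\<close> chooses one witness for each line of \<open>g\<close>, and
    \<open>S \<phi>\<close> collects the sites these witnesses still need. Summing over all choices
    factorizes into \<open>\<theta> k h ^ card g\<close>.\<close>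
  define S where "S \<phi> = (\<Union>v\<in>g. (\<lambda>u. site k u v) ` (\<phi> v - h k))" for \<phi>
  have fing: "finite g" using g(1) finite_I finite_subset by blast
  have fin\<Phi>: "finite ?\<Phi>" by (intro finite_PiE fing) auto
  have finV: "finite (\<phi> v)" if "\<phi> \<in> ?\<Phi>" "v \<in> g" for \<phi> v
    using that grp_finite by (auto simp: witnesses_def PiE_iff)
  have finS: "finite (S \<phi>)" if "\<phi> \<in> ?\<Phi>" for \<phi>
    unfolding S_def using finV[OF that] fing by auto
  have ev: "?H \<in> events" by (rule depends_sets[OF finite_II depends_hist])
  have evS: "{\<omega>. \<forall>z\<in>S \<phi>. \<omega> z} \<in> events" if "\<phi> \<in> ?\<Phi>" for \<phi>
    by (rule depends_sets[OF finS[OF that] depends_all_occupied]) simp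
  have cardS: "card (S \<phi>) = (\<Sum>v\<in>g. card (\<phi> v - h k))" if "\<phi> \<in> ?\<Phi>" for \<phi>
  proof -
    have "card (S \<phi>) = (\<Sum>v\<in>g. card ((\<lambda>u. site k u v) ` (\<phi> v - h k)))"
      unfolding S_def using finV[OF that] fing by (intro card_UN_disjoint) auto
    also have "\<dots> = (\<Sum>v\<in>g. card (\<phi> v - h k))"
      by (intro sum.cong refl card_image) (auto simp: inj_on_def)
    finally show ?thesis .
  qed
  have "?H \<inter> {\<omega>. g \<subseteq> lines (Suc k) \<omega>} \<subseteq> (\<Union>\<phi>\<in>?\<Phi>. ?H \<inter> {\<omega>. \<forall>z\<in>S \<phi>. \<omega> z})"
  proof
    fix \<omega> assume "\<omega> \<in> ?H \<inter> {\<omega>. g \<subseteq> lines (Suc k) \<omega>}"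
    then have hw: "hist k \<omega> = h" and gX: "g \<subseteq> lines (Suc k) \<omega>" by auto
    have hk: "h k = lines k \<omega>" and hk1: "h (k - 1) = lines (k - 1) \<omega>" using hw by (auto simp: hist_def)
    have "\<exists>V. V \<in> witnesses k h \<and> (\<forall>u\<in>V - h k. \<omega> (site k u v))" if "v \<in> g" for v
    proof -
      have "v \<in> lines (Suc k) \<omega>" "v \<notin> lines (k - 1) \<omega>" using that gX g(2) hk1 by auto
      from new_line_witness[OF this] show ?thesis using hw hk by blast
    qed
    then obtain \<phi> where \<phi>: "\<And>v. v \<in> g \<Longrightarrow> \<phi> v \<in> witnesses k h \<and> (\<forall>u\<in>\<phi> v - h k. \<omega> (site k u v))"
      by metis
    then have "restrict \<phi> g \<in> ?\<Phi>" "\<forall>z\<in>S (restrict \<phi> g). \<omega> z" by (auto simp: S_def)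
    with hw show "\<omega> \<in> (\<Union>\<phi>\<in>?\<Phi>. ?H \<inter> {\<omega>. \<forall>z\<in>S \<phi>. \<omega> z})" by blast
  qed
  then have "prob (?H \<inter> {\<omega>. g \<subseteq> lines (Suc k) \<omega>}) \<le> prob (\<Union>\<phi>\<in>?\<Phi>. ?H \<inter> {\<omega>. \<forall>z\<in>S \<phi>. \<omega> z})"
    using ev evS fin\<Phi> by (intro finite_measure_mono sets.finite_UN sets.Int) auto
  also have "\<dots> \<le> (\<Sum>\<phi>\<in>?\<Phi>. prob (?H \<inter> {\<omega>. \<forall>z\<in>S \<phi>. \<omega> z}))"
    using ev evS fin\<Phi> by (intro finite_measure_subadditive_finite) auto
  also have "\<dots> \<le> (\<Sum>\<phi>\<in>?\<Phi>. p ^ card (S \<phi>) * prob ?H)"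
  proof (intro sum_mono prob_decreasing_occupied[OF finite_II depends_hist finS])
    fix \<phi> \<omega> \<omega>'
    assume \<phi>: "\<phi> \<in> ?\<Phi>" and \<omega>: "\<omega> \<in> ?H" and le: "\<And>z. \<omega>' z \<Longrightarrow> \<omega> z"
      and off: "\<And>z. z \<notin> S \<phi> \<Longrightarrow> \<omega>' z = \<omega> z"
    have hX: "h j = lines j \<omega>" if "j \<le> k" for j using \<omega> that by (auto simp: hist_def)
    \<comment> \<open>Lines of one parity only accumulate. Hence avoiding \<open>h k\<close> and
      \<open>h (k - 1)\<close> means avoiding every line of the history, of either kind.\<close>
    have mono: "lines j \<omega> \<subseteq> lines i \<omega>" if "j \<le> i" "even j = even i" for i j
      using that
    proof (induction "i - j" arbitrary: j rule: less_induct)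
      case less
      show ?case
      proof (cases "j = i")
        case False
        with less.prems have "Suc (Suc j) \<le> i" by presburger
        then have "i - Suc (Suc j) < i - j" by linarith
        then have "lines (Suc (Suc j)) \<omega> \<subseteq> lines i \<omega>"
          using \<open>Suc (Suc j) \<le> i\<close> less.prems(2) by (intro less.hyps) auto
        with lines_Suc_Suc[of j \<omega>] show ?thesis by blast
      qed simp
    qed
    have "lines j \<omega>' = lines j \<omega>" if "j \<le> k" for j
    proof (rule lines_stable_off_lines[OF le _ that])
      fix z i assume i: "i \<le> k" and on: "on_lines i (lines i \<omega>) z"
      have "z \<notin> S \<phi>"
      proof
        assume "z \<in> S \<phi>"
        then obtain v u where vu: "v \<in> g" "u \<in> \<phi> v - h k" "z = site k u v" by (auto simp: S_def)
        show False
        proof (cases "even i = even k")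
          case True
          then have "u \<in> lines i \<omega>" using on vu(3) on_lines_parity[OF True] by simp
          with mono[OF i True] vu(2) hX[of k] show False by auto
        next
          case False
          then have "on_lines (Suc k) (lines i \<omega>) z" using on on_lines_parity[of i "Suc k"] by simp
          then have "v \<in> lines i \<omega>" using vu(3) by simp
          moreover have "i \<le> k - 1" "even i = even (k - 1)" using False i by presburger+
          ultimately have "v \<in> h (k - 1)" using mono[of i "k - 1"] hX[of "k - 1"] by auto
          with vu(1) g(2) show False by blast
        qed
      qed
      then show "\<omega>' z = \<omega> z" by (rule off)
    qed
    then have "hist k \<omega>' = hist k \<omega>" by (auto simp: hist_def fun_eq_iff)
    then show "\<omega>' \<in> ?H" using \<omega> by simp
  qed
  also have "\<dots> = (\<Sum>\<phi>\<in>?\<Phi>. \<Prod>v\<in>g. p ^ card (\<phi> v - h k)) * prob ?H"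
    by (simp add: cardS power_sum sum_distrib_right cong: sum.cong)
  also have "(\<Sum>\<phi>\<in>?\<Phi>. \<Prod>v\<in>g. p ^ card (\<phi> v - h k)) = \<theta> k h ^ card g"
    using fing unfolding \<theta>_def by (subst prod_sum_PiE[symmetric]) auto
  finally show ?thesis .
qed

end

section \<open>First moment bounds under the subcritical conditions\<close>

context random_lines
begin

lemma newgrp_nonempty: "{} \<notin> newgrp i A A'"
  by (simp add: newgrp_def)

lemma newgrp_empty [simp]: "newgrp i {} A' = {}"
  by (auto simp: newgrp_def)

text \<open>Witnesses are sorted by the number \<open>i\<close> of their lines already filled. For
  \<open>i \<ge> 1\<close> these lines form a new group, and a group extends to at most
  \<open>cst\<close> witnesses. If \<open>u * \<nu> * D ^ i < 1\<close>, an integer count below one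
  vanishes; otherwise the class contributes at most \<open>cst * u * x\<close>. The
  \<open>threshold k + 1\<close> classes give the constant.\<close>

lemma theta_le:
  fixes u D \<nu> x :: real
  assumes first: "k \<le> 1 \<Longrightarrow> h (k - 2) = {}" "k \<le> 1 \<Longrightarrow> 1 \<le> u"
    and cnt: "\<And>i. 1 \<le> i \<Longrightarrow> i \<le> threshold k \<Longrightarrow> real (card (newgrp i (h k) (h (k - 2)))) \<le> u * \<nu> * D ^ i"
    and \<nu>: "2 * real L + 1 \<le> \<nu>" and nonneg: "0 \<le> u" "0 \<le> D" "0 \<le> x"
    and cond: "\<And>i. i \<le> threshold k \<Longrightarrow> u * \<nu> * D ^ i < 1 \<or> \<nu> * D ^ i * p ^ (threshold k - i) \<le> x"
  shows "\<theta> k h \<le> real ((threshold k + 1) * cst) * u * x"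
proof -
  define W where "W i = {V \<in> witnesses k h. card (V \<inter> h k) = i}" for i
  have witnessesD: "V \<in> grp (threshold k)" "k \<le> 1 \<or> \<not> V \<inter> h k \<subseteq> h (k - 2)" if "V \<in> witnesses k h" for V
    using that by (auto simp: witnesses_def)
  have cap: "card (V \<inter> h k) \<le> threshold k" if "V \<in> grp (threshold k)" for V
    using card_mono[OF grp_finite[OF that], of "V \<inter> h k"] grpD(2)[OF that] by simp
  have "\<theta> k h = (\<Sum>i\<le>threshold k. \<Sum>V\<in>W i. p ^ card (V - h k))"
    unfolding \<theta>_def W_def using cap witnessesD(1) by (intro sum.group[symmetric]) auto
  also have "\<dots> = (\<Sum>i\<le>threshold k. real (card (W i)) * p ^ (threshold k - i))"
  proof (intro sum.cong refl)
    fix i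
    have "p ^ card (V - h k) = p ^ (threshold k - i)" if "V \<in> W i" for V
    proof -
      from that have V: "V \<in> grp (threshold k)" "card (V \<inter> h k) = i" using witnessesD(1) by (auto simp: W_def)
      have "card (V - h k) = card V - card (V \<inter> h k)"
        by (rule card_Diff_subset_Int) (simp add: grp_finite[OF V(1)])
      with V(2) grpD(2)[OF V(1)] show ?thesis by simp
    qed
    then show "(\<Sum>V\<in>W i. p ^ card (V - h k)) = real (card (W i)) * p ^ (threshold k - i)" by simp
  qed
  also have "\<dots> \<le> (\<Sum>i\<le>threshold k. real cst * u * x)"
  proof (intro sum_mono)
    fix i assume i: "i \<in> {..threshold k}"
    have W: "real (card (W i)) \<le> real cst * (u * \<nu> * D ^ i) \<and> (u * \<nu> * D ^ i < 1 \<longrightarrow> W i = {})"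
    proof (cases "i = 0")
      \<comment> \<open>Witnesses without any filled line occur only for \<open>k \<le> 1\<close>.
        There the count of all groups is good enough, because \<open>1 \<le> u\<close>.\<close>
      case True
      show ?thesis
      proof (cases "k \<le> 1")
        case k: True
        have "card (W i) \<le> card (grp (threshold k))"
          using witnessesD(1) by (intro card_mono) (auto simp: W_def)
        also have "\<dots> \<le> cst * (2 * L + 1)" by (rule card_grp)
        finally have "real (card (W i)) \<le> real (cst * (2 * L + 1))" by (simp only: of_nat_le_iff)
        also have "\<dots> = real cst * (1 * (2 * real L + 1))" by (simp add: algebra_simps)
        also have "\<dots> \<le> real cst * (u * \<nu>)"
          using \<nu> first(2)[OF k] by (intro mult_left_mono mult_mono) auto
        finally have "real (card (W i)) \<le> real cst * (u * \<nu>)" .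
        moreover have "1 * 1 \<le> u * \<nu>" using \<nu> first(2)[OF k] by (intro mult_mono) auto
        ultimately show ?thesis using True by simp
      next
        case False
        have "V \<notin> W i" for V
        proof
          assume V: "V \<in> W i"
          then have "finite V" using witnessesD(1) grp_finite by (auto simp: W_def)
          with V True have "V \<inter> h k = {}" by (simp add: W_def)
          with V witnessesD(2)[of V] False show False by (simp add: W_def)
        qed
        then have "W i = {}" by blast
        moreover have "0 \<le> real cst * (u * \<nu> * D ^ i)" using nonneg \<nu> by simp
        ultimately show ?thesis by simp
      qed
    next
      case False
      then have i1: "1 \<le> i" "i \<le> threshold k" using i by auto
      let ?N = "newgrp i (h k) (h (k - 2))"
      have sub: "W i \<subseteq> (\<Union>G\<in>?N. {V \<in> grp (threshold k). G \<subseteq> V})"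
      proof
        fix V assume V: "V \<in> W i"
        then have Vg: "V \<in> grp (threshold k)" and c: "card (V \<inter> h k) = i" using witnessesD(1) by (auto simp: W_def)
        have "V \<inter> h k \<noteq> {}" using c False by auto
        then have "\<not> V \<inter> h k \<subseteq> h (k - 2)"
          using witnessesD(2)[of V] V first(1) by (auto simp: W_def)
        moreover have "V \<inter> h k \<in> grp i" using grp_subset[OF Vg, of "V \<inter> h k"] c by auto
        ultimately have "V \<inter> h k \<in> ?N" by (simp add: newgrp_def)
        then show "V \<in> (\<Union>G\<in>?N. {V \<in> grp (threshold k). G \<subseteq> V})" using Vg by blast
      qed
      then have "card (W i) \<le> card (\<Union>G\<in>?N. {V \<in> grp (threshold k). G \<subseteq> V})"
        by (intro card_mono) auto
      also have "\<dots> \<le> cst * card ?N"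
        by (rule card_UN_grp_containing) (auto simp: newgrp_nonempty)
      finally have "real (card (W i)) \<le> real (cst * card ?N)" by (simp only: of_nat_le_iff)
      also have "\<dots> = real cst * real (card ?N)" by simp
      also have "\<dots> \<le> real cst * (u * \<nu> * D ^ i)"
        using cnt[OF i1] by (intro mult_left_mono) auto
      finally have 1: "real (card (W i)) \<le> real cst * (u * \<nu> * D ^ i)" .
      have 2: "W i = {}" if "u * \<nu> * D ^ i < 1"
      proof -
        have "real (card ?N) < 1" using cnt[OF i1] that by linarith
        then have "?N = {}" by (simp add: card_eq_0_iff)
        with sub show ?thesis by blast
      qed
      from 1 2 show ?thesis by blast
    qed
    from cond[of i] i consider "u * \<nu> * D ^ i < 1" | "\<nu> * D ^ i * p ^ (threshold k - i) \<le> x" by auto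
    then show "real (card (W i)) * p ^ (threshold k - i) \<le> real cst * u * x"
    proof cases
      case 1
      then show ?thesis using W nonneg by simp
    next
      case 2
      have "real (card (W i)) * p ^ (threshold k - i) \<le> real cst * (u * \<nu> * D ^ i) * p ^ (threshold k - i)"
        using W p0 by (intro mult_right_mono) auto
      also have "\<dots> = real cst * u * (\<nu> * D ^ i * p ^ (threshold k - i))" by simp
      also have "\<dots> \<le> real cst * u * x" using 2 nonneg by (intro mult_left_mono) auto
      finally show ?thesis .
    qed
  qed
  also have "\<dots> = real ((threshold k + 1) * cst) * u * x" by (simp add: algebra_simps)
  finally show ?thesis .
qed

text \<open>Every group inside \<open>lines j\<close> is complete for the first time at some
  half-round of the parity of \<open>j\<close>; going back two half-rounds at a time, the new groups
  add up.\<close>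

lemma card_groups_le:
  fixes b :: real
  assumes "1 \<le> l" "0 \<le> b"
    and "\<And>i. 1 \<le> i \<Longrightarrow> i \<le> j \<Longrightarrow> even i = even j \<Longrightarrow> real (card (newgrp l (lines i \<omega>) (lines (i - 2) \<omega>))) \<le> b"
  shows "real (card {G \<in> grp l. G \<subseteq> lines j \<omega>}) \<le> real j * b"
  using assms(3)
proof (induction j rule: less_induct)
  case (less j)
  show ?case
  proof (cases "j = 0")
    case True
    have "{G \<in> grp l. G \<subseteq> lines j \<omega>} = {}" using True assms(1) by (auto simp: grp_def)
    then show ?thesis by (simp add: True)
  next
    case False
    have split: "{G \<in> grp l. G \<subseteq> lines j \<omega>} \<subseteq>
        newgrp l (lines j \<omega>) (lines (j - 2) \<omega>) \<union> {G \<in> grp l. G \<subseteq> lines (j - 2) \<omega>}"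
      by (auto simp: newgrp_def)
    have prev: "real (card {G \<in> grp l. G \<subseteq> lines (j - 2) \<omega>}) \<le> real (j - 2) * b"
    proof (rule less.IH)
      fix i assume "1 \<le> i" "i \<le> j - 2" "even i = even (j - 2)"
      then show "real (card (newgrp l (lines i \<omega>) (lines (i - 2) \<omega>))) \<le> b"
        by (intro less.prems) auto
    qed (use False in simp)
    have "card {G \<in> grp l. G \<subseteq> lines j \<omega>} \<le>
        card (newgrp l (lines j \<omega>) (lines (j - 2) \<omega>) \<union> {G \<in> grp l. G \<subseteq> lines (j - 2) \<omega>})"
      using split by (intro card_mono) auto
    also have "\<dots> \<le> card (newgrp l (lines j \<omega>) (lines (j - 2) \<omega>)) + card {G \<in> grp l. G \<subseteq> lines (j - 2) \<omega>}"
      by (rule card_Un_le)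
    finally have "real (card {G \<in> grp l. G \<subseteq> lines j \<omega>}) \<le>
        real (card (newgrp l (lines j \<omega>) (lines (j - 2) \<omega>))) + real (card {G \<in> grp l. G \<subseteq> lines (j - 2) \<omega>})"
      by linarith
    also have "\<dots> \<le> b + real (j - 2) * b"
      using False prev by (intro add_mono less.prems) auto
    also have "\<dots> = real (1 + (j - 2)) * b" by (simp add: distrib_right)
    also have "\<dots> \<le> real j * b"
      using False assms(2) by (intro mult_right_mono) auto
    finally show ?thesis .
  qed
qed

end

text \<open>\<open>\<nu>\<close> bounds the number of lines of each kind, rows have density \<open>p\<close>, columns density \<open>Q\<close>, and each
  half-round gains a factor \<open>g\<close>. In \<open>cond_even\<close> and \<open>cond_odd\<close> the first alternative says that
  groups of \<open>i\<close> lines do not occur at all.\<close>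

locale subcritical_lines = random_lines p \<rho> L r s for p :: real and \<rho> L r s :: nat +
  fixes \<nu> Q g :: real
  assumes p_pos: "0 < p" and Q: "0 < Q" "Q \<le> 1" and g: "0 < g" "g \<le> 1"
    and sr: "1 \<le> s" "s \<le> r"
    and \<nu>: "2 * real L + 1 \<le> \<nu>"
    and small: "real ((r + 1) * 2 ^ (4 * \<rho> + 1)) * g \<le> 1"
    and cond_even: "\<And>i. i \<le> s \<Longrightarrow> \<nu> * p ^ i < g \<or> \<nu> * p ^ i * p ^ (s - i) \<le> g ^ 2 * Q"
    and cond_odd: "\<And>i. i \<le> r \<Longrightarrow> \<nu> * Q ^ i < g \<or> \<nu> * Q ^ i * p ^ (r - i) \<le> g ^ 2 * p"
begin

definition dens :: "nat \<Rightarrow> real" where "dens k = (if even k then p else Q)"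
text \<open>This is \<open>g\<close> to the power \<open>k - 1\<close>, with the value
  \<open>1 / g\<close> at \<open>k = 0\<close> and \<open>1\<close> at \<open>k = 1\<close>. Since
  \<open>gain k \<le> 1 / g\<close> in all cases, comparing \<open>\<nu> * dens k ^ i\<close> with
  \<open>g\<close> excludes groups at every half-round.\<close>

definition gain :: "nat \<Rightarrow> real" where "gain k = g ^ k / g"
definition C0 :: real where "C0 = real ((r + 1) * cst)"

lemma dens_pos: "0 < dens k" and dens_le_1: "dens k \<le> 1"
  using p_pos p1 Q by (auto simp: dens_def)

lemma dens_parity: "even i = even j \<Longrightarrow> dens i = dens j"
  by (simp add: dens_def)

lemma gain_pos: "0 < gain k" using g by (simp add: gain_def)

lemma gain_Suc: "gain (Suc k) = g * gain k" by (simp add: gain_def)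

lemma gain_le_1: "1 \<le> k \<Longrightarrow> gain k \<le> 1"
proof -
  assume "1 \<le> k"
  then obtain j where "k = Suc j" by (cases k) auto
  then show ?thesis using g by (simp add: gain_def power_le_one)
qed

lemma gain_le_inv: "gain k \<le> 1 / g"
  using g by (auto simp: gain_def power_le_one intro!: divide_right_mono)

lemma gain_ge_1: "k \<le> 1 \<Longrightarrow> 1 \<le> gain k"
  using g by (cases k) (auto simp: gain_def)

lemma nu_pos: "0 < \<nu>" "1 \<le> \<nu>" using \<nu> by linarith+

text \<open>The expected number of groups of \<open>i\<close> nearby new lines is about \<open>\<nu> * dens j ^ i\<close>, up to the gain
  that makes the cascade die out.\<close>

definition Good :: "nat \<Rightarrow> (nat \<Rightarrow> int set) \<Rightarrow> bool" where
  "Good k h \<longleftrightarrow> (\<forall>j. 1 \<le> j \<longrightarrow> j \<le> k \<longrightarrow> (\<forall>i. 1 \<le> i \<longrightarrow> i \<le> r \<longrightarrow>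
     real (card (newgrp i (h j) (h (j - 2)))) \<le> gain j * \<nu> * dens j ^ i))"

lemma threshold_le: "threshold k \<le> r" using sr by (simp add: threshold_def)

text \<open>The factor \<open>g ^ 2\<close> of the conditions is spent in two ways: one
  \<open>g\<close> turns \<open>gain k\<close> into \<open>gain (Suc k)\<close>, the other stays as
  the margin that makes Markov's inequality effective.\<close>

lemma theta_Good:
  assumes h: "h = hist k \<omega>0" and Good: "Good k h"
  shows "\<theta> k h \<le> C0 * g * gain (Suc k) * dens (Suc k)"
proof -
  have "\<theta> k h \<le> real ((threshold k + 1) * cst) * gain k * (g ^ 2 * dens (Suc k))"
  proof (rule theta_le[where \<nu> = \<nu> and D = "dens k"])
    show "h (k - 2) = {}" if "k \<le> 1" using that by (simp add: h hist_def)
    show "1 \<le> gain k" if "k \<le> 1" using that by (rule gain_ge_1)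
    show "2 * real L + 1 \<le> \<nu>" by (rule \<nu>)
    show "0 \<le> gain k" "0 \<le> dens k" "0 \<le> g ^ 2 * dens (Suc k)"
      using gain_pos[of k] dens_pos[of k] dens_pos[of "Suc k"] by auto
    show "real (card (newgrp i (h k) (h (k - 2)))) \<le> gain k * \<nu> * dens k ^ i"
      if "1 \<le> i" "i \<le> threshold k" for i
    proof (cases "k = 0")
      case True
      then have "h k = {}" by (simp add: h hist_def)
      then show ?thesis using gain_pos[of k] dens_pos[of k] nu_pos by simp
    next
      case False
      then show ?thesis using Good that threshold_le[of k] by (auto simp: Good_def)
    qed
    show "gain k * \<nu> * dens k ^ i < 1 \<or> \<nu> * dens k ^ i * p ^ (threshold k - i) \<le> g ^ 2 * dens (Suc k)"
      if "i \<le> threshold k" for i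
    proof -
      have "gain k * \<nu> * dens k ^ i < 1" if "\<nu> * dens k ^ i < g"
      proof -
        have "gain k * (\<nu> * dens k ^ i) \<le> 1 / g * (\<nu> * dens k ^ i)"
          using gain_le_inv nu_pos dens_pos[of k] by (intro mult_right_mono) auto
        also have "\<dots> < 1" using that g by (simp add: field_simps)
        finally show ?thesis by (simp add: mult.assoc)
      qed
      moreover have "\<nu> * dens k ^ i < g \<or> \<nu> * dens k ^ i * p ^ (threshold k - i) \<le> g ^ 2 * dens (Suc k)"
        using cond_even[of i] cond_odd[of i] that by (auto simp: threshold_def dens_def)
      ultimately show ?thesis by blast
    qed
  qed
  also have "\<dots> \<le> C0 * gain k * (g ^ 2 * dens (Suc k))"
    using threshold_le[of k] gain_pos[of k] dens_pos[of "Suc k"]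
    unfolding C0_def by (intro mult_right_mono mult_nonneg_nonneg) (auto intro!: mult_right_mono)
  also have "\<dots> = C0 * g * gain (Suc k) * dens (Suc k)"
    by (simp add: gain_Suc power2_eq_square)
  finally show ?thesis .
qed

text \<open>A new group of size \<open>i\<close> may contain \<open>l < i\<close> old lines. It is
  then an extension of an old group of size \<open>l\<close>, and only the other
  \<open>i - l\<close> lines have to be filled now. Summed over \<open>l\<close>, the expected
  number falls below the threshold by a factor of order \<open>g\<close>.\<close>

lemma prob_many_groups:
  assumes h: "h = hist k \<omega>0" and Good: "Good k h" and i: "1 \<le> i" "i \<le> r"
  shows "prob ({\<omega>. hist k \<omega> = h} \<inter>
      {\<omega>. gain (Suc k) * \<nu> * dens (Suc k) ^ i \<le> real (card (newgrp i (lines (Suc k) \<omega>) (h (k - 1))))})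
    \<le> real (r * cst * (k + 1)) * C0 * g * prob {\<omega>. hist k \<omega> = h}" (is "prob (?H \<inter> ?E) \<le> _")
proof -
  let ?B = "h (k - 1)" and ?D = "dens (Suc k)" and ?t = "gain (Suc k) * \<nu> * dens (Suc k) ^ i"
  define \<phi> where "\<phi> = C0 * g * gain (Suc k)"
  define Gs where "Gs = {G \<in> grp i. \<not> G \<subseteq> ?B}"
  define PH where "PH = prob ?H"
  have PH: "0 \<le> PH" by (simp add: PH_def)
  have D: "0 < ?D" "?D \<le> 1" by (rule dens_pos dens_le_1)+
  have t: "0 < ?t" using gain_pos[of "Suc k"] nu_pos D by simp
  have C0g: "0 \<le> C0 * g" "C0 * g \<le> 1" using g small by (auto simp: C0_def)
  have \<phi>: "0 \<le> \<phi>" "\<phi> \<le> 1"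
    using C0g gain_pos[of "Suc k"] gain_le_1[of "Suc k"] mult_mono[of "C0 * g" 1 "gain (Suc k)" 1]
    by (auto simp: \<phi>_def)
  have \<theta>: "\<theta> k h \<le> \<phi> * ?D" using theta_Good[OF h Good] by (simp add: \<phi>_def)
  have finGs: "finite Gs" by (simp add: Gs_def)
  have evH: "?H \<in> events" by (rule depends_sets[OF finite_II depends_hist])
  have evX: "{\<omega>. P (lines (Suc k) \<omega>)} \<in> events" for P by (rule depends_sets[OF finite_II depends_lines])
  have B: "?B = lines (k - 1) \<omega>0" by (simp add: h hist_def)
  have cap: "card (G \<inter> ?B) < i" "card (G - ?B) = i - card (G \<inter> ?B)" if "G \<in> Gs" for G
  proof -
    from that have G: "G \<in> grp i" "\<not> G \<subseteq> ?B" by (auto simp: Gs_def)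
    have fG: "finite G" by (rule grp_finite[OF G(1)])
    have "G \<inter> ?B \<subset> G" using G(2) by blast
    then show "card (G \<inter> ?B) < i" using psubset_card_mono[OF fG] grpD(2)[OF G(1)] by simp
    show "card (G - ?B) = i - card (G \<inter> ?B)"
      using card_Diff_subset_Int[of G ?B] fG grpD(2)[OF G(1)] by simp
  qed
  \<comment> \<open>Old groups of size \<open>l\<close> number at most \<open>\<nu> * ?D ^ l\<close>
    per half-round, as \<open>gain j \<le> 1\<close> from \<open>j = 1\<close> on. For
    \<open>l = 0\<close> all groups are counted.\<close>
  have count: "real (card {G \<in> Gs. card (G \<inter> ?B) = l}) \<le> real (cst * (k + 1)) * \<nu> * ?D ^ l" if "l < i" for l
  proof (cases "l = 0")
    case True
    have "card {G \<in> Gs. card (G \<inter> ?B) = l} \<le> card (grp i)"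
      by (intro card_mono) (auto simp: Gs_def)
    also have "\<dots> \<le> cst * (2 * L + 1)" by (rule card_grp)
    finally have "real (card {G \<in> Gs. card (G \<inter> ?B) = l}) \<le> real (cst * (2 * L + 1))"
      by (simp only: of_nat_le_iff)
    also have "\<dots> = real cst * (2 * real L + 1)" by (simp add: algebra_simps)
    also have "\<dots> \<le> real (cst * (k + 1)) * \<nu>"
      using \<nu> by (intro mult_mono) auto
    finally show ?thesis by (simp add: True)
  next
    case False
    let ?N = "{G \<in> grp l. G \<subseteq> ?B}"
    have N: "real (card ?N) \<le> real (k - 1) * (\<nu> * ?D ^ l)"
      unfolding B
    proof (rule card_groups_le)
      fix j assume j: "1 \<le> j" "j \<le> k - 1" "even j = even (k - 1)"
      then have "dens j = ?D" by (intro dens_parity) auto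
      moreover have "real (card (newgrp l (h j) (h (j - 2)))) \<le> gain j * \<nu> * dens j ^ l"
        using Good j False that i by (auto simp: Good_def)
      moreover have "gain j * \<nu> * dens j ^ l \<le> 1 * \<nu> * dens j ^ l"
        using gain_le_1[OF j(1)] nu_pos dens_pos[of j] by (intro mult_right_mono) auto
      moreover have "h j = lines j \<omega>0" "h (j - 2) = lines (j - 2) \<omega>0" using j by (auto simp: h hist_def)
      ultimately show "real (card (newgrp l (lines j \<omega>0) (lines (j - 2) \<omega>0))) \<le> \<nu> * ?D ^ l" by simp
    qed (use False nu_pos D in auto)
    have "{G \<in> Gs. card (G \<inter> ?B) = l} \<subseteq> (\<Union>G\<in>?N. {V \<in> grp i. G \<subseteq> V})"
    proof
      fix V assume V: "V \<in> {G \<in> Gs. card (G \<inter> ?B) = l}"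
      then have "V \<in> grp i" by (simp add: Gs_def)
      moreover have "V \<inter> ?B \<in> ?N" using grp_subset[OF \<open>V \<in> grp i\<close>, of "V \<inter> ?B"] V by auto
      ultimately show "V \<in> (\<Union>G\<in>?N. {V \<in> grp i. G \<subseteq> V})" by blast
    qed
    then have "card {G \<in> Gs. card (G \<inter> ?B) = l} \<le> card (\<Union>G\<in>?N. {V \<in> grp i. G \<subseteq> V})"
      by (intro card_mono) auto
    also have "\<dots> \<le> cst * card ?N"
      using False by (intro card_UN_grp_containing) (auto simp: grp_def)
    finally have "real (card {G \<in> Gs. card (G \<inter> ?B) = l}) \<le> real (cst * card ?N)"
      by (simp only: of_nat_le_iff)
    also have "\<dots> = real cst * real (card ?N)" by simp
    also have "\<dots> \<le> real cst * (real (k - 1) * (\<nu> * ?D ^ l))"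
      using N by (intro mult_left_mono) auto
    also have "\<dots> \<le> real cst * (real (k + 1) * (\<nu> * ?D ^ l))"
      using nu_pos D by (intro mult_left_mono mult_right_mono) auto
    also have "\<dots> = real (cst * (k + 1)) * \<nu> * ?D ^ l"
      by (simp only: of_nat_mult mult_ac)
    finally show ?thesis .
  qed
  have "?t * prob (?H \<inter> ?E) \<le> (\<Sum>G\<in>Gs. prob (?H \<inter> {\<omega>. G \<subseteq> lines (Suc k) \<omega>}))"
  proof -
    have "{\<omega> \<in> ?H. ?t \<le> real (card {G \<in> Gs. \<omega> \<in> {\<omega>. G \<subseteq> lines (Suc k) \<omega>}})} = ?H \<inter> ?E"
    proof -
      have "{G \<in> Gs. G \<subseteq> A} = newgrp i A ?B" for A by (auto simp: newgrp_def Gs_def)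
      then show ?thesis by auto
    qed
    moreover have "?H \<inter> ?E \<in> events" by (intro sets.Int evH evX)
    moreover have "{\<omega>. G \<subseteq> lines (Suc k) \<omega>} \<in> events" for G by (rule evX)
    ultimately show ?thesis
      using card_Markov[OF finGs evH, of "\<lambda>G. {\<omega>. G \<subseteq> lines (Suc k) \<omega>}" ?t] by simp
  qed
  also have "\<dots> \<le> (\<Sum>G\<in>Gs. \<theta> k h ^ (i - card (G \<inter> ?B)) * PH)"
  proof (intro sum_mono)
    fix G assume G: "G \<in> Gs"
    have "prob (?H \<inter> {\<omega>. G \<subseteq> lines (Suc k) \<omega>}) \<le> prob (?H \<inter> {\<omega>. G - ?B \<subseteq> lines (Suc k) \<omega>})"
      using evH evX by (intro finite_measure_mono) auto
    also have "\<dots> \<le> \<theta> k h ^ card (G - ?B) * PH"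
      unfolding PH_def using G grpD(1) by (intro prob_new_lines) (auto simp: Gs_def)
    finally show "prob (?H \<inter> {\<omega>. G \<subseteq> lines (Suc k) \<omega>}) \<le> \<theta> k h ^ (i - card (G \<inter> ?B)) * PH"
      using cap(2)[OF G] by simp
  qed
  also have "\<dots> = (\<Sum>l<i. \<Sum>G\<in>{G \<in> Gs. card (G \<inter> ?B) = l}. \<theta> k h ^ (i - card (G \<inter> ?B)) * PH)"
    using cap(1) by (intro sum.group[symmetric] finGs) auto
  also have "\<dots> = (\<Sum>l<i. real (card {G \<in> Gs. card (G \<inter> ?B) = l}) * (\<theta> k h ^ (i - l) * PH))"
    by (intro sum.cong refl) simp
  also have "\<dots> \<le> (\<Sum>l<i. (real (cst * (k + 1)) * \<nu> * ?D ^ i * \<phi>) * PH)"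
  proof (intro sum_mono)
    fix l assume l: "l \<in> {..<i}"
    have "\<theta> k h ^ (i - l) \<le> (\<phi> * ?D) ^ (i - l)" by (intro power_mono \<theta> theta_nonneg)
    also have "\<dots> = \<phi> ^ (i - l) * ?D ^ (i - l)" by (simp add: power_mult_distrib)
    \<comment> \<open>At least one line of the group is new, so \<open>i - l \<ge> 1\<close> and one
      factor \<open>\<phi>\<close> survives. It carries both \<open>gain (Suc k)\<close>, which the
      threshold contains, and the margin \<open>C0 * g\<close>.\<close>
    also have "\<dots> \<le> \<phi> * ?D ^ (i - l)"
    proof (rule mult_right_mono)
      show "\<phi> ^ (i - l) \<le> \<phi>" using l \<phi> power_decreasing[of 1 "i - l" \<phi>] by simp
    qed (use D in simp)
    finally have "real (card {G \<in> Gs. card (G \<inter> ?B) = l}) * (\<theta> k h ^ (i - l) * PH)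
        \<le> real (cst * (k + 1)) * \<nu> * ?D ^ l * (\<phi> * ?D ^ (i - l) * PH)"
      using count[of l] l PH nu_pos D theta_nonneg by (intro mult_mono mult_right_mono mult_nonneg_nonneg) auto
    also have "\<dots> = real (cst * (k + 1)) * \<nu> * (?D ^ l * ?D ^ (i - l)) * \<phi> * PH" by simp
    also have "?D ^ l * ?D ^ (i - l) = ?D ^ i" using l by (simp flip: power_add)
    finally show "real (card {G \<in> Gs. card (G \<inter> ?B) = l}) * (\<theta> k h ^ (i - l) * PH)
      \<le> (real (cst * (k + 1)) * \<nu> * ?D ^ i * \<phi>) * PH" .
  qed
  also have "\<dots> = ?t * (real (i * cst * (k + 1)) * C0 * g * PH)"
    by (simp add: \<phi>_def algebra_simps)
  finally have "prob (?H \<inter> ?E) \<le> real (i * cst * (k + 1)) * C0 * g * PH"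
    using t by (simp only: mult_le_cancel_left_pos)
  also have "\<dots> \<le> real (r * cst * (k + 1)) * C0 * g * PH"
  proof -
    have "i * cst * (k + 1) \<le> r * cst * (k + 1)" using i by (intro mult_le_mono) auto
    then have "real (i * cst * (k + 1)) \<le> real (r * cst * (k + 1))" by (simp only: of_nat_le_iff)
    moreover have "0 \<le> C0" by (simp add: C0_def)
    ultimately show ?thesis using PH g by (intro mult_right_mono) auto
  qed
  finally show ?thesis unfolding PH_def .
qed

text \<open>The union bound has \<open>r\<close> terms from \<open>prob_many_groups\<close>, one per
  group size, and one term for the line through the origin.\<close>

definition fail_const :: "nat \<Rightarrow> real" where
  "fail_const k = real (r * (r * cst * (k + 1)) + 1) * C0"

lemma C0_nonneg: "0 \<le> C0" by (simp add: C0_def)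

lemma fail_const_nonneg: "0 \<le> fail_const k" using C0_nonneg by (simp add: fail_const_def)

definition ok :: "nat \<Rightarrow> (int \<times> int \<Rightarrow> bool) \<Rightarrow> bool" where
  "ok k \<omega> \<longleftrightarrow> Good k (hist k \<omega>) \<and> (\<forall>j\<le>k. 0 \<notin> lines j \<omega>)"

lemma prob_step_fails:
  "prob {\<omega>. hist k \<omega> \<in> {h. Good k h \<and> (\<exists>\<omega>0. h = hist k \<omega>0)} \<and>
      \<omega> \<in> {\<omega>'. (\<exists>i\<in>{1..r}. gain (Suc k) * \<nu> * dens (Suc k) ^ i
                \<le> real (card (newgrp i (lines (Suc k) \<omega>') (hist k \<omega> (k - 1)))))
           \<or> (0 \<in> lines (Suc k) \<omega>' \<and> 0 \<notin> hist k \<omega> (k - 1))}} \<le> fail_const k * g"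
proof (rule prob_fibres[where D = "I \<times> I" and E = "I \<times> I" and F = "hist k"])
  show "finite (I \<times> I)" "finite (I \<times> I)" by auto
  show "0 \<le> fail_const k * g" using fail_const_nonneg g by simp
  fix h
  assume "h \<in> {h. Good k h \<and> (\<exists>\<omega>0. h = hist k \<omega>0)}"
  then obtain \<omega>0 where Good: "Good k h" and h: "h = hist k \<omega>0" by blast
  let ?H = "{\<omega>. hist k \<omega> = h}"
  let ?E = "\<lambda>i. {\<omega>. gain (Suc k) * \<nu> * dens (Suc k) ^ i \<le> real (card (newgrp i (lines (Suc k) \<omega>) (h (k - 1))))}"
  let ?Z = "{\<omega>. 0 \<in> lines (Suc k) \<omega> \<and> 0 \<notin> h (k - 1)}"
  have evH: "?H \<in> events" by (rule depends_sets[OF finite_II depends_hist])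
  have evX: "{\<omega>. P (lines (Suc k) \<omega>)} \<in> events" for P by (rule depends_sets[OF finite_II depends_lines])
  have PH: "0 \<le> prob ?H" by simp
  have "prob (?H \<inter> {\<omega>. (\<exists>i\<in>{1..r}. gain (Suc k) * \<nu> * dens (Suc k) ^ i
                \<le> real (card (newgrp i (lines (Suc k) \<omega>) (h (k - 1))))) \<or> (0 \<in> lines (Suc k) \<omega> \<and> 0 \<notin> h (k - 1))})
     = prob ((\<Union>i\<in>{1..r}. ?H \<inter> ?E i) \<union> (?H \<inter> ?Z))"
    by (rule arg_cong[where f = prob]) auto
  also have "\<dots> \<le> prob (\<Union>i\<in>{1..r}. ?H \<inter> ?E i) + prob (?H \<inter> ?Z)"
    using evH evX by (intro measure_Un_le sets.finite_UN sets.Int) auto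
  also have "prob (\<Union>i\<in>{1..r}. ?H \<inter> ?E i) \<le> (\<Sum>i\<in>{1..r}. prob (?H \<inter> ?E i))"
    using evH evX by (intro finite_measure_subadditive_finite) auto
  also have "\<dots> \<le> (\<Sum>i\<in>{1..r}. real (r * cst * (k + 1)) * C0 * g * prob ?H)"
    by (intro sum_mono prob_many_groups[OF h Good]) auto
  also have "\<dots> = real (r * (r * cst * (k + 1))) * C0 * g * prob ?H" by simp
  also have "prob (?H \<inter> ?Z) \<le> C0 * g * prob ?H"
  proof (cases "0 \<in> h (k - 1)")
    case True
    then show ?thesis using C0_nonneg g by simp
  next
    case False
    then have "prob (?H \<inter> ?Z) = prob (?H \<inter> {\<omega>. {0} \<subseteq> lines (Suc k) \<omega>})" by simp
    also have "\<dots> \<le> \<theta> k h ^ card {0 :: int} * prob ?H"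
      using False by (intro prob_new_lines) (auto simp: I_def)
    also have "\<dots> \<le> C0 * g * prob ?H"
    proof (rule mult_right_mono)
      have "\<theta> k h \<le> C0 * g * gain (Suc k) * dens (Suc k)" by (rule theta_Good[OF h Good])
      also have "\<dots> = C0 * g * (gain (Suc k) * dens (Suc k))" by simp
      also have "\<dots> \<le> C0 * g * (1 * 1)"
        using gain_le_1[of "Suc k"] dens_le_1[of "Suc k"] gain_pos[of "Suc k"] dens_pos[of "Suc k"] C0_nonneg g
        by (intro mult_left_mono mult_mono) auto
      finally show "\<theta> k h ^ card {0 :: int} \<le> C0 * g" by simp
    qed simp
    finally show ?thesis .
  qed
  finally show "prob (?H \<inter> {\<omega>. (\<exists>i\<in>{1..r}. gain (Suc k) * \<nu> * dens (Suc k) ^ i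
                \<le> real (card (newgrp i (lines (Suc k) \<omega>) (h (k - 1))))) \<or> (0 \<in> lines (Suc k) \<omega> \<and> 0 \<notin> h (k - 1))})
    \<le> fail_const k * g * prob ?H"
    by (simp add: fail_const_def algebra_simps)
next
  show "hist k \<omega> = hist k \<omega>'" if "\<And>z. z \<in> I \<times> I \<Longrightarrow> \<omega> z = \<omega>' z" for \<omega> \<omega>'
    using that by (rule hist_depends)
  show "depends (I \<times> I) {\<omega>'. (\<exists>i\<in>{1..r}. gain (Suc k) * \<nu> * dens (Suc k) ^ i
                \<le> real (card (newgrp i (lines (Suc k) \<omega>') (h (k - 1)))))
           \<or> (0 \<in> lines (Suc k) \<omega>' \<and> 0 \<notin> h (k - 1))}" for h
    by (rule depends_lines)
qed

lemma ok_depends: "depends (I \<times> I) {\<omega>. \<not> ok k \<omega>}"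
proof (rule dependsI)
  fix \<omega> \<omega>' :: "int \<times> int \<Rightarrow> bool"
  assume eq: "\<And>z. z \<in> I \<times> I \<Longrightarrow> \<omega> z = \<omega>' z" and "\<omega> \<in> {\<omega>. \<not> ok k \<omega>}"
  moreover have "(\<lambda>j. lines j \<omega>) = (\<lambda>j. lines j \<omega>')" by (intro ext lines_depends[OF eq])
  then have "lines j \<omega> = lines j \<omega>'" "hist k \<omega> = hist k \<omega>'" for j
    by (auto simp: hist_def fun_eq_iff)
  ultimately show "\<omega>' \<in> {\<omega>. \<not> ok k \<omega>}" by (simp add: ok_def)
qed

lemma prob_not_ok: "prob {\<omega>. \<not> ok k \<omega>} \<le> (\<Sum>j<k. fail_const j) * g"
proof (induction k)
  case 0
  have "{\<omega>. \<not> ok 0 \<omega>} = {}" by (auto simp: ok_def Good_def)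
  then show ?case by simp
next
  case (Suc k)
  let ?F = "{\<omega>. hist k \<omega> \<in> {h. Good k h \<and> (\<exists>\<omega>0. h = hist k \<omega>0)} \<and>
      \<omega> \<in> {\<omega>'. (\<exists>i\<in>{1..r}. gain (Suc k) * \<nu> * dens (Suc k) ^ i
                \<le> real (card (newgrp i (lines (Suc k) \<omega>') (hist k \<omega> (k - 1)))))
           \<or> (0 \<in> lines (Suc k) \<omega>' \<and> 0 \<notin> hist k \<omega> (k - 1))}}"
  have dF: "depends (I \<times> I) ?F"
  proof (rule dependsI)
    fix \<omega> \<omega>' :: "int \<times> int \<Rightarrow> bool"
    assume eq: "\<And>z. z \<in> I \<times> I \<Longrightarrow> \<omega> z = \<omega>' z" and "\<omega> \<in> ?F"
    moreover have "hist k \<omega> = hist k \<omega>'" "lines (Suc k) \<omega> = lines (Suc k) \<omega>'"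
      by (rule hist_depends[OF eq] lines_depends[OF eq], assumption)+
    ultimately show "\<omega>' \<in> ?F" by simp
  qed
  have "{\<omega>. \<not> ok (Suc k) \<omega>} \<subseteq> {\<omega>. \<not> ok k \<omega>} \<union> ?F"
  proof
    fix \<omega> assume "\<omega> \<in> {\<omega>. \<not> ok (Suc k) \<omega>}"
    then have no: "\<not> ok (Suc k) \<omega>" by simp
    show "\<omega> \<in> {\<omega>. \<not> ok k \<omega>} \<union> ?F"
    proof (cases "ok k \<omega>")
      case True
      then have G: "Good k (hist k \<omega>)" and Z: "\<And>j. j \<le> k \<Longrightarrow> 0 \<notin> lines j \<omega>" by (auto simp: ok_def)
      have hk: "hist k \<omega> (k - 1) = lines (k - 1) \<omega>" by (simp add: hist_def)
      have hs: "hist (Suc k) \<omega> j = lines j \<omega>" if "j \<le> Suc k" for j using that by (simp add: hist_def)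
      have hkj: "hist k \<omega> j = lines j \<omega>" if "j \<le> k" for j using that by (simp add: hist_def)
      from no have "\<not> Good (Suc k) (hist (Suc k) \<omega>) \<or> (\<exists>j\<le>Suc k. 0 \<in> lines j \<omega>)" by (auto simp: ok_def)
      then show ?thesis
      proof
        assume "\<not> Good (Suc k) (hist (Suc k) \<omega>)"
        then obtain j i where ji: "1 \<le> j" "j \<le> Suc k" "1 \<le> i" "i \<le> r"
          "gain j * \<nu> * dens j ^ i < real (card (newgrp i (lines j \<omega>) (lines (j - 2) \<omega>)))"
          using hs by (auto simp: Good_def not_le)
        have "\<not> j \<le> k"
        proof
          assume jk: "j \<le> k"
          then have "real (card (newgrp i (hist k \<omega> j) (hist k \<omega> (j - 2)))) \<le> gain j * \<nu> * dens j ^ i"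
            using G ji by (auto simp: Good_def)
          with ji(5) jk show False by (simp add: hkj)
        qed
        then have "j = Suc k" using ji by simp
        then have "gain (Suc k) * \<nu> * dens (Suc k) ^ i \<le> real (card (newgrp i (lines (Suc k) \<omega>) (hist k \<omega> (k - 1))))"
          using ji(5) hk by (simp add: numeral_2_eq_2)
        then show ?thesis using G ji(3,4) by auto
      next
        assume "\<exists>j\<le>Suc k. 0 \<in> lines j \<omega>"
        then have "0 \<in> lines (Suc k) \<omega>" using Z by (metis le_Suc_eq)
        moreover have "0 \<notin> hist k \<omega> (k - 1)" unfolding hk by (rule Z) simp
        ultimately show ?thesis using G by auto
      qed
    qed simp
  qed
  then have "prob {\<omega>. \<not> ok (Suc k) \<omega>} \<le> prob ({\<omega>. \<not> ok k \<omega>} \<union> ?F)"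
    by (intro finite_measure_mono sets.Un depends_sets[OF finite_II] ok_depends dF)
  also have "\<dots> \<le> prob {\<omega>. \<not> ok k \<omega>} + prob ?F"
    by (intro measure_Un_le depends_sets[OF finite_II] ok_depends dF)
  also have "\<dots> \<le> (\<Sum>j<k. fail_const j) * g + fail_const k * g"
    by (intro add_mono Suc.IH prob_step_fails)
  finally show ?case by (simp add: distrib_right)
qed

text \<open>Applied to groups of size one, \<open>Good\<close> bounds the number of lines new at
  half-round \<open>K + 2\<close> by a number below one. So there are none, and
  \<open>origin_not_hit\<close> applies.\<close>

lemma prob_origin_hit:
  assumes K: "gain (Suc (Suc K)) * \<nu> < 1" and t: "\<rho> * t \<le> L"
  shows "prob {\<omega>. (0, 0) \<in> growth \<rho> (line_growth r s) {z. \<omega> z} t} \<le> p + (\<Sum>j<Suc (Suc K). fail_const j) * g"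
proof -
  let ?K = "Suc (Suc K)"
  have "{\<omega>. (0, 0) \<in> growth \<rho> (line_growth r s) {z. \<omega> z} t} \<subseteq> {\<omega>. \<omega> (0, 0)} \<union> {\<omega>. \<not> ok ?K \<omega>}"
  proof clarify
    fix \<omega> assume hit: "(0, 0) \<in> growth \<rho> (line_growth r s) {z. \<omega> z} t"
      and "\<not> \<omega> (0, 0)" and ok: "ok ?K \<omega>"
    have "lines ?K \<omega> \<subseteq> lines K \<omega>"
    proof
      fix x assume x: "x \<in> lines ?K \<omega>"
      have "Good ?K (hist ?K \<omega>)" using ok by (simp add: ok_def)
      then have "real (card (newgrp 1 (hist ?K \<omega> ?K) (hist ?K \<omega> (?K - 2)))) \<le> gain ?K * \<nu> * dens ?K ^ 1"
        using sr unfolding Good_def by (elim allE[of _ ?K] allE[of _ 1] impE) auto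
      then have "real (card (newgrp 1 (lines ?K \<omega>) (lines K \<omega>))) \<le> gain ?K * \<nu> * dens ?K ^ 1"
        by (simp add: hist_def)
      also have "\<dots> \<le> gain ?K * \<nu> * 1"
        using gain_pos[of ?K] nu_pos dens_le_1[of ?K] by (intro mult_left_mono) auto
      also have "\<dots> < 1" using K by simp
      finally have "newgrp 1 (lines ?K \<omega>) (lines K \<omega>) = {}" by (simp add: card_eq_0_iff)
      moreover have "{x} \<in> grp 1" using x lines_subset_I[of ?K \<omega>] by (auto simp: grp_def)
      ultimately show "x \<in> lines K \<omega>" using x unfolding newgrp_def by blast
    qed
    with lines_Suc_Suc[of K \<omega>] have "lines ?K \<omega> = lines K \<omega>" by blast
    with hit t sr ok \<open>\<not> \<omega> (0, 0)\<close> origin_not_hit[of t K \<omega>] show False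
      by (auto simp: ok_def)
  qed
  moreover have "{\<omega>. \<omega> (0, 0)} \<in> events"
    by (rule depends_sets[of "{(0, 0)}"]) (auto intro: dependsI)
  moreover have "{\<omega>. \<not> ok ?K \<omega>} \<in> events"
    by (rule depends_sets[OF finite_II ok_depends])
  ultimately have "prob {\<omega>. (0, 0) \<in> growth \<rho> (line_growth r s) {z. \<omega> z} t}
      \<le> prob {\<omega>. \<omega> (0, 0)} + prob {\<omega>. \<not> ok ?K \<omega>}"
    by (intro order_trans[OF finite_measure_mono measure_Un_le]) auto
  then show ?thesis using prob_site[of "(0, 0)"] prob_not_ok[of ?K] by linarith
qed

end

section \<open>Choice of exponents for the lower bound\<close>

lemma powr_tendsto_0:
  assumes "0 < (a :: real)"
  shows "((\<lambda>p :: real. C * p powr a) \<longlongrightarrow> 0) (at_right 0)"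
proof -
  have "((\<lambda>p :: real. p powr a) \<longlongrightarrow> 0) (at_right 0)"
    by (rule tendsto_zero_powrI[OF tendsto_ident_at tendsto_const _ assms])
      (auto simp: eventually_at_right_less eventually_at_filter)
  from tendsto_mult_right_zero[OF this, of C] show ?thesis .
qed

lemma eventually_powr_le:
  assumes "b < (a :: real)"
  shows "eventually (\<lambda>p :: real. C * p powr a \<le> p powr b) (at_right 0)"
proof -
  have "eventually (\<lambda>p :: real. C * p powr (a - b) < 1) (at_right 0)"
    using assms by (intro order_tendstoD(2)[OF powr_tendsto_0]) auto
  moreover have "eventually (\<lambda>p :: real. 0 < p) (at_right 0)"
    by (simp add: eventually_at_right_less)
  ultimately show ?thesis
  proof eventually_elim
    case (elim p)
    have "C * p powr a = C * p powr (a - b) * p powr b"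
      using elim by (simp flip: powr_add)
    also have "\<dots> \<le> 1 * p powr b" using elim by (intro mult_right_mono) auto
    finally show ?case by simp
  qed
qed

lemma eventually_at_right_unit: "eventually (\<lambda>p :: real. 0 < p \<and> p < 1) (at_right 0)"
  using eventually_at_right_real[of 0 "1 :: real"] by simp

lemma powr_less_exponent:
  "0 < p \<Longrightarrow> p < 1 \<Longrightarrow> b < a \<Longrightarrow> p powr a < p powr b" for p a b :: real
  by (simp add: powr_def mult_strict_right_mono_neg)

text \<open>The sum of \<open>fail_const\<close> written out without \<open>p\<close>, so that it is
  visibly one constant while \<open>p\<close> tends to 0.\<close>

definition failsum :: "nat \<Rightarrow> nat \<Rightarrow> nat \<Rightarrow> real" where
  "failsum \<rho> r K = (\<Sum>j<Suc (Suc K). real (r * (r * 2 ^ (4 * \<rho> + 1) * (j + 1)) + 1) * real ((r + 1) * 2 ^ (4 * \<rho> + 1)))"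

text \<open>Instance with \<open>\<nu> = p powr (e - \<gamma>)\<close>,
  \<open>Q = p powr (s / r + e / 2)\<close> and \<open>g = p powr (e / 4)\<close>. The hypothesis on
  \<open>K\<close> says that the gain of \<open>Suc K\<close> half-rounds outweighs
  \<open>p powr - \<gamma>\<close>.\<close>

lemma prob_origin_hit_powr:
  fixes r s \<rho> t K :: nat and e p :: real
  defines "\<gamma> \<equiv> (real r - 1) * real s / real r"
  assumes rs: "2 \<le> s" "s \<le> r" and e: "0 < e" and p: "0 < p" "p < 1"
    and size: "2 * real (\<rho> * t) + 1 \<le> p powr (e - \<gamma>)"
    and small: "real ((r + 1) * 2 ^ (4 * \<rho> + 1)) * p powr (e / 4) \<le> 1"
    and K: "4 * \<gamma> < real (Suc K) * e"
  shows "measure (init_measure p) {\<omega>. (0, 0) \<in> growth \<rho> (line_growth r s) {z. \<omega> z} t}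
    \<le> p + failsum \<rho> r K * p powr (e / 4)"
proof -
  define \<sigma> where "\<sigma> = real s / real r + e / 2"
  have rpos: "0 < real r" "2 \<le> real r" using rs by auto
  have \<gamma>: "\<gamma> = real s - real s / real r"
    using rpos by (simp add: \<gamma>_def field_simps)
  have sr1: "real s / real r \<le> 1" using rs by simp
  have sr0: "0 < real s / real r" using rs by simp
  have pw: "p ^ n = p powr real n" for n using p by (simp add: powr_realpow)
  have Qw: "(p powr \<sigma>) ^ n = p powr (\<sigma> * real n)" for n using p by (simp add: powr_power mult.commute)
  have le: "p powr a \<le> p powr b" if "b \<le> a" for a b
    using p that by (intro powr_mono') auto
  have lt: "p powr a < p powr b" if "b < a" for a b
    using p that by (rule powr_less_exponent)
  \<comment> \<open>The exponent of \<open>Q\<close> lies below the true exponent \<open>s / r + e\<close> of initially filled columns,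
    which leaves room for the constants in Markov's inequality.\<close>
  interpret subcritical_lines p \<rho> "\<rho> * t" r s "p powr (e - \<gamma>)" "p powr \<sigma>" "p powr (e / 4)"
  proof unfold_locales
    show "0 \<le> p" "p \<le> 1" "0 < p" using p by auto
    show "0 < p powr \<sigma>" "0 < p powr (e / 4)" using p by auto
    have "p powr \<sigma> \<le> p powr 0" by (rule le) (use e sr0 in \<open>simp add: \<sigma>_def\<close>)
    then show "p powr \<sigma> \<le> 1" using p by simp
    have "p powr (e / 4) \<le> p powr 0" by (rule le) (use e in simp)
    then show "p powr (e / 4) \<le> 1" using p by simp
    show "1 \<le> s" "s \<le> r" using rs by auto
    show "2 * real (\<rho> * t) + 1 \<le> p powr (e - \<gamma>)" by (rule size)
    show "real ((r + 1) * 2 ^ (4 * \<rho> + 1)) * p powr (e / 4) \<le> 1" by (rule small)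
    fix i
    show "p powr (e - \<gamma>) * p ^ i < p powr (e / 4) \<or>
        p powr (e - \<gamma>) * p ^ i * p ^ (s - i) \<le> (p powr (e / 4)) ^ 2 * p powr \<sigma>" if "i \<le> s"
    proof -
      \<comment> \<open>A filled row counts like an occupied site, so \<open>i\<close> drops out. By
        \<open>s - \<gamma> = s / r\<close> both sides have exponent \<open>e + s / r\<close>: the
        choice of \<open>\<sigma>\<close> and \<open>g\<close> is exact here.\<close>
      have "p powr (e - \<gamma>) * p ^ i * p ^ (s - i) = p powr (e - \<gamma> + real s)"
        using that p by (simp add: pw algebra_simps flip: powr_add)
      also have "\<dots> = (p powr (e / 4)) ^ 2 * p powr \<sigma>"
        using p by (simp add: powr_power \<gamma> \<sigma>_def flip: powr_add)
      finally show ?thesis by simp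
    qed
    show "p powr (e - \<gamma>) * (p powr \<sigma>) ^ i < p powr (e / 4) \<or>
        p powr (e - \<gamma>) * (p powr \<sigma>) ^ i * p ^ (r - i) \<le> (p powr (e / 4)) ^ 2 * p" if "i \<le> r"
    proof (cases "r - 1 \<le> i")
      case True
      \<comment> \<open>Groups of at least \<open>r - 1\<close> columns are excluded:
        \<open>\<gamma>\<close> is exactly \<open>r - 1\<close> times the exponent
        \<open>s / r\<close>, which leaves at least the exponent \<open>e > e / 4\<close>.\<close>
      have "\<gamma> = (real r - 1) * (real s / real r)" by (simp add: \<gamma>_def)
      also have "\<dots> \<le> real i * (real s / real r)"
        using True rs by (intro mult_right_mono) auto
      also have "\<dots> \<le> \<sigma> * real i" using e by (simp add: \<sigma>_def algebra_simps)
      finally have "e / 4 < e - \<gamma> + \<sigma> * real i" using e by linarith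
      from lt[OF this] show ?thesis by (simp add: Qw powr_add)
    next
      case False
      \<comment> \<open>Relative to \<open>r - 1\<close> columns, \<open>m\<close> columns are
        replaced by occupied sites. Each site has exponent 1, a column only
        \<open>s / r \<le> 1\<close>, so nothing is lost; one further site supplies the factor
        \<open>p\<close>.\<close>
      define m where "m = r - 1 - i"
      have m: "real r = real m + real i + 1" "1 \<le> real m" using False by (auto simp: m_def)
      have "real m * (real s / real r) \<le> real m * 1" using sr1 by (intro mult_left_mono) auto
      moreover have "\<gamma> = real m * (real s / real r) + real i * (real s / real r)"
        unfolding \<gamma>_def m(1) by (simp add: add_divide_distrib algebra_simps)
      moreover have "\<sigma> * real i = real i * (real s / real r) + real i * (e / 2)"
        by (simp add: \<sigma>_def algebra_simps)
      moreover have "0 \<le> real i * (e / 2)" using e by simp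
      moreover have "real (r - i) = real m + 1" using m that by simp
      ultimately have "e / 2 + 1 \<le> e - \<gamma> + \<sigma> * real i + real (r - i)" using e by linarith
      from le[OF this] have "p powr (e - \<gamma>) * (p powr \<sigma>) ^ i * p ^ (r - i) \<le> p powr (e / 2 + 1)"
        by (simp only: Qw pw powr_add)
      also have "\<dots> = (p powr (e / 4)) ^ 2 * p"
        using p by (simp add: powr_power powr_add)
      finally show ?thesis by simp
    qed
  qed
  have "gain (Suc (Suc K)) * p powr (e - \<gamma>) < 1"
  proof -
    have "gain (Suc (Suc K)) = (p powr (e / 4)) ^ Suc K" using p by (simp add: gain_def)
    also have "\<dots> = p powr (e / 4 * real (Suc K))"
      using p by (simp add: powr_power mult.commute del: power_Suc of_nat_Suc)
    finally have "gain (Suc (Suc K)) * p powr (e - \<gamma>) = p powr (e / 4 * real (Suc K) + (e - \<gamma>))"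
      by (simp add: powr_add)
    also have "\<dots> < p powr 0"
      by (rule lt) (use K e in \<open>simp add: field_simps\<close>)
    finally show ?thesis using p by simp
  qed
  from prob_origin_hit[OF this order_refl] show ?thesis
    by (simp only: fail_const_def C0_def failsum_def)
qed

text \<open>The box has exponent \<open>\<gamma> - \<epsilon> / 2\<close> while the time has
  \<open>\<gamma> - \<epsilon>\<close>, which absorbs the factor \<open>2 * \<rho> + 1\<close>. The
  bound \<open>\<epsilon> \<le> \<gamma>\<close> keeps the time scale at least 1.\<close>

lemma lower_limit:
  fixes r s \<rho> :: nat and \<epsilon> :: real
  defines "\<gamma> \<equiv> (real r - 1) * real s / real r"
  assumes rs: "2 \<le> s" "s \<le> r" and \<epsilon>: "0 < \<epsilon>" "\<epsilon> \<le> \<gamma>"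
  shows "((\<lambda>p. measure (init_measure p) {\<omega>. (0, 0) \<in> growth \<rho> (line_growth r s) {z. \<omega> z} (nat \<lfloor>p powr - (\<gamma> - \<epsilon>)\<rfloor>)})
    \<longlongrightarrow> 0) (at_right 0)"
proof -
  define e where "e = \<epsilon> / 2"
  have e: "0 < e" using \<epsilon> by (simp add: e_def)
  obtain K :: nat where K0: "4 * \<gamma> / e < real K" using reals_Archimedean2 by blast
  have K: "4 * \<gamma> < real (Suc K) * e"
    using K0 e by (simp add: field_simps)
  show ?thesis
  proof (rule tendsto_sandwich[OF _ _ tendsto_const])
  show "eventually (\<lambda>p. 0 \<le> measure (init_measure p)
      {\<omega>. (0, 0) \<in> growth \<rho> (line_growth r s) {z. \<omega> z} (nat \<lfloor>p powr - (\<gamma> - \<epsilon>)\<rfloor>)}) (at_right 0)"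
    by simp
  have "((\<lambda>p :: real. 1 * p powr 1 + failsum \<rho> r K * p powr (e / 4)) \<longlongrightarrow> 0 + 0) (at_right 0)"
    using e by (intro tendsto_add powr_tendsto_0) auto
  then show "((\<lambda>p :: real. 1 * p powr 1 + failsum \<rho> r K * p powr (e / 4)) \<longlongrightarrow> 0) (at_right 0)"
    by simp
  have "eventually (\<lambda>p :: real. real ((r + 1) * 2 ^ (4 * \<rho> + 1)) * p powr (e / 4) \<le> p powr 0) (at_right 0)"
    using e by (intro eventually_powr_le) simp
  moreover have "eventually (\<lambda>p :: real. (2 * real \<rho> + 1) * p powr - (\<gamma> - \<epsilon>) \<le> p powr (e - \<gamma>)) (at_right 0)"
    using e by (intro eventually_powr_le) (simp add: e_def)
  ultimately show "eventually (\<lambda>p. measure (init_measure p)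
      {\<omega>. (0, 0) \<in> growth \<rho> (line_growth r s) {z. \<omega> z} (nat \<lfloor>p powr - (\<gamma> - \<epsilon>)\<rfloor>)}
      \<le> 1 * p powr 1 + failsum \<rho> r K * p powr (e / 4)) (at_right 0)"
    using eventually_at_right_unit
  proof eventually_elim
    case (elim p)
    let ?t = "nat \<lfloor>p powr - (\<gamma> - \<epsilon>)\<rfloor>"
    have t: "real ?t \<le> p powr - (\<gamma> - \<epsilon>)" by simp
    have ge1: "p powr 0 \<le> p powr - (\<gamma> - \<epsilon>)" using elim \<epsilon> by (intro powr_mono') auto
    have "2 * real (\<rho> * ?t) + 1 \<le> 2 * (real \<rho> * p powr - (\<gamma> - \<epsilon>)) + p powr - (\<gamma> - \<epsilon>)"
      using t ge1 elim by (intro add_mono mult_left_mono) (auto intro: mult_left_mono)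
    also have "\<dots> = (2 * real \<rho> + 1) * p powr - (\<gamma> - \<epsilon>)" by (simp add: algebra_simps)
    also have "\<dots> \<le> p powr (e - \<gamma>)" using elim by simp
    finally have size: "2 * real (\<rho> * ?t) + 1 \<le> p powr (e - \<gamma>)" .
    have small: "real ((r + 1) * 2 ^ (4 * \<rho> + 1)) * p powr (e / 4) \<le> 1" using elim by simp
    from prob_origin_hit_powr[OF rs e _ _ size[unfolded \<gamma>_def] small K[unfolded \<gamma>_def]] elim
    show ?case by (simp add: \<gamma>_def)
  qed
qed
qed

section \<open>Cascades of filled blocks and the upper bound\<close>

text \<open>The site next to either end of a filled run sees the nearest \<open>m\<close> sites of
  it, because \<open>m \<le> \<rho>\<close>. So the run gains one site per step on both
  sides.\<close>

lemma growth_spread: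
  assumes rs: "0 < r" "0 < s" and m: "m = (if even k then s else r)" "m \<le> \<rho>"
    and run: "\<And>i. i < m \<Longrightarrow> site k (a + int i) v \<in> growth \<rho> (line_growth r s) A t"
    and u: "a - int d \<le> u" "u < a + int m + int d"
  shows "site k u v \<in> growth \<rho> (line_growth r s) A (t + d)"
  using u
proof (induction d arbitrary: u)
  case 0
  then have "site k (a + int (nat (u - a))) v \<in> growth \<rho> (line_growth r s) A t"
    by (intro run) auto
  then show ?case using 0 by simp
next
  case (Suc d)
  let ?g = "growth \<rho> (line_growth r s) A (t + d)"
  have fill: "site k u v \<in> growth \<rho> (line_growth r s) A (Suc (t + d))"
    if "u - int \<rho> \<le> c" "c + int m \<le> u + int \<rho> + 1" "a - int d \<le> c" "c + int m \<le> a + int m + int d" for c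
  proof (rule growth_site_Suc[OF rs])
    have "card {c..<c + int m} \<le> card {w \<in> {u - int \<rho>..u + int \<rho>}. site k w v \<in> ?g}"
    proof (rule card_mono)
      show "finite {w \<in> {u - int \<rho>..u + int \<rho>}. site k w v \<in> ?g}"
        by (rule finite_subset[of _ "{u - int \<rho>..u + int \<rho>}"]) auto
      show "{c..<c + int m} \<subseteq> {w \<in> {u - int \<rho>..u + int \<rho>}. site k w v \<in> ?g}"
        using that Suc.IH by auto
    qed
    then show "(if even k then s else r) \<le> card {w \<in> {u - int \<rho>..u + int \<rho>}. site k w v \<in> ?g}"
      using m(1) by simp
  qed
  consider "a - int d \<le> u" "u < a + int m + int d" | "u = a - int d - 1" | "u = a + int m + int d"
    using Suc.prems by fastforce
  then show ?case
  proof cases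
    case 1
    then show ?thesis using Suc.IH by auto
  next
    case 2
    with fill[of "a - int d"] m(2) show ?thesis by simp
  next
    case 3
    with fill[of "a + int d"] m(2) show ?thesis by simp
  qed
qed

text \<open>Level \<open>k\<close> occupies the coordinates \<open>k * W, \<dots>, (k + 1) * W - 1\<close>, cut into \<open>B\<close> blocks of length
  \<open>r\<close>; blocks of even levels consist of rows, blocks of odd levels of columns. In a full block all
  lines but the last are filled, so a single occupied site on the last line (at level \<open>0\<close>, where
  nothing is filled, a whole run of sites) fills a transversal line. At the last level \<open>F\<close> all lines
  of the block are required. The transitions between levels use disjoint sets of sites.\<close>

locale seeding =
  fixes r s \<rho> B F :: nat
  assumes s2: "2 \<le> s" and sr: "s \<le> r" and r\<rho>: "r \<le> \<rho>" and F: "0 < F"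
begin

definition W :: nat where "W = B * r"
definition M :: nat where "M = (F + 1) * W"
definition width :: "nat \<Rightarrow> nat" where "width k = (if even k then s else r)"
definition needed :: "nat \<Rightarrow> nat" where "needed k = (if k = F then width k else width k - 1)"
definition ext :: "nat \<Rightarrow> nat set" where "ext k = (if k = 0 then {..<width k} else {width k - 1})"
definition pos :: "nat \<Rightarrow> nat \<Rightarrow> nat \<Rightarrow> int" where "pos k b j = int (k * W + b * r + j)"

definition seeded :: "nat \<Rightarrow> nat set \<Rightarrow> (int \<times> int \<Rightarrow> bool) \<Rightarrow> int \<Rightarrow> bool" where
  "seeded k \<beta> \<omega> v \<longleftrightarrow> (\<exists>b\<in>\<beta>. \<forall>j\<in>ext k. \<omega> (site k (pos k b j) v))"

definition good :: "nat \<Rightarrow> nat set \<Rightarrow> (int \<times> int \<Rightarrow> bool) \<Rightarrow> nat \<Rightarrow> bool" where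
  "good k \<beta> \<omega> b \<longleftrightarrow> (\<forall>j<needed (Suc k). seeded k \<beta> \<omega> (pos (Suc k) b j))"

primrec full_blocks :: "nat \<Rightarrow> (int \<times> int \<Rightarrow> bool) \<Rightarrow> nat set" where
  "full_blocks 0 \<omega> = {..<B}"
| "full_blocks (Suc k) \<omega> = {b. b < B \<and> good k (full_blocks k \<omega>) \<omega> b}"

lemma full_blocks_subset: "full_blocks k \<omega> \<subseteq> {..<B}" by (cases k) auto

lemma finite_full_blocks: "finite (full_blocks k \<omega>)" using full_blocks_subset finite_lessThan by (rule finite_subset)

lemma width_bounds: "2 \<le> width k" "width k \<le> r" "needed k \<le> r"
  using s2 sr by (auto simp: width_def needed_def)

lemma block_bound: "b < B \<Longrightarrow> j < r \<Longrightarrow> b * r + j < W"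
proof -
  assume "b < B" "j < r"
  then have "b * r + j < Suc b * r" by simp
  also have "\<dots> \<le> B * r" using \<open>b < B\<close> by (intro mult_le_mono) auto
  finally show ?thesis by (simp add: W_def)
qed

lemma pos_bounds:
  assumes "b < B" "j < r"
  shows "int (k * W) \<le> pos k b j" "pos k b j < int (Suc k * W)"
proof -
  have "pos k b j = int (k * W) + int (b * r + j)" by (simp add: pos_def)
  moreover have "int (b * r + j) < int W" using block_bound[OF assms] by (simp only: of_nat_less_iff)
  moreover have "int (Suc k * W) = int (k * W) + int W" by simp
  ultimately show "int (k * W) \<le> pos k b j" "pos k b j < int (Suc k * W)" by linarith+
qed

lemma pos_lt_M:
  assumes "b < B" "j < r" "k \<le> F"
  shows "0 \<le> pos k b j" "pos k b j < int M"
proof -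
  have "Suc k * W \<le> M" using assms(3) unfolding M_def by (intro mult_le_mono) auto
  then have "int (Suc k * W) \<le> int M" by (simp only: of_nat_le_iff)
  with pos_bounds(2)[OF assms(1,2), of k] show "pos k b j < int M" by linarith
qed (simp add: pos_def)

lemma pos_inj:
  assumes "j < r" "j' < r" "pos k b j = pos k b' j'"
  shows "b = b' \<and> j = j'"
proof -
  from assms(3) have eq: "b * r + j = b' * r + j'" by (simp add: pos_def flip: of_nat_add of_nat_mult)
  have "(b * r + j) div r = b" "(b' * r + j') div r = b'" using assms(1,2) by auto
  with eq have "b = b'" by metis
  with eq show ?thesis by simp
qed

text \<open>At time \<open>k * M\<close> a full block supplies a run of threshold length on the line
  \<open>v\<close>, and \<open>M\<close> further steps spread it over the whole range. The
  alternative for \<open>ext\<close> serves two situations: between levels the extra sites are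
  occupied, at level \<open>F\<close> the block itself fills every position.\<close>

lemma run_of_block:
  assumes k: "k \<le> F" and b: "b \<in> full_blocks k \<omega>" and v: "0 \<le> v" "v < int M"
    and ext: "\<And>j. j \<in> ext k \<Longrightarrow> j < needed k \<or> \<omega> (site k (pos k b j) v)"
    and filled: "\<And>j u. 0 < k \<Longrightarrow> j < needed k \<Longrightarrow> 0 \<le> u \<Longrightarrow> u < int M \<Longrightarrow>
      site (k - 1) u (pos k b j) \<in> growth \<rho> (line_growth r s) {z. \<omega> z} (k * M)"
    and "0 < k \<or> (\<forall>j<width k. \<omega> (site k (pos k b j) v))"
    and u: "0 \<le> u" "u < int M"
  shows "site k u v \<in> growth \<rho> (line_growth r s) {z. \<omega> z} (Suc k * M)"
proof -
  let ?g = "growth \<rho> (line_growth r s) {z. \<omega> z}"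
  have bB: "b < B" using b full_blocks_subset by blast
  have run: "site k (pos k b 0 + int i) v \<in> ?g (k * M)" if i: "i < width k" for i
  proof -
    have pos: "pos k b 0 + int i = pos k b i" by (simp add: pos_def)
    have init: "z \<in> ?g (k * M)" if "\<omega> z" for z
      using that growth_mono_time[of 0 "k * M" \<rho> "line_growth r s" "{z. \<omega> z}"] by auto
    show ?thesis
    proof (cases "k = 0")
      case True
      with assms(7) i have "\<omega> (site k (pos k b i) v)" by simp
      then show ?thesis unfolding pos by (rule init)
    next
      case False
      have line: "site k (pos k b i) v \<in> ?g (k * M)" if "i < needed k"
        using filled[of i v] site_Suc[of "k - 1" v "pos k b i"] False that v site_Suc[of "k - 1"] by auto
      show ?thesis
      proof (cases "i < needed k")
        case True
        then show ?thesis unfolding pos by (rule line)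
      next
        case no: False
        then have "i \<in> ext k" using i False by (auto simp: needed_def ext_def split: if_splits)
        from ext[OF this] no show ?thesis unfolding pos by (auto intro: init)
      qed
    qed
  qed
  have w: "width k = (if even k then s else r)" "width k \<le> \<rho>" using width_bounds[of k] r\<rho> by (auto simp: width_def)
  have p0: "0 \<le> pos k b 0" "pos k b 0 < int M"
    using pos_lt_M[OF bB _ k, of 0] s2 sr by auto
  have "site k u v \<in> ?g (k * M + M)"
    by (rule growth_spread[OF _ _ w run]) (use s2 sr p0 u in auto)
  then show ?thesis by (simp add: add.commute)
qed

lemma lines_filled:
  assumes "k < F" "b \<in> full_blocks (Suc k) \<omega>" "j < needed (Suc k)" "0 \<le> u" "u < int M"
  shows "site k u (pos (Suc k) b j) \<in> growth \<rho> (line_growth r s) {z. \<omega> z} (Suc k * M)"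
  using assms
proof (induction k arbitrary: b j u)
  case 0
  then have "seeded 0 {..<B} \<omega> (pos 1 b j)" and bB: "b < B" by (auto simp: good_def)
  then obtain b' where b': "b' < B" "\<And>i. i < width 0 \<Longrightarrow> \<omega> (site 0 (pos 0 b' i) (pos 1 b j))"
    by (auto simp: seeded_def ext_def)
  have v: "0 \<le> pos 1 b j" "pos 1 b j < int M"
    using pos_lt_M[OF bB, of j 1] 0 width_bounds(3)[of 1] by auto
  have "site 0 u (pos 1 b j) \<in> growth \<rho> (line_growth r s) {z. \<omega> z} (Suc 0 * M)"
    by (rule run_of_block[of 0 b']) (use b' v 0 in \<open>auto simp: ext_def\<close>)
  then show ?case by simp
next
  case (Suc k)
  let ?v = "pos (Suc (Suc k)) b j"
  from Suc.prems(2) have bB: "b < B" and "good (Suc k) (full_blocks (Suc k) \<omega>) \<omega> b"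
    unfolding full_blocks.simps(2)[of "Suc k"] by blast+
  with Suc.prems(3) have "seeded (Suc k) (full_blocks (Suc k) \<omega>) \<omega> ?v"
    by (simp add: good_def del: full_blocks.simps)
  then obtain b' where b': "b' \<in> full_blocks (Suc k) \<omega>" "\<And>i. i \<in> ext (Suc k) \<Longrightarrow> \<omega> (site (Suc k) (pos (Suc k) b' i) ?v)"
    by (auto simp: seeded_def simp del: full_blocks.simps(2))
  have "needed (Suc (Suc k)) \<le> r" by (rule width_bounds)
  then have v: "0 \<le> ?v" "?v < int M"
    using pos_lt_M[OF bB, of j "Suc (Suc k)"] Suc.prems by auto
  show ?case
  proof (rule run_of_block[of "Suc k" b'])
    show "site (Suc k - 1) u' (pos (Suc k) b' i) \<in> growth \<rho> (line_growth r s) {z. \<omega> z} (Suc k * M)"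
      if "i < needed (Suc k)" "0 \<le> u'" "u' < int M" for i u'
      using Suc.IH[of b' i u'] Suc.prems(1) b'(1) that by simp
  qed (use Suc.prems b' v in auto)
qed

text \<open>At level \<open>F\<close> the run consists of filled lines only, so every transversal
  line in the range gets filled without any occupied site of its own, in particular the one through
  the origin.\<close>

lemma origin_hit:
  assumes "full_blocks F \<omega> \<noteq> {}"
  shows "(0, 0) \<in> growth \<rho> (line_growth r s) {z. \<omega> z} (Suc F * M)"
proof -
  obtain b where b: "b \<in> full_blocks F \<omega>" using assms by blast
  obtain k where k: "F = Suc k" using F by (cases F) auto
  have bB: "b < B" using b full_blocks_subset by blast
  have "pos 0 b 0 < int M" using pos_lt_M[OF bB, of 0 0] s2 sr by simp
  then have M0: "0 < int M" using pos_lt_M(1)[OF bB, of 0 0] s2 sr by linarith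
  have "site F 0 0 \<in> growth \<rho> (line_growth r s) {z. \<omega> z} (Suc F * M)"
  proof (rule run_of_block[OF order_refl b])
    show "site (F - 1) u (pos F b j) \<in> growth \<rho> (line_growth r s) {z. \<omega> z} (F * M)"
      if "j < needed F" "0 \<le> u" "u < int M" for j u
      using lines_filled[of k b \<omega> j u] b that by (simp add: k)
    show "j < needed F \<or> \<omega> (site F (pos F b j) 0)" if "j \<in> ext F" for j
      using that F width_bounds(1)[of F] by (auto simp: ext_def needed_def)
  qed (use M0 F in auto)
  then show ?thesis by (simp add: site_def split: if_splits)
qed

section \<open>Disjoint sites for successive levels\<close>

definition past :: "nat \<Rightarrow> (int \<times> int) set" where
  "past k = {z \<in> {0..<int M} \<times> {0..<int M}. min (fst z) (snd z) < int (k * W)}"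

definition line_sites :: "nat \<Rightarrow> int \<Rightarrow> (int \<times> int) set" where
  "line_sites k v = (\<lambda>u. site k u v) ` {int (k * W)..<int (Suc k * W)}"

definition present :: "nat \<Rightarrow> (int \<times> int) set" where
  "present k = (\<Union>b<B. \<Union>j<r. line_sites k (pos (Suc k) b j))"

lemma finite_past [simp]: "finite (past k)"
  by (rule finite_subset[of _ "{0..<int M} \<times> {0..<int M}"]) (auto simp: past_def)

lemma finite_line_sites [simp]: "finite (line_sites k v)" by (simp add: line_sites_def)

lemma finite_present [simp]: "finite (present k)" by (simp add: present_def)

text \<open>A site inspected between levels \<open>k\<close> and \<open>k + 1\<close> has one
  coordinate in each of the two ranges, so its smaller coordinate identifies the level. This holds
  for either parity of \<open>k\<close>.\<close>

lemma past_present_disjoint: "past k \<inter> present k = {}"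
proof -
  have "int (k * W) \<le> min (fst z) (snd z)" if z: "z \<in> present k" for z
  proof -
    from z obtain b j u where bj: "b < B" "j < r" and zu: "z = site k u (pos (Suc k) b j)"
      and u: "int (k * W) \<le> u"
      by (auto simp: present_def line_sites_def)
    have "int (Suc k * W) \<le> pos (Suc k) b j" by (rule pos_bounds[OF bj])
    moreover have "int (k * W) \<le> int (Suc k * W)" by simp
    ultimately have "int (k * W) \<le> pos (Suc k) b j" by linarith
    with zu u show ?thesis by (auto simp: site_def)
  qed
  then show ?thesis unfolding past_def by fastforce
qed

lemma ext_lt: "j \<in> ext k \<Longrightarrow> j < r"
  using width_bounds(1,2)[of k] by (auto simp: ext_def split: if_splits)

lemma site_in_line_sites:
  assumes "b < B" "j \<in> ext k"
  shows "site k (pos k b j) v \<in> line_sites k v"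
  unfolding line_sites_def using pos_bounds[OF assms(1) ext_lt[OF assms(2)], of k] by auto

lemma seeded_depends:
  assumes "\<beta> \<subseteq> {..<B}" "\<And>z. z \<in> line_sites k v \<Longrightarrow> \<omega> z = \<omega>' z"
  shows "seeded k \<beta> \<omega> v = seeded k \<beta> \<omega>' v"
proof -
  have "\<omega> (site k (pos k b j) v) = \<omega>' (site k (pos k b j) v)" if "b \<in> \<beta>" "j \<in> ext k" for b j
    using that assms(1) by (intro assms(2) site_in_line_sites) auto
  then show ?thesis by (auto simp: seeded_def)
qed

definition block_sites :: "nat \<Rightarrow> nat \<Rightarrow> (int \<times> int) set" where
  "block_sites k b = (\<Union>j<needed (Suc k). line_sites k (pos (Suc k) b j))"

lemma finite_block_sites [simp]: "finite (block_sites k b)" by (simp add: block_sites_def)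

lemma block_sites_present: "b < B \<Longrightarrow> block_sites k b \<subseteq> present k"
  unfolding block_sites_def present_def using width_bounds(3)[of "Suc k"] by fastforce

lemma good_depends:
  assumes "\<beta> \<subseteq> {..<B}" "\<And>z. z \<in> block_sites k b \<Longrightarrow> \<omega> z = \<omega>' z"
  shows "good k \<beta> \<omega> b = good k \<beta> \<omega>' b"
proof -
  have "seeded k \<beta> \<omega> (pos (Suc k) b j) = seeded k \<beta> \<omega>' (pos (Suc k) b j)" if "j < needed (Suc k)" for j
    by (rule seeded_depends[OF assms(1)]) (use that assms(2) in \<open>auto simp: block_sites_def\<close>)
  then show ?thesis by (auto simp: good_def)
qed

lemma present_subset_past:
  assumes "j < k" "k \<le> F"
  shows "present j \<subseteq> past k"
proof
  fix z assume "z \<in> present j"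
  then obtain b i u where bi: "b < B" "i < r" and z: "z = site j u (pos (Suc j) b i)"
    and u: "int (j * W) \<le> u" "u < int (Suc j * W)"
    by (auto simp: present_def line_sites_def)
  have le: "Suc j * W \<le> k * W" "Suc j * W \<le> M"
    unfolding M_def using assms by (intro mult_le_mono; simp)+
  then have le': "int (Suc j * W) \<le> int (k * W)" "int (Suc j * W) \<le> int M" by (simp_all only: of_nat_le_iff)
  have u0: "0 \<le> u" using u(1) by (rule order_trans[rotated]) simp
  have v: "0 \<le> pos (Suc j) b i" "pos (Suc j) b i < int M"
    using pos_lt_M[OF bi, of "Suc j"] assms by auto
  have u': "u < int (k * W)" "u < int M" using u le' by linarith+
  then show "z \<in> past k" using u0 v by (auto simp: past_def z site_def)
qed

lemma full_blocks_depends: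
  assumes "\<And>z. z \<in> past k \<Longrightarrow> \<omega> z = \<omega>' z" "k \<le> F"
  shows "full_blocks k \<omega> = full_blocks k \<omega>'"
proof -
  have "full_blocks j \<omega> = full_blocks j \<omega>'" if "j \<le> k" for j
    using that
  proof (induction j)
    case (Suc j)
    then have IH: "full_blocks j \<omega> = full_blocks j \<omega>'" by simp
    have "good j (full_blocks j \<omega>) \<omega> b = good j (full_blocks j \<omega>) \<omega>' b" if "b < B" for b
    proof (rule good_depends[OF full_blocks_subset])
      fix z assume "z \<in> block_sites j b"
      then have "z \<in> past k"
        using block_sites_present[OF that, of j] present_subset_past[of j k] Suc.prems assms(2) by auto
      then show "\<omega> z = \<omega>' z" by (rule assms(1))
    qed
    then show ?case by (auto simp: IH)
  qed simp
  then show ?thesis by simp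
qed

lemma line_sites_disjoint: "v \<noteq> v' \<Longrightarrow> line_sites k v \<inter> line_sites k v' = {}"
  by (auto simp: line_sites_def)

lemma block_sites_disjoint:
  assumes "b \<noteq> b'"
  shows "block_sites k b \<inter> block_sites k b' = {}"
proof -
  have "line_sites k (pos (Suc k) b j) \<inter> line_sites k (pos (Suc k) b' j') = {}"
    if "j < needed (Suc k)" "j' < needed (Suc k)" for j j'
    using pos_inj[of j j' "Suc k" b b'] that width_bounds(3)[of "Suc k"] assms
    by (intro line_sites_disjoint) auto
  then show ?thesis unfolding block_sites_def by blast
qed

end

section \<open>Probability estimates for the seeding\<close>

locale random_seeding = bernoulli_field p + seeding r s \<rho> B F for p :: real and r s \<rho> B F :: nat
begin

abbreviation cost :: "nat \<Rightarrow> nat" where "cost k \<equiv> card (ext k)"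

lemma finite_ext [simp]: "finite (ext k)" by (simp add: ext_def)

lemma prob_not_seeded:
  assumes \<beta>: "\<beta> \<subseteq> {..<B}"
  shows "prob {\<omega>. \<not> seeded k \<beta> \<omega> v} = (1 - p ^ cost k) ^ card \<beta>"
proof -
  define S where "S b = (\<lambda>j. site k (pos k b j) v) ` ext k" for b
  have finS: "finite (S b)" for b by (simp add: S_def)
  have cardS: "card (S b) = cost k" for b
    unfolding S_def by (intro card_image) (auto simp: inj_on_def dest: pos_inj[OF ext_lt ext_lt])
  have fin\<beta>: "finite \<beta>" using \<beta> finite_subset by blast
  have dep: "depends (S b) (- {\<omega>. \<forall>z\<in>S b. \<omega> z})" for b
    by (intro depends_compl depends_all_occupied) simp
  have compl: "prob (- {\<omega>. \<forall>z\<in>S b. \<omega> z}) = 1 - p ^ cost k" for b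
  proof -
    have "{\<omega>. \<forall>z\<in>S b. \<omega> z} \<in> events"
      by (rule depends_sets[OF finS[of b] depends_all_occupied]) simp
    from prob_compl[OF this] show ?thesis
      by (simp add: prob_all_occupied[OF finS] cardS Compl_eq_Diff_UNIV)
  qed
  have "disjoint_family_on S \<beta>"
    unfolding disjoint_family_on_def S_def by (auto dest: pos_inj[OF ext_lt ext_lt])
  then have "prob (\<Inter>b\<in>\<beta>. - {\<omega>. \<forall>z\<in>S b. \<omega> z}) = (\<Prod>b\<in>\<beta>. prob (- {\<omega>. \<forall>z\<in>S b. \<omega> z}))"
    using dep finS by (intro prob_INT_depends[OF fin\<beta>]) auto
  also have "\<dots> = (1 - p ^ cost k) ^ card \<beta>" by (simp add: compl)
  also have "(\<Inter>b\<in>\<beta>. - {\<omega>. \<forall>z\<in>S b. \<omega> z}) = {\<omega>. \<not> seeded k \<beta> \<omega> v}"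
    by (auto simp: seeded_def S_def)
  finally show ?thesis by simp
qed

lemma depends_seeded:
  assumes "\<beta> \<subseteq> {..<B}"
  shows "depends (line_sites k v) {\<omega>. seeded k \<beta> \<omega> v}"
  by (rule depends_vimage[where P = "\<lambda>x. x"]) (rule seeded_depends[OF assms])

lemma depends_good:
  assumes "\<beta> \<subseteq> {..<B}"
  shows "depends (block_sites k b) {\<omega>. good k \<beta> \<omega> b}"
  by (rule depends_vimage[where P = "\<lambda>x. x"]) (rule good_depends[OF assms])

lemma prob_seeded:
  assumes \<beta>: "\<beta> \<subseteq> {..<B}"
  shows "prob {\<omega>. seeded k \<beta> \<omega> v} = 1 - (1 - p ^ cost k) ^ card \<beta>"
proof -
  have "{\<omega>. seeded k \<beta> \<omega> v} \<in> events"
    by (rule depends_sets[OF finite_line_sites depends_seeded[OF \<beta>]])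
  moreover have "UNIV - {\<omega>. seeded k \<beta> \<omega> v} = {\<omega>. \<not> seeded k \<beta> \<omega> v}" by auto
  ultimately show ?thesis using prob_compl[of "{\<omega>. seeded k \<beta> \<omega> v}"] prob_not_seeded[OF \<beta>, of k v] by simp
qed

lemma prob_good:
  assumes \<beta>: "\<beta> \<subseteq> {..<B}"
  shows "prob {\<omega>. good k \<beta> \<omega> b} = (1 - (1 - p ^ cost k) ^ card \<beta>) ^ needed (Suc k)"
proof -
  let ?v = "pos (Suc k) b"
  have "prob (\<Inter>j\<in>{..<needed (Suc k)}. {\<omega>. seeded k \<beta> \<omega> (?v j)})
      = (\<Prod>j\<in>{..<needed (Suc k)}. prob {\<omega>. seeded k \<beta> \<omega> (?v j)})"
  proof (rule prob_INT_depends[where D = "\<lambda>j. line_sites k (?v j)"])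
    show "disjoint_family_on (\<lambda>j. line_sites k (?v j)) {..<needed (Suc k)}"
      unfolding disjoint_family_on_def
      using pos_inj[of _ _ "Suc k" b b] width_bounds(3)[of "Suc k"]
      by (intro ballI impI line_sites_disjoint) fastforce
  qed (auto simp: depends_seeded[OF \<beta>])
  moreover have "(\<Inter>j\<in>{..<needed (Suc k)}. {\<omega>. seeded k \<beta> \<omega> (?v j)}) = {\<omega>. good k \<beta> \<omega> b}"
    by (auto simp: good_def)
  ultimately show ?thesis by (simp add: prob_seeded[OF \<beta>])
qed

lemma one_minus_power_le_exp: "(1 - x) ^ n \<le> exp (- x * real n)" if "x \<le> 1" for x :: real
proof -
  have "(1 - x) ^ n \<le> exp (- x) ^ n"
    using that exp_ge_add_one_self[of "- x"] by (intro power_mono) auto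
  also have "\<dots> = exp (- x * real n)" by (rule exp_of_nat2_mult[symmetric])
  finally show ?thesis .
qed

text \<open>A lower bound for the probability that a block of level \<open>k + 1\<close> is good
  when at least \<open>G\<close> blocks of level \<open>k\<close> are full: each of its needed lines
  must find one full block whose extra sites are occupied.\<close>

definition rate :: "nat \<Rightarrow> real \<Rightarrow> real" where
  "rate k G = (1 - exp (- (p ^ cost k) * G)) ^ needed (Suc k)"

lemma prob_chunk_bad:
  assumes \<beta>: "\<beta> \<subseteq> {..<B}" and G: "0 \<le> G" "G \<le> real (card \<beta>)" and C: "C \<subseteq> {..<B}"
  shows "prob {\<omega>. \<forall>b\<in>C. \<not> good k \<beta> \<omega> b} \<le> exp (- rate k G * real (card C))"
proof -
  define q where "q = (1 - (1 - p ^ cost k) ^ card \<beta>) ^ needed (Suc k)"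
  have pc: "0 \<le> p ^ cost k" "p ^ cost k \<le> 1" using p0 p1 by (auto simp: power_le_one)
  have q1: "q \<le> 1"
    unfolding q_def using pc by (intro power_le_one) (auto simp: power_le_one)
  have finC: "finite C" using C finite_subset by blast
  have "prob (\<Inter>b\<in>C. - {\<omega>. good k \<beta> \<omega> b}) = (\<Prod>b\<in>C. prob (- {\<omega>. good k \<beta> \<omega> b}))"
  proof (rule prob_INT_depends[OF finC, where D = "block_sites k"])
    show "disjoint_family_on (block_sites k) C"
      unfolding disjoint_family_on_def using block_sites_disjoint by blast
  qed (auto intro: depends_compl depends_good[OF \<beta>])
  also have "\<dots> = (1 - q) ^ card C"
  proof -
    have "prob (- {\<omega>. good k \<beta> \<omega> b}) = 1 - q" for b
      using prob_compl[OF depends_sets[OF finite_block_sites depends_good[OF \<beta>]], of k b]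
      by (simp add: prob_good[OF \<beta>] q_def Compl_eq_Diff_UNIV)
    then show ?thesis by simp
  qed
  also have "\<dots> \<le> exp (- q * real (card C))" by (rule one_minus_power_le_exp[OF q1])
  also have "\<dots> \<le> exp (- rate k G * real (card C))"
  proof -
    have "(1 - p ^ cost k) ^ card \<beta> \<le> exp (- (p ^ cost k) * real (card \<beta>))"
      by (rule one_minus_power_le_exp[OF pc(2)])
    also have "\<dots> \<le> exp (- (p ^ cost k) * G)"
      using G pc by (simp add: mult_left_mono)
    finally have "rate k G \<le> q"
      unfolding rate_def q_def using G pc by (intro power_mono) auto
    then show ?thesis by (simp add: mult_right_mono)
  qed
  also have "(\<Inter>b\<in>C. - {\<omega>. good k \<beta> \<omega> b}) = {\<omega>. \<forall>b\<in>C. \<not> good k \<beta> \<omega> b}" by auto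
  finally show ?thesis .
qed

text \<open>A substitute for concentration of the number of good blocks. The blocks contain
  \<open>g\<close> disjoint chunks of length \<open>l\<close>; if fewer than \<open>g\<close> blocks
  are good, some chunk has none, and independence inside a chunk makes this exponentially
  unlikely.\<close>

lemma prob_step_seeding:
  assumes k: "k < F" and G: "0 \<le> G" and size: "g * l \<le> B"
  shows "prob {\<omega>. G \<le> real (card (full_blocks k \<omega>)) \<and> card (full_blocks (Suc k) \<omega>) < g}
    \<le> real g * exp (- rate k G * real l)" (is "_ \<le> ?c")
proof -
  define C where "C c = {c * l..<Suc c * l}" for c
  have C: "C c \<subseteq> {..<B}" if "c < g" for c
  proof -
    have "Suc c * l \<le> g * l" using that by (intro mult_le_mono) auto
    then show ?thesis using size by (auto simp: C_def)
  qed
  have cardC: "card (C c) = l" for c by (simp add: C_def)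
  have disjC: "c = c'" if "b \<in> C c" "b \<in> C c'" for b c c'
  proof -
    have "c = b div l" if "b \<in> C c" for c
      using that by (auto simp: C_def intro!: div_nat_eqI[symmetric] simp: mult.commute)
    with that show ?thesis by metis
  qed
  define Bad where "Bad \<beta> = (\<Union>c<g. {\<omega>. \<beta> \<subseteq> {..<B} \<and> (\<forall>b\<in>C c. \<not> good k \<beta> \<omega> b)})" for \<beta>
  define V where "V = {\<beta>. \<beta> \<subseteq> {..<B} \<and> G \<le> real (card \<beta>)}"
  have depB: "depends (present k) (Bad \<beta>)" for \<beta>
  proof (cases "\<beta> \<subseteq> {..<B}")
    case True
    show ?thesis unfolding Bad_def
    proof (rule depends_UN)
      fix c assume "c \<in> {..<g}"
      have "depends (present k) (\<Inter>b\<in>C c. - {\<omega>. good k \<beta> \<omega> b})"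
      proof (rule depends_INT)
        fix b assume "b \<in> C c"
        then have "b < B" using C \<open>c \<in> {..<g}\<close> by auto
        then show "depends (present k) (- {\<omega>. good k \<beta> \<omega> b})"
          by (rule depends_mono[OF depends_compl[OF depends_good[OF True]] block_sites_present])
      qed
      moreover have "(\<Inter>b\<in>C c. - {\<omega>. good k \<beta> \<omega> b}) = {\<omega>. \<beta> \<subseteq> {..<B} \<and> (\<forall>b\<in>C c. \<not> good k \<beta> \<omega> b)}"
        using True by auto
      ultimately show "depends (present k) {\<omega>. \<beta> \<subseteq> {..<B} \<and> (\<forall>b\<in>C c. \<not> good k \<beta> \<omega> b)}" by simp
    qed
  next
    case False
    then have "Bad \<beta> = {}" by (auto simp: Bad_def)
    then show ?thesis by (simp add: depends_def)
  qed
  have evB: "{\<omega>. \<forall>b\<in>C c. \<not> good k \<beta> \<omega> b} \<in> events" if "c < g" "\<beta> \<subseteq> {..<B}" for c \<beta>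
  proof -
    have "- {\<omega>. good k \<beta> \<omega> b} \<in> events" for b
      by (rule depends_sets[OF finite_block_sites depends_compl[OF depends_good[OF that(2)]]])
    then have "(\<Inter>b\<in>C c. - {\<omega>. good k \<beta> \<omega> b}) \<in> events"
      using sets.top[of \<mu>] by (cases "C c = {}") (auto simp: C_def)
    moreover have "(\<Inter>b\<in>C c. - {\<omega>. good k \<beta> \<omega> b}) = {\<omega>. \<forall>b\<in>C c. \<not> good k \<beta> \<omega> b}" by auto
    ultimately show ?thesis by simp
  qed
  have full_blocks_past: "full_blocks k \<omega> = full_blocks k \<omega>'" if "\<And>z. z \<in> past k \<Longrightarrow> \<omega> z = \<omega>' z" for \<omega> \<omega>'
    using that k by (intro full_blocks_depends) auto
  have depF: "depends (past k) {\<omega>. full_blocks k \<omega> = \<beta>}" for \<beta>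
    by (rule depends_vimage[where P = "\<lambda>x. x = \<beta>"]) (erule full_blocks_past)
  have "prob {\<omega>. full_blocks k \<omega> \<in> V \<and> \<omega> \<in> Bad (full_blocks k \<omega>)} \<le> ?c"
  proof (rule prob_fibres[where D = "past k" and E = "present k" and F = "full_blocks k"])
    show "full_blocks k \<omega> = full_blocks k \<omega>'" if "\<And>z. z \<in> past k \<Longrightarrow> \<omega> z = \<omega>' z" for \<omega> \<omega>'
      using that by (rule full_blocks_past)
    fix \<beta> assume "\<beta> \<in> V"
    then have \<beta>: "\<beta> \<subseteq> {..<B}" "G \<le> real (card \<beta>)" by (auto simp: V_def)
    have "prob (Bad \<beta>) \<le> (\<Sum>c<g. prob {\<omega>. \<forall>b\<in>C c. \<not> good k \<beta> \<omega> b})"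
      unfolding Bad_def using \<beta>(1) evB[OF _ \<beta>(1)]
      by (intro order_trans[OF finite_measure_subadditive_finite]) auto
    also have "\<dots> \<le> (\<Sum>c<g. exp (- rate k G * real l))"
      using prob_chunk_bad[OF \<beta>(1) G \<beta>(2) C] cardC by (intro sum_mono) auto
    finally have "prob (Bad \<beta>) \<le> ?c" by simp
    \<comment> \<open>For fixed \<open>\<beta>\<close> the bad event looks only at
      \<open>present k\<close>, whereas the value of \<open>full_blocks k\<close> is decided on
      \<open>past k\<close>.\<close>
    then show "prob ({\<omega>. full_blocks k \<omega> = \<beta>} \<inter> Bad \<beta>) \<le> ?c * prob {\<omega>. full_blocks k \<omega> = \<beta>}"
      using prob_Int_depends[OF finite_past finite_present past_present_disjoint depF depB, of \<beta> \<beta>]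
        mult_right_mono[of "prob (Bad \<beta>)" ?c "prob {\<omega>. full_blocks k \<omega> = \<beta>}"]
      by (simp add: mult.commute)
  qed (use depB in auto)
  moreover have "{\<omega>. G \<le> real (card (full_blocks k \<omega>)) \<and> card (full_blocks (Suc k) \<omega>) < g} \<subseteq>
      {\<omega>. full_blocks k \<omega> \<in> V \<and> \<omega> \<in> Bad (full_blocks k \<omega>)}"
  proof clarify
    fix \<omega> assume \<omega>: "G \<le> real (card (full_blocks k \<omega>))" "card (full_blocks (Suc k) \<omega>) < g"
    have "\<exists>c<g. \<forall>b\<in>C c. \<not> good k (full_blocks k \<omega>) \<omega> b"
    proof (rule ccontr)
      assume "\<not> ?thesis"
      then obtain f where f: "\<And>c. c < g \<Longrightarrow> f c \<in> C c \<and> good k (full_blocks k \<omega>) \<omega> (f c)" by metis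
      have "inj_on f {..<g}" using f disjC by (auto simp: inj_on_def) metis
      moreover have "f ` {..<g} \<subseteq> full_blocks (Suc k) \<omega>" using f C by fastforce
      ultimately have "card {..<g} \<le> card (full_blocks (Suc k) \<omega>)"
        by (intro card_inj_on_le[of f] finite_full_blocks) auto
      with \<omega>(2) show False by simp
    qed
    then show "full_blocks k \<omega> \<in> V \<and> \<omega> \<in> Bad (full_blocks k \<omega>)"
      using \<omega>(1) full_blocks_subset by (auto simp: V_def Bad_def)
  qed
  moreover have "{\<omega>. full_blocks k \<omega> \<in> V \<and> \<omega> \<in> Bad (full_blocks k \<omega>)} \<in> events"
  proof (rule depends_sets)
    show "finite (past k \<union> present k)" by simp
    show "depends (past k \<union> present k) {\<omega>. full_blocks k \<omega> \<in> V \<and> \<omega> \<in> Bad (full_blocks k \<omega>)}"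
    proof (rule dependsI)
      fix \<omega> \<omega>' :: "int \<times> int \<Rightarrow> bool"
      assume eq: "\<And>z. z \<in> past k \<union> present k \<Longrightarrow> \<omega> z = \<omega>' z"
        and in_A: "\<omega> \<in> {\<omega>. full_blocks k \<omega> \<in> V \<and> \<omega> \<in> Bad (full_blocks k \<omega>)}"
      have "full_blocks k \<omega> = full_blocks k \<omega>'" using eq k by (intro full_blocks_depends) auto
      moreover have "\<omega>' \<in> Bad (full_blocks k \<omega>)"
        by (rule depends_imp[OF depB[of "full_blocks k \<omega>"], of \<omega> \<omega>']) (use eq in_A in auto)
      ultimately show "\<omega>' \<in> {\<omega>. full_blocks k \<omega> \<in> V \<and> \<omega> \<in> Bad (full_blocks k \<omega>)}" using in_A by simp
    qed
  qed
  ultimately show ?thesis by (meson finite_measure_mono order_trans)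
qed

lemma depends_full_blocks:
  assumes "k \<le> F"
  shows "depends (past k) {\<omega>. P (full_blocks k \<omega>)}"
  by (rule depends_vimage) (rule full_blocks_depends[OF _ assms])

lemma prob_seeding_fails:
  assumes G: "\<And>k. k < F \<Longrightarrow> 0 \<le> G k" "G 0 \<le> real B"
    and step: "\<And>k. k < F \<Longrightarrow> nat \<lceil>G (Suc k)\<rceil> * l k \<le> B"
    and fail: "\<And>k. k < F \<Longrightarrow> real (nat \<lceil>G (Suc k)\<rceil>) * exp (- rate k (G k) * real (l k)) \<le> \<delta>"
    and "k \<le> F"
  shows "prob {\<omega>. real (card (full_blocks k \<omega>)) < G k} \<le> real k * \<delta>"
  using \<open>k \<le> F\<close>
proof (induction k)
  case 0
  have "{\<omega>. real (card (full_blocks 0 \<omega>)) < G 0} = {}" using G(2) by auto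
  then show ?case by simp
next
  case (Suc k)
  let ?F = "{\<omega>. G k \<le> real (card (full_blocks k \<omega>)) \<and> card (full_blocks (Suc k) \<omega>) < nat \<lceil>G (Suc k)\<rceil>}"
  have ev1: "{\<omega>. P (full_blocks k \<omega>)} \<in> events" for P
    using Suc.prems by (intro depends_sets[OF finite_past depends_full_blocks]) auto
  have ev2: "{\<omega>. P (full_blocks (Suc k) \<omega>)} \<in> events" for P
    using Suc.prems by (intro depends_sets[OF finite_past depends_full_blocks]) auto
  have evF: "?F \<in> events" using sets.Int[OF ev1 ev2] by (simp add: Collect_conj_eq del: full_blocks.simps)
  have "{\<omega>. real (card (full_blocks (Suc k) \<omega>)) < G (Suc k)} \<subseteq> {\<omega>. real (card (full_blocks k \<omega>)) < G k} \<union> ?F"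
  proof
    fix \<omega> assume "\<omega> \<in> {\<omega>. real (card (full_blocks (Suc k) \<omega>)) < G (Suc k)}"
    then have "card (full_blocks (Suc k) \<omega>) < nat \<lceil>G (Suc k)\<rceil>"
      by (simp del: full_blocks.simps) linarith
    then show "\<omega> \<in> {\<omega>. real (card (full_blocks k \<omega>)) < G k} \<union> ?F" by (auto simp del: full_blocks.simps simp: not_less)
  qed
  then have "prob {\<omega>. real (card (full_blocks (Suc k) \<omega>)) < G (Suc k)} \<le> prob ({\<omega>. real (card (full_blocks k \<omega>)) < G k} \<union> ?F)"
    using ev1 evF by (intro finite_measure_mono sets.Un) auto
  also have "\<dots> \<le> prob {\<omega>. real (card (full_blocks k \<omega>)) < G k} + prob ?F"
    using ev1 evF by (intro measure_Un_le) auto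
  also have "\<dots> \<le> real k * \<delta> + \<delta>"
    using Suc prob_step_seeding[of k "G k" "nat \<lceil>G (Suc k)\<rceil>" "l k"] G(1)[of k] step[of k] fail[of k]
    by (intro add_mono) auto
  finally show ?case by (simp add: distrib_right add.commute)
qed

lemma prob_origin_not_hit:
  assumes "\<And>k. k < F \<Longrightarrow> 0 \<le> G k" "G 0 \<le> real B" "0 < G F"
    and "\<And>k. k < F \<Longrightarrow> nat \<lceil>G (Suc k)\<rceil> * l k \<le> B"
    and "\<And>k. k < F \<Longrightarrow> real (nat \<lceil>G (Suc k)\<rceil>) * exp (- rate k (G k) * real (l k)) \<le> \<delta>"
  shows "prob {\<omega>. (0, 0) \<notin> growth \<rho> (line_growth r s) {z. \<omega> z} (Suc F * M)} \<le> real F * \<delta>"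
proof -
  have "{\<omega>. (0, 0) \<notin> growth \<rho> (line_growth r s) {z. \<omega> z} (Suc F * M)} \<subseteq> {\<omega>. real (card (full_blocks F \<omega>)) < G F}"
  proof clarify
    fix \<omega> assume "(0, 0) \<notin> growth \<rho> (line_growth r s) {z. \<omega> z} (Suc F * M)"
    then have "full_blocks F \<omega> = {}" using origin_hit by blast
    then show "real (card (full_blocks F \<omega>)) < G F" using assms(3) by simp
  qed
  then have "prob {\<omega>. (0, 0) \<notin> growth \<rho> (line_growth r s) {z. \<omega> z} (Suc F * M)}
      \<le> prob {\<omega>. real (card (full_blocks F \<omega>)) < G F}"
    by (intro finite_measure_mono depends_sets[OF finite_past depends_full_blocks]) auto
  also have "\<dots> \<le> real F * \<delta>"
    by (rule prob_seeding_fails[OF assms(1,2,4,5)]) auto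
  finally show ?thesis .
qed

end

section \<open>Exponents of the cascade for the upper bound\<close>

lemma one_minus_exp_ge: "x / 2 \<le> 1 - exp (- x)" if "0 \<le> x" "x \<le> 1" for x :: real
proof -
  have "exp (- x) = 1 / exp x" by (simp add: exp_minus field_simps)
  also have "\<dots> \<le> 1 / (1 + x)"
    using that exp_ge_add_one_self[of x] by (intro divide_left_mono) (auto simp: add_pos_nonneg)
  also have "\<dots> \<le> 1 - x / 2"
  proof -
    have "0 \<le> x * (1 - x)" using that by simp
    then have "1 \<le> (1 - x / 2) * (1 + x)" by (simp add: algebra_simps)
    then show ?thesis using that by (simp add: pos_divide_le_eq)
  qed
  finally show ?thesis by simp
qed

lemma nat_ceiling_le_double: "1 \<le> x \<Longrightarrow> real (nat \<lceil>x\<rceil>) \<le> 2 * x" for x :: real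
  by linarith

context random_seeding
begin

text \<open>\<open>\<alpha> k\<close> is the exponent of the guaranteed number of full blocks. A
  line finds a suitable block with probability about \<open>p powr (cost k - \<alpha> k)\<close>, a
  good block needs \<open>needed (Suc k)\<close> such lines, and about
  \<open>p powr - \<Gamma>\<close> blocks are available; \<open>step\<close> states that
  \<open>\<alpha> (Suc k)\<close> respects this balance.\<close>

lemma prob_origin_not_hit_exponents:
  fixes \<alpha> :: "nat \<Rightarrow> real" and \<Gamma> \<delta> :: real
  assumes p: "0 < p" "p < 1" and B: "p powr - \<Gamma> \<le> real B"
    and \<alpha>: "\<alpha> 0 = \<Gamma>" "\<And>k. k \<le> F \<Longrightarrow> 0 \<le> \<alpha> k"
    and cost: "\<And>k. k < F \<Longrightarrow> \<alpha> k \<le> real (cost k)"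
    and step: "\<And>k. k < F \<Longrightarrow> \<alpha> (Suc k) + real (needed (Suc k)) * (real (cost k) - \<alpha> k) + 2 * \<delta> \<le> \<Gamma>"
    and \<delta>: "0 < \<delta>" and small: "2 ^ (r + 2) * p powr - (\<Gamma> - \<delta>) \<le> p powr - \<Gamma>"
  shows "prob {\<omega>. (0, 0) \<notin> growth \<rho> (line_growth r s) {z. \<omega> z} (Suc F * M)}
    \<le> real F * (2 * p powr - \<Gamma> * exp (- (p powr - \<delta>)))"
proof (rule prob_origin_not_hit)
  let ?G = "\<lambda>k. p powr - \<alpha> k"
  \<comment> \<open>This chunk length makes the expected number of good blocks per chunk at least
    \<open>p powr - \<delta>\<close>, so a chunk fails with probability at most
    \<open>exp (- (p powr - \<delta>))\<close>.\<close>
  let ?l = "\<lambda>k. nat \<lceil>p powr - \<delta> / rate k (?G k)\<rceil>"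
  have le: "p powr a \<le> p powr b" if "b \<le> a" for a b
    using p that by (intro powr_mono') auto
  have ge1: "1 \<le> p powr - a" if "0 \<le> a" for a
    using le[of "- a" 0] that p by simp
  show "0 \<le> ?G k" for k by simp
  show "?G 0 \<le> real B" using B \<alpha>(1) by simp
  show "0 < ?G F" using p by simp
  fix k assume k: "k < F"
  define c where "c = real (cost k) - \<alpha> k"
  have c: "0 \<le> c" using cost[OF k] by (simp add: c_def)
  let ?n = "needed (Suc k)"
  have x: "p ^ cost k * ?G k = p powr c"
    using p by (simp add: c_def powr_realpow[symmetric] flip: powr_add)
  have x1: "p powr c \<le> 1" using le[OF c] p by simp
  have rate: "(p powr c / 2) ^ ?n \<le> rate k (?G k)" "rate k (?G k) \<le> 1"
  proof -
    have "rate k (?G k) = (1 - exp (- (p powr c))) ^ ?n"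
      by (simp add: rate_def x)
    moreover have "(p powr c / 2) ^ ?n \<le> (1 - exp (- (p powr c))) ^ ?n"
      using one_minus_exp_ge[of "p powr c"] x1 by (intro power_mono) auto
    moreover have "(1 - exp (- (p powr c))) ^ ?n \<le> 1"
      by (intro power_le_one) auto
    ultimately show "(p powr c / 2) ^ ?n \<le> rate k (?G k)" "rate k (?G k) \<le> 1" by simp_all
  qed
  have pos: "0 < (p powr c / 2) ^ ?n" using p by simp
  have rate_pos: "0 < rate k (?G k)" using pos rate(1) by linarith
  have a': "0 \<le> \<alpha> (Suc k)" using \<alpha>(2) k by simp
  have nc: "0 \<le> real ?n * c" using c by simp
  have "1 \<le> p powr - \<delta> / rate k (?G k)"
    using rate(2) rate_pos ge1[of \<delta>] \<delta> by (simp add: le_divide_eq)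
  then have "real (?l k) \<le> 2 * (p powr - \<delta> / rate k (?G k))"
    by (rule nat_ceiling_le_double)
  also have "\<dots> \<le> 2 * (p powr - \<delta> / (p powr c / 2) ^ ?n)"
    using rate(1) pos rate_pos by (intro mult_left_mono divide_left_mono) auto
  also have "\<dots> = 2 ^ (?n + 1) * p powr (- \<delta> - real ?n * c)"
    using p by (simp add: power_divide powr_power powr_diff)
  finally have l: "real (?l k) \<le> 2 ^ (?n + 1) * p powr (- \<delta> - real ?n * c)" .
  have g: "real (nat \<lceil>?G (Suc k)\<rceil>) \<le> 2 * ?G (Suc k)"
    by (rule nat_ceiling_le_double[OF ge1[OF a']])
  have "real (nat \<lceil>?G (Suc k)\<rceil> * ?l k) = real (nat \<lceil>?G (Suc k)\<rceil>) * real (?l k)" by simp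
  also have "\<dots> \<le> 2 * ?G (Suc k) * (2 ^ (?n + 1) * p powr (- \<delta> - real ?n * c))"
    using g l by (intro mult_mono) auto
  also have "\<dots> = 2 ^ (?n + 2) * p powr (- \<alpha> (Suc k) + (- \<delta> - real ?n * c))"
    by (simp only: powr_add[of p "- \<alpha> (Suc k)" "- \<delta> - real ?n * c"]) simp
  \<comment> \<open>Of the term \<open>2 * \<delta>\<close> in \<open>step\<close>, one
    \<open>\<delta>\<close> pays for the chunk length; the other remains to absorb the constant by
    \<open>small\<close>.\<close>
  also have "\<dots> \<le> 2 ^ (r + 2) * p powr - (\<Gamma> - \<delta>)"
    using step[OF k] width_bounds(3)[of "Suc k"]
    by (intro mult_mono le power_increasing) (auto simp: c_def)
  also have "\<dots> \<le> real B" using small B by simp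
  finally show "nat \<lceil>?G (Suc k)\<rceil> * ?l k \<le> B" by (simp only: of_nat_le_iff)
  have "p powr - \<delta> = rate k (?G k) * (p powr - \<delta> / rate k (?G k))" using rate_pos by simp
  also have "\<dots> \<le> rate k (?G k) * real (?l k)"
    using rate_pos by (intro mult_left_mono) (auto intro: real_nat_ceiling_ge)
  finally have "exp (- rate k (?G k) * real (?l k)) \<le> exp (- (p powr - \<delta>))" by simp
  moreover have "?G (Suc k) \<le> p powr - \<Gamma>"
    using step[OF k] nc \<delta> by (intro le) (simp add: c_def)
  ultimately show "real (nat \<lceil>?G (Suc k)\<rceil>) * exp (- rate k (?G k) * real (?l k)) \<le>
      2 * p powr - \<Gamma> * exp (- (p powr - \<delta>))"
    using g by (intro mult_mono) auto
qed

end

text \<open>In terms of \<open>x = p powr - \<delta>\<close>, which tends to infinity, the first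
  factor is at most a power of \<open>x\<close> and the second is \<open>exp (- x)\<close>.\<close>

lemma powr_times_exp_tendsto_0:
  fixes \<Gamma> \<delta> :: real
  assumes "0 < \<delta>"
  shows "((\<lambda>p :: real. p powr - \<Gamma> * exp (- (p powr - \<delta>))) \<longlongrightarrow> 0) (at_right 0)"
proof -
  obtain n :: nat where n: "\<Gamma> / \<delta> < real n" using reals_Archimedean2 by blast
  have "filterlim (\<lambda>p :: real. inverse (1 * p powr \<delta>)) at_top (at_right 0)"
    by (intro filterlim_inverse_at_top powr_tendsto_0 assms)
      (auto simp: eventually_at_right_less eventually_at_filter)
  then have "filterlim (\<lambda>p :: real. p powr - \<delta>) at_top (at_right 0)"
    by (simp add: powr_minus)
  from filterlim_compose[OF tendsto_power_div_exp_0 this]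
  have lim: "((\<lambda>p :: real. (p powr - \<delta>) ^ n / exp (p powr - \<delta>)) \<longlongrightarrow> 0) (at_right 0)" .
  show ?thesis
  proof (rule tendsto_sandwich[OF _ _ tendsto_const lim])
    show "eventually (\<lambda>p :: real. 0 \<le> p powr - \<Gamma> * exp (- (p powr - \<delta>))) (at_right 0)"
      by simp
    show "eventually (\<lambda>p :: real. p powr - \<Gamma> * exp (- (p powr - \<delta>)) \<le> (p powr - \<delta>) ^ n / exp (p powr - \<delta>)) (at_right 0)"
      using eventually_at_right_unit
    proof eventually_elim
      case (elim p)
      have "p powr - \<Gamma> \<le> p powr (real n * - \<delta>)"
        using elim n assms by (intro powr_mono') (auto simp: field_simps)
      also have "\<dots> = (p powr - \<delta>) ^ n" using elim by (simp add: powr_power)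
      finally show ?case by (simp add: exp_minus divide_inverse)
    qed
  qed
qed

text \<open>The choice \<open>e = 1 / (r * i)\<close> lets the column exponent grow in steps of
  \<open>e\<close> and reach \<open>1 / r\<close> exactly after \<open>i\<close> rounds. Then
  \<open>s * (1 - 1 / r) = \<gamma>\<close>, so blocks of \<open>s\<close> filled rows exist in a
  box of exponent above \<open>\<gamma>\<close>.\<close>

lemma upper_limit_step:
  fixes r s \<rho> i :: nat
  defines "\<gamma> \<equiv> (real r - 1) * real s / real r"
  assumes rs: "2 \<le> s" "s \<le> r" "r \<le> \<rho>" and i: "1 \<le> i"
  defines "e \<equiv> 1 / (real r * real i)"
  shows "((\<lambda>p. measure (init_measure p) {\<omega>. (0, 0) \<notin> growth \<rho> (line_growth r s) {z. \<omega> z}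
      (Suc (2 * i) * (Suc (2 * i) * (nat \<lceil>p powr - (\<gamma> + e)\<rceil> * r)))}) \<longlongrightarrow> 0) (at_right 0)"
proof (rule tendsto_sandwich[OF _ _ tendsto_const])
  define \<Gamma> where "\<Gamma> = \<gamma> + e"
  define a where "a = real s / real r"
  have rpos: "0 < real r" "2 \<le> real r" "2 \<le> real s" "real s \<le> real r" using rs by auto
  have e: "0 < e" using rpos i by (simp add: e_def)
  have ei: "e * real i = 1 / real r" using rpos i by (simp add: e_def)
  have r1: "1 / real r \<le> 1 / 2" using rpos by (simp add: field_simps)
  have ra: "(real r - 1) * a = \<gamma>" "\<gamma> = real s - a" "a \<le> 1" "real s / real r = a" "0 < a"
    using rpos by (auto simp: \<gamma>_def a_def field_simps)
  have sa: "real s * (1 / real r) = a" by (simp add: a_def)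
  have e1: "e \<le> 1 / real r"
    using ei i e mult_left_mono[of 1 "real i" e] by simp
  have "1 / real r \<le> a" unfolding a_def using rpos by (intro divide_right_mono) auto
  \<comment> \<open>Level \<open>k\<close> has at least \<open>p powr - \<alpha> k\<close> full blocks. Each round of two levels gains a factor
    \<open>p powr - e\<close> in the number of column blocks; once this number reaches \<open>p powr - (1 / r)\<close>, some
    \<open>s\<close> adjacent rows are filled.\<close>
  define \<alpha> where "\<alpha> k = (if k = 0 then \<Gamma> else if odd k then real ((k + 1) div 2) * e
      else if k = 2 * i then 0 else \<gamma> + e / 2 - (real s - 1) * (1 - real (k div 2) * e))" for k :: nat
  define \<delta> where "\<delta> = e / 8"
  have "((\<lambda>p :: real. real (2 * i) * (2 * (p powr - \<Gamma> * exp (- (p powr - \<delta>))))) \<longlongrightarrow> real (2 * i) * (2 * 0)) (at_right 0)"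
    using e by (intro tendsto_mult tendsto_const powr_times_exp_tendsto_0) (simp add: \<delta>_def)
  then show "((\<lambda>p :: real. real (2 * i) * (2 * p powr - \<Gamma> * exp (- (p powr - \<delta>)))) \<longlongrightarrow> 0) (at_right 0)"
    by (simp add: mult.assoc)
  show "eventually (\<lambda>p. 0 \<le> measure (init_measure p) {\<omega>. (0, 0) \<notin> growth \<rho> (line_growth r s) {z. \<omega> z}
      (Suc (2 * i) * (Suc (2 * i) * (nat \<lceil>p powr - (\<gamma> + e)\<rceil> * r)))}) (at_right 0)"
    by simp
  have "eventually (\<lambda>p :: real. 2 ^ (r + 2) * p powr - (\<Gamma> - \<delta>) \<le> p powr - \<Gamma>) (at_right 0)"
    using e by (intro eventually_powr_le) (simp add: \<delta>_def)
  then show "eventually (\<lambda>p. measure (init_measure p) {\<omega>. (0, 0) \<notin> growth \<rho> (line_growth r s) {z. \<omega> z}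
      (Suc (2 * i) * (Suc (2 * i) * (nat \<lceil>p powr - (\<gamma> + e)\<rceil> * r)))}
      \<le> real (2 * i) * (2 * p powr - \<Gamma> * exp (- (p powr - \<delta>)))) (at_right 0)"
    using eventually_at_right_unit
  proof eventually_elim
    case (elim p)
    define B where "B = nat \<lceil>p powr - (\<gamma> + e)\<rceil>"
    interpret random_seeding p r s \<rho> B "2 * i"
      using elim rs i by unfold_locales auto
    have cost0: "cost 0 = s" by (simp add: ext_def width_def)
    have cost1: "cost k = 1" if "0 < k" for k using that by (simp add: ext_def)
    have bound: "0 \<le> \<alpha> k \<and> (k < 2 * i \<longrightarrow> \<alpha> k \<le> real (cost k) \<and>
        \<alpha> (Suc k) + real (needed (Suc k)) * (real (cost k) - \<alpha> k) + 2 * \<delta> \<le> \<Gamma>)" if k: "k \<le> 2 * i" for k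
    proof -
      consider (zero) "k = 0" | (odd) j where "k = 2 * j + 1" "j < i" | (last) "k = 2 * i"
        | (even) j where "k = 2 * j" "1 \<le> j" "j < i"
      proof (cases "even k")
        case True
        then obtain j where "k = 2 * j" by (auto elim: evenE)
        then show ?thesis using that k by (cases "j = 0"; cases "j = i") auto
      next
        case False
        then obtain j where "k = 2 * j + 1" by (auto elim: oddE)
        then show ?thesis using that k by auto
      qed
      then show ?thesis
      proof cases
        case zero
        have "needed (Suc k) = r - 1" using zero by (simp add: needed_def width_def)
        then have n: "real (needed (Suc k)) = real r - 1" using rs by simp
        have "\<alpha> (Suc k) = e" by (simp add: \<alpha>_def zero)
        \<comment> \<open>Initially a column is filled with exponent
          \<open>s - \<Gamma> = a - e\<close>. For \<open>r - 1\<close> columns this saves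
          \<open>(r - 1) * e \<ge> e\<close> against \<open>\<gamma>\<close>, which pays for
          \<open>\<alpha> 1 = e\<close>.\<close>
        moreover have "(real r - 1) * (real s - \<Gamma>) = \<gamma> - (real r - 1) * e"
        proof -
          have "real s - \<Gamma> = a - e" using ra(2) by (simp add: \<Gamma>_def)
          then show ?thesis by (simp only: right_diff_distrib ra(1))
        qed
        moreover have "\<gamma> - (real r - 1) * e \<le> \<gamma> - e"
          using rpos e mult_right_mono[of 1 "real r - 1" e] by simp
        moreover have "0 \<le> \<gamma>" using rpos by (simp add: \<gamma>_def)
        moreover have "\<Gamma> \<le> real s" using \<open>1 / real r \<le> a\<close> e1 ra by (simp add: \<Gamma>_def)
        moreover have "\<alpha> k = \<Gamma>" "real (cost k) = real s" using zero cost0 by (simp_all add: \<alpha>_def)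
        moreover have "2 * \<delta> \<le> e" "0 \<le> \<Gamma>" "\<Gamma> = \<gamma> + e"
          using e \<open>0 \<le> \<gamma>\<close> by (simp_all add: \<delta>_def \<Gamma>_def)
        ultimately have "\<alpha> (Suc k) + real (needed (Suc k)) * (real (cost k) - \<alpha> k) + 2 * \<delta> \<le> \<Gamma> \<and>
            0 \<le> \<alpha> k \<and> \<alpha> k \<le> real (cost k)"
          unfolding n by (intro conjI) (simp only:, linarith, simp_all only:)
        then show ?thesis by blast
      next
        case (odd j)
        have \<alpha>k: "\<alpha> k = real (Suc j) * e" using odd by (simp add: \<alpha>_def)
        have ck: "cost k = 1" using odd cost1 by simp
        have "real (Suc j) * e \<le> real i * e" using odd e by (intro mult_right_mono) auto
        then have je: "real (Suc j) * e \<le> 1 / real r" using ei by (simp add: mult.commute)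
        \<comment> \<open>Apart from the last level, \<open>\<alpha> (Suc k)\<close> is defined to
          make this an equality. At the last level all \<open>s\<close> rows are needed, and the
          column exponent \<open>1 / r\<close> makes that affordable.\<close>
        have "\<alpha> (Suc k) + real (needed (Suc k)) * (1 - real (Suc j) * e) \<le> \<gamma> + e / 2"
        proof (cases "Suc j = i")
          case True
          have "needed (Suc k) = s" using odd True by (simp add: needed_def width_def)
          moreover have "\<alpha> (Suc k) = 0" using odd True by (simp add: \<alpha>_def)
          moreover have "real (Suc j) * e = 1 / real r" using True ei by (simp add: mult.commute)
          moreover have "real s * (1 - 1 / real r) = \<gamma>" using ra(2) sa by (simp only: right_diff_distrib mult_1_right)
          ultimately show ?thesis using e by simp
        next
          case False
          have "needed (Suc k) = s - 1" using odd False by (simp add: needed_def width_def)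
          moreover have "real (s - 1) = real s - 1" using rs by simp
          moreover have "\<alpha> (Suc k) = \<gamma> + e / 2 - (real s - 1) * (1 - real (Suc j) * e)"
            using odd False by (simp add: \<alpha>_def)
          ultimately show ?thesis by simp
        qed
        then show ?thesis using e je r1 by (simp add: \<alpha>k ck \<Gamma>_def \<delta>_def)
      next
        case last
        then show ?thesis using i by (simp add: \<alpha>_def)
      next
        case (even j)
        define m where "m = real j * e"
        have \<alpha>k: "\<alpha> k = \<gamma> + e / 2 - (real s - 1) * (1 - m)" using even by (simp add: \<alpha>_def m_def)
        have ck: "cost k = 1" using even cost1 by simp
        have m0: "0 \<le> m" "e \<le> m" using e even by (auto simp: m_def)
        have "real j * e \<le> real i * e" using even e by (intro mult_right_mono) auto
        then have m1: "m \<le> 1 / real r" using ei by (simp add: m_def mult.commute)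
        have c: "1 - \<alpha> k = a - e / 2 - (real s - 1) * m"
          using ra by (simp add: \<alpha>k algebra_simps)
        have "(real s - 1) * m \<le> (real s - 1) * (1 / real r)"
          using m1 rpos by (intro mult_left_mono) auto
        also have "\<dots> = a - 1 / real r" using sa by (simp only: left_diff_distrib mult_1_left)
        finally have "0 \<le> 1 - \<alpha> k" using c e e1 by linarith
        moreover have "0 \<le> \<alpha> k"
        proof -
          have "0 \<le> (real s - 1) * m" using m0 rpos by simp
          then show ?thesis using c ra e by linarith
        qed
        \<comment> \<open>The round trip through rows multiplies the exponent \<open>m\<close>
          gained so far by \<open>(r - 1) * (s - 1) \<ge> 1\<close>, so it is not lost. The next
          increment \<open>e\<close> is paid half by \<open>(r - 1) * (e / 2)\<close> and half by
          the excess of \<open>\<Gamma>\<close> over \<open>\<gamma>\<close>, which leaves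
          \<open>e / 2\<close> for \<open>2 * \<delta>\<close>.\<close>
        moreover have "\<alpha> (Suc k) + real (needed (Suc k)) * (1 - \<alpha> k) \<le> \<gamma> + e / 2"
        proof -
          have "Suc k \<noteq> 2 * i" using even by presburger
          then have "needed (Suc k) = r - 1" using even by (simp add: needed_def width_def)
          then have n: "real (needed (Suc k)) = real r - 1" using rs by simp
          have "\<alpha> (Suc k) = m + e" using even by (simp add: \<alpha>_def m_def algebra_simps)
          moreover have "(real r - 1) * (1 - \<alpha> k) = \<gamma> - (real r - 1) * (e / 2) - (real r - 1) * ((real s - 1) * m)"
            unfolding c using ra(1) by (simp add: algebra_simps)
          moreover have "1 * (e / 2) \<le> (real r - 1) * (e / 2)"
            using rpos e by (intro mult_right_mono) auto
          moreover have "1 * (1 * m) \<le> (real r - 1) * ((real s - 1) * m)"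
            using rpos m0 by (intro mult_mono) auto
          ultimately show ?thesis unfolding n by linarith
        qed
        ultimately show ?thesis using e by (simp add: ck \<Gamma>_def \<delta>_def)
      qed
    qed
    have "prob {\<omega>. (0, 0) \<notin> growth \<rho> (line_growth r s) {z. \<omega> z} (Suc (2 * i) * M)}
        \<le> real (2 * i) * (2 * p powr - \<Gamma> * exp (- (p powr - \<delta>)))"
    proof (rule prob_origin_not_hit_exponents[where \<alpha> = \<alpha>])
      show "0 < p" "p < 1" using elim by auto
      show "p powr - \<Gamma> \<le> real B" unfolding B_def \<Gamma>_def by (rule real_nat_ceiling_ge)
      show "\<alpha> 0 = \<Gamma>" by (simp add: \<alpha>_def)
      show "0 < \<delta>" using e by (simp add: \<delta>_def)
      show "2 ^ (r + 2) * p powr - (\<Gamma> - \<delta>) \<le> p powr - \<Gamma>" using elim by simp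
    qed (use bound in auto)
    moreover have "M = Suc (2 * i) * (B * r)" by (simp add: M_def W_def)
    ultimately show ?case by (simp add: B_def)
  qed
qed

section \<open>The critical power\<close>

text \<open>Influence travels at most \<open>\<rho>\<close> sites per step, so being hit by time
  \<open>t\<close> depends on finitely many sites and is measurable.\<close>

lemma growth_local:
  assumes "\<And>w. \<bar>fst w - fst z\<bar> \<le> int (\<rho> * t) \<Longrightarrow> \<bar>snd w - snd z\<bar> \<le> int (\<rho> * t) \<Longrightarrow> \<omega> w = \<omega>' w"
  shows "z \<in> growth \<rho> Z {w. \<omega> w} t \<longleftrightarrow> z \<in> growth \<rho> Z {w. \<omega>' w} t"
  using assms
proof (induction t arbitrary: z)
  case (Suc t)
  have same: "w \<in> growth \<rho> Z {w. \<omega> w} t \<longleftrightarrow> w \<in> growth \<rho> Z {w. \<omega>' w} t"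
    if w: "\<bar>fst w - fst z\<bar> \<le> int \<rho>" "\<bar>snd w - snd z\<bar> \<le> int \<rho>" for w
  proof (rule Suc.IH)
    fix x assume "\<bar>fst x - fst w\<bar> \<le> int (\<rho> * t)" "\<bar>snd x - snd w\<bar> \<le> int (\<rho> * t)"
    then have "\<bar>fst x - fst z\<bar> \<le> int \<rho> + int (\<rho> * t)" "\<bar>snd x - snd z\<bar> \<le> int \<rho> + int (\<rho> * t)"
      using w by linarith+
    then show "\<omega> x = \<omega>' x" by (intro Suc.prems) (auto simp: algebra_simps)
  qed
  have "nbhd_h \<rho> z \<inter> growth \<rho> Z {w. \<omega> w} t = nbhd_h \<rho> z \<inter> growth \<rho> Z {w. \<omega>' w} t"
    "nbhd_v \<rho> z \<inter> growth \<rho> Z {w. \<omega> w} t = nbhd_v \<rho> z \<inter> growth \<rho> Z {w. \<omega>' w} t"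
    using same by (auto simp: nbhd_h_def nbhd_v_def)
  then show ?case using same[of z] by simp
qed simp

text \<open>An infimum of a nonempty set of times is attained. The empty set gives
  \<open>\<top>\<close>, which is below no \<open>c\<close>, so the equivalence also covers
  configurations in which the origin is never hit.\<close>

lemma T_less_iff: "T \<rho> Z \<omega> < c \<longleftrightarrow> (\<exists>t. of_nat t < c \<and> (0, 0) \<in> growth \<rho> Z {z. \<omega> z} t)"
proof
  let ?S = "{enat t | t. (0, 0) \<in> growth \<rho> Z {z. \<omega> z} t}"
  assume less: "T \<rho> Z \<omega> < c"
  have "?S \<noteq> {}"
  proof
    assume "?S = {}"
    then have "T \<rho> Z \<omega> = \<top>" by (simp add: T_def hit_time_def Inf_enat_def)
    with less show False by simp
  qed
  then have "Inf ?S \<in> ?S" unfolding Inf_enat_def by (metis (mono_tags, lifting) LeastI ex_in_conv)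
  then obtain t where t: "Inf ?S = enat t" "(0, 0) \<in> growth \<rho> Z {z. \<omega> z} t" by blast
  then have "T \<rho> Z \<omega> = of_nat t" by (simp add: T_def hit_time_def)
  with t(2) less show "\<exists>t. of_nat t < c \<and> (0, 0) \<in> growth \<rho> Z {z. \<omega> z} t" by auto
next
  assume "\<exists>t. of_nat t < c \<and> (0, 0) \<in> growth \<rho> Z {z. \<omega> z} t"
  then obtain t where t: "of_nat t < c" "(0, 0) \<in> growth \<rho> Z {z. \<omega> z} t" by blast
  then have "hit_time \<rho> Z {z. \<omega> z} \<le> enat t"
    unfolding hit_time_def by (intro Inf_lower) blast
  then have "T \<rho> Z \<omega> \<le> ennreal_of_enat (enat t)"
    unfolding T_def by (simp only: ennreal_of_enat_le_iff)
  with t(1) show "T \<rho> Z \<omega> < c" by simp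
qed

text \<open>Times are integers and occupation persists, hence the floor. For negative
  \<open>x\<close> both sides say that the origin is occupied initially, as \<open>ennreal x\<close>
  and \<open>nat \<lfloor>x\<rfloor>\<close> are then 0.\<close>

lemma T_le_iff: "T \<rho> Z \<omega> \<le> ennreal x \<longleftrightarrow> (0, 0) \<in> growth \<rho> Z {z. \<omega> z} (nat \<lfloor>x\<rfloor>)"
proof
  assume le: "T \<rho> Z \<omega> \<le> ennreal x"
  have "T \<rho> Z \<omega> < ennreal (real (nat \<lfloor>x\<rfloor> + 1))"
    by (rule le_less_trans[OF le], rule ennreal_lessI) linarith+
  then obtain t where t: "of_nat t < ennreal (real (nat \<lfloor>x\<rfloor> + 1))" "(0, 0) \<in> growth \<rho> Z {z. \<omega> z} t"
    unfolding T_less_iff by blast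
  from t(1) have "t \<le> nat \<lfloor>x\<rfloor>"
    by (simp add: ennreal_of_nat_eq_real_of_nat ennreal_less_iff del: of_nat_add of_nat_Suc ennreal_plus)
  with t(2) show "(0, 0) \<in> growth \<rho> Z {z. \<omega> z} (nat \<lfloor>x\<rfloor>)" using growth_mono_time by blast
next
  assume hit: "(0, 0) \<in> growth \<rho> Z {z. \<omega> z} (nat \<lfloor>x\<rfloor>)"
  show "T \<rho> Z \<omega> \<le> ennreal x"
  proof (rule ccontr)
    assume "\<not> T \<rho> Z \<omega> \<le> ennreal x"
    then have "ennreal x < T \<rho> Z \<omega>" by simp
    moreover have "T \<rho> Z \<omega> \<le> of_nat (nat \<lfloor>x\<rfloor>)"
      using hit T_less_iff[of \<rho> Z \<omega> "T \<rho> Z \<omega>"] by (meson less_irrefl not_le)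
    ultimately have "ennreal x < of_nat (nat \<lfloor>x\<rfloor>)" by order
    then have "ennreal x < ennreal (real (nat \<lfloor>x\<rfloor>))" by (simp add: ennreal_of_nat_eq_real_of_nat)
    then show False
      by (cases "0 \<le> x") (auto simp: ennreal_less_iff ennreal_neg, linarith)
  qed
qed

context bernoulli_field
begin

lemma hit_event: "{\<omega>. (0, 0) \<in> growth \<rho> Z {z. \<omega> z} t} \<in> events"
proof (rule depends_sets)
  let ?D = "{- int (\<rho> * t)..int (\<rho> * t)} \<times> {- int (\<rho> * t)..int (\<rho> * t)}"
  show "finite ?D" by simp
  show "depends ?D {\<omega>. (0, 0) \<in> growth \<rho> Z {z. \<omega> z} t}"
  proof (rule dependsI)
    fix \<omega> \<omega>' :: "int \<times> int \<Rightarrow> bool"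
    assume eq: "\<And>z. z \<in> ?D \<Longrightarrow> \<omega> z = \<omega>' z"
      and hit: "\<omega> \<in> {\<omega>. (0, 0) \<in> growth \<rho> Z {z. \<omega> z} t}"
    have "\<omega> w = \<omega>' w" if "\<bar>fst w - fst (0 :: int, 0 :: int)\<bar> \<le> int (\<rho> * t)"
      "\<bar>snd w - snd (0 :: int, 0 :: int)\<bar> \<le> int (\<rho> * t)" for w
      by (rule eq) (use that in \<open>auto simp: mem_Times_iff abs_le_iff\<close>)
    from growth_local[of "(0, 0)" \<rho> t \<omega> \<omega>' Z, OF this] hit
    show "\<omega>' \<in> {\<omega>. (0, 0) \<in> growth \<rho> Z {z. \<omega> z} t}" by simp
  qed
qed

lemma not_hit_event: "{\<omega>. (0, 0) \<notin> growth \<rho> Z {z. \<omega> z} t} \<in> events"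
  using sets.compl_sets[OF hit_event[of \<rho> Z t]] by (simp add: set_diff_eq)

text \<open>A set outside the sigma-algebra would have \<open>emeasure\<close> 0; monotonicity of
  \<open>emeasure\<close> towards this set, used for uniqueness of the power, therefore requires its
  measurability.\<close>

lemma T_ge_event: "{\<omega>. c \<le> T \<rho> Z \<omega>} \<in> events"
proof -
  have "{\<omega>. c \<le> T \<rho> Z \<omega>} = UNIV - (\<Union>t\<in>{t. of_nat t < c}. {\<omega>. (0, 0) \<in> growth \<rho> Z {z. \<omega> z} t})"
    using T_less_iff[of \<rho> Z _ c] by (auto simp: not_less[symmetric])
  also have "\<dots> \<in> events"
  proof -
    have "(\<Union>t\<in>{t. of_nat t < c}. {\<omega>. (0, 0) \<in> growth \<rho> Z {z. \<omega> z} t}) \<in> events"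
      by (rule sets.countable_UN') (use hit_event in auto)
    from sets.compl_sets[OF this] show ?thesis by simp
  qed
  finally show ?thesis .
qed

lemma prob_hit_add: "prob {\<omega>. (0, 0) \<in> growth \<rho> Z {z. \<omega> z} t} + prob {\<omega>. (0, 0) \<notin> growth \<rho> Z {z. \<omega> z} t} = 1"
  using prob_compl[OF hit_event[of \<rho> Z t]] by (simp add: set_diff_eq)

end

lemma at_right_0_field: "eventually (\<lambda>p :: real. bernoulli_field p \<and> 0 < p) (at_right 0)"
  using eventually_at_right_unit by eventually_elim (auto intro: bernoulli_field.intro)

lemma tendsto_0_ennreal_le:
  fixes f :: "'a \<Rightarrow> real" and g :: "'a \<Rightarrow> ennreal"
  assumes "(f \<longlongrightarrow> 0) F" "eventually (\<lambda>x. g x \<le> ennreal (f x)) F"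
  shows "(g \<longlongrightarrow> 0) F"
proof (rule tendsto_sandwich[OF _ assms(2) tendsto_const])
  show "((\<lambda>x. ennreal (f x)) \<longlongrightarrow> 0) F" using tendsto_ennrealI[OF assms(1)] by simp
qed simp

section \<open>Both bounds and uniqueness of the power\<close>

locale line_growth_power =
  fixes r s \<rho> :: nat
  assumes rs: "2 \<le> s" "s \<le> r" "r \<le> \<rho>"
begin

definition \<gamma> :: real where "\<gamma> = (real r - 1) * real s / real r"

lemma \<gamma>_pos: "0 < \<gamma>" using rs by (simp add: \<gamma>_def)

abbreviation hit_prob :: "real \<Rightarrow> nat \<Rightarrow> real" where
  "hit_prob p t \<equiv> measure (init_measure p) {\<omega>. (0, 0) \<in> growth \<rho> (line_growth r s) {z. \<omega> z} t}"

abbreviation miss_prob :: "real \<Rightarrow> nat \<Rightarrow> real" where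
  "miss_prob p t \<equiv> measure (init_measure p) {\<omega>. (0, 0) \<notin> growth \<rho> (line_growth r s) {z. \<omega> z} t}"

text \<open>An exponent strictly between \<open>\<gamma> - \<epsilon>\<close> and
  \<open>\<gamma>\<close> absorbs every fixed factor \<open>l\<close>. The minimum with
  \<open>\<gamma>\<close> in \<open>e\<close> keeps \<open>lower_limit\<close> applicable when
  \<open>\<epsilon>\<close> is large.\<close>

lemma lower_times:
  assumes "0 < \<epsilon>"
  obtains t where "((\<lambda>p. hit_prob p (t p)) \<longlongrightarrow> 0) (at_right 0)"
    "eventually (\<lambda>p. nat \<lfloor>l * p powr - (\<gamma> - \<epsilon>)\<rfloor> \<le> t p) (at_right 0)"
proof
  define e where "e = min (\<epsilon> / 2) \<gamma>"
  have e: "0 < e" "e \<le> \<gamma>" "e < \<epsilon>" using assms \<gamma>_pos by (auto simp: e_def)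
  show "((\<lambda>p. hit_prob p (nat \<lfloor>p powr - (\<gamma> - e)\<rfloor>)) \<longlongrightarrow> 0) (at_right 0)"
    using lower_limit[OF rs(1,2), of e \<rho>] e by (simp add: \<gamma>_def)
  have "eventually (\<lambda>p :: real. l * p powr - (\<gamma> - \<epsilon>) \<le> p powr - (\<gamma> - e)) (at_right 0)"
    using e by (intro eventually_powr_le) simp
  then show "eventually (\<lambda>p. nat \<lfloor>l * p powr - (\<gamma> - \<epsilon>)\<rfloor> \<le> nat \<lfloor>p powr - (\<gamma> - e)\<rfloor>) (at_right 0)"
    by eventually_elim (intro nat_mono floor_mono)
qed

text \<open>Exponents \<open>\<gamma> + 1 / (r * i)\<close> come arbitrarily close to
  \<open>\<gamma>\<close>; once one lies strictly below \<open>\<gamma> + \<epsilon>\<close>, the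
  difference absorbs the number of levels, the block length and \<open>1 / l\<close>.\<close>

lemma upper_times:
  assumes "0 < \<epsilon>" "0 < l"
  obtains t where "((\<lambda>p. miss_prob p (t p)) \<longlongrightarrow> 0) (at_right 0)"
    "eventually (\<lambda>p. real (t p) < l * p powr - (\<gamma> + \<epsilon>)) (at_right 0)"
proof -
  obtain n where n: "inverse (real (Suc n)) < \<epsilon>" using reals_Archimedean[OF assms(1)] by blast
  define i where "i = Suc n"
  define e where "e = 1 / (real r * real i)"
  have "1 / (real r * real i) \<le> 1 / real i"
    using rs by (intro divide_left_mono) (auto simp: i_def)
  with n have e: "e < \<epsilon>" by (simp add: e_def i_def inverse_eq_divide)
  define t where "t p = Suc (2 * i) * (Suc (2 * i) * (nat \<lceil>p powr - (\<gamma> + e)\<rceil> * r))" for p :: real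
  define C where "C = real (Suc (2 * i)) * (real (Suc (2 * i)) * (2 * real r))"
  have C: "0 \<le> C" by (simp add: C_def)
  have e0: "0 < e" using rs by (simp add: e_def i_def)
  have "eventually (\<lambda>p :: real. (C + 1) / l * p powr - (\<gamma> + e) \<le> p powr - (\<gamma> + \<epsilon>)) (at_right 0)"
    using e by (intro eventually_powr_le) simp
  then have "eventually (\<lambda>p. real (t p) < l * p powr - (\<gamma> + \<epsilon>)) (at_right 0)"
    using eventually_at_right_unit
  proof eventually_elim
    case (elim p)
    have "p powr 0 \<le> p powr - (\<gamma> + e)" using elim \<gamma>_pos e0 by (intro powr_mono') auto
    then have ge1: "1 \<le> p powr - (\<gamma> + e)" using elim by simp
    have "real (t p) \<le> real (Suc (2 * i)) * (real (Suc (2 * i)) * (2 * p powr - (\<gamma> + e) * real r))"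
      unfolding t_def of_nat_mult
      by (intro mult_left_mono mult_right_mono nat_ceiling_le_double[OF ge1]) auto
    also have "\<dots> = C * p powr - (\<gamma> + e)" by (simp add: C_def)
    also have "\<dots> < (C + 1) * p powr - (\<gamma> + e)" using elim by (intro mult_strict_right_mono) auto
    also have "\<dots> = l * ((C + 1) / l * p powr - (\<gamma> + e))" using assms(2) by simp
    also have "\<dots> \<le> l * p powr - (\<gamma> + \<epsilon>)" using elim assms(2) by (intro mult_left_mono) auto
    finally show ?case .
  qed
  moreover have "((\<lambda>p. miss_prob p (t p)) \<longlongrightarrow> 0) (at_right 0)"
    using upper_limit_step[OF rs, of i] unfolding t_def e_def \<gamma>_def by (simp add: i_def)
  ultimately show thesis using that by blast
qed

text \<open>For each fixed \<open>l\<close> the upper limit in \<open>p\<close> is already 0, since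
  \<open>\<epsilon>\<close> leaves a positive power of \<open>p\<close> to spare; the limit in
  \<open>l\<close> is that of a constant.\<close>

lemma lower_power: "lower_power \<rho> (line_growth r s) \<gamma>"
  unfolding lower_power_def prob_greatersim_def
proof (intro conjI allI impI)
  fix \<epsilon> :: real assume \<epsilon>: "0 < \<epsilon>"
  show "((\<lambda>l. Limsup (at_right 0) (\<lambda>p. emeasure (init_measure p)
      {\<omega> \<in> space (init_measure p). T \<rho> (line_growth r s) \<omega> \<le> ennreal (l * p powr - (\<gamma> - \<epsilon>))})) \<longlongrightarrow> 0) (at_right 0)"
  proof (intro tendsto_eventually always_eventually allI)
    fix l :: real
    obtain t where t: "((\<lambda>p. hit_prob p (t p)) \<longlongrightarrow> 0) (at_right 0)"
      "eventually (\<lambda>p. nat \<lfloor>l * p powr - (\<gamma> - \<epsilon>)\<rfloor> \<le> t p) (at_right 0)"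
      using lower_times[OF \<epsilon>] by blast
    have "((\<lambda>p. emeasure (init_measure p) {\<omega> \<in> space (init_measure p).
        T \<rho> (line_growth r s) \<omega> \<le> ennreal (l * p powr - (\<gamma> - \<epsilon>))}) \<longlongrightarrow> 0) (at_right 0)"
    proof (rule tendsto_0_ennreal_le[OF t(1)])
      show "eventually (\<lambda>p. emeasure (init_measure p) {\<omega> \<in> space (init_measure p).
        T \<rho> (line_growth r s) \<omega> \<le> ennreal (l * p powr - (\<gamma> - \<epsilon>))} \<le> ennreal (hit_prob p (t p))) (at_right 0)"
        using t(2) at_right_0_field
      proof eventually_elim
        case (elim p)
        interpret bernoulli_field p using elim by blast
        have "emeasure \<mu> {\<omega> \<in> space \<mu>. T \<rho> (line_growth r s) \<omega> \<le> ennreal (l * p powr - (\<gamma> - \<epsilon>))}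
            \<le> emeasure \<mu> {\<omega>. (0, 0) \<in> growth \<rho> (line_growth r s) {z. \<omega> z} (t p)}"
          using growth_mono_time[OF elim(1)] by (intro emeasure_mono hit_event) (auto simp: T_le_iff)
        then show ?case by (simp add: emeasure_eq_measure)
      qed
    qed
    then show "Limsup (at_right 0) (\<lambda>p. emeasure (init_measure p) {\<omega> \<in> space (init_measure p).
        T \<rho> (line_growth r s) \<omega> \<le> ennreal (l * p powr - (\<gamma> - \<epsilon>))}) = 0"
      by (intro lim_imp_Limsup) auto
  qed
qed (rule \<gamma>_pos)

lemma upper_power: "upper_power \<rho> (line_growth r s) \<gamma>"
  unfolding upper_power_def prob_lesssim_def
proof (intro conjI allI impI)
  fix \<epsilon> :: real assume \<epsilon>: "0 < \<epsilon>"
  show "((\<lambda>l. Limsup (at_right 0) (\<lambda>p. emeasure (init_measure p)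
      {\<omega> \<in> space (init_measure p). ennreal (l * p powr - (\<gamma> + \<epsilon>)) \<le> T \<rho> (line_growth r s) \<omega>})) \<longlongrightarrow> 0) at_top"
  proof (rule tendsto_eventually, rule eventually_mono[OF eventually_gt_at_top[of 0]])
    fix l :: real assume l: "0 < l"
    obtain t where t: "((\<lambda>p. miss_prob p (t p)) \<longlongrightarrow> 0) (at_right 0)"
      "eventually (\<lambda>p. real (t p) < l * p powr - (\<gamma> + \<epsilon>)) (at_right 0)"
      using upper_times[OF \<epsilon> l] by blast
    have "((\<lambda>p. emeasure (init_measure p) {\<omega> \<in> space (init_measure p).
        ennreal (l * p powr - (\<gamma> + \<epsilon>)) \<le> T \<rho> (line_growth r s) \<omega>}) \<longlongrightarrow> 0) (at_right 0)"
    proof (rule tendsto_0_ennreal_le[OF t(1)])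
      show "eventually (\<lambda>p. emeasure (init_measure p) {\<omega> \<in> space (init_measure p).
        ennreal (l * p powr - (\<gamma> + \<epsilon>)) \<le> T \<rho> (line_growth r s) \<omega>} \<le> ennreal (miss_prob p (t p))) (at_right 0)"
        using t(2) at_right_0_field
      proof eventually_elim
        case (elim p)
        interpret bernoulli_field p using elim by blast
        have "of_nat (t p) < ennreal (l * p powr - (\<gamma> + \<epsilon>))"
          using elim by (simp add: ennreal_of_nat_eq_real_of_nat ennreal_less_iff)
        then have "(0, 0) \<notin> growth \<rho> (line_growth r s) {z. \<omega> z} (t p)"
          if "ennreal (l * p powr - (\<gamma> + \<epsilon>)) \<le> T \<rho> (line_growth r s) \<omega>" for \<omega>
          using that T_less_iff[of \<rho> "line_growth r s" \<omega>] by (meson not_less)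
        then have "emeasure \<mu> {\<omega> \<in> space \<mu>. ennreal (l * p powr - (\<gamma> + \<epsilon>)) \<le> T \<rho> (line_growth r s) \<omega>}
            \<le> emeasure \<mu> {\<omega>. (0, 0) \<notin> growth \<rho> (line_growth r s) {z. \<omega> z} (t p)}"
          by (intro emeasure_mono not_hit_event) auto
        then show ?case by (simp add: emeasure_eq_measure)
      qed
    qed
    then show "Limsup (at_right 0) (\<lambda>p. emeasure (init_measure p) {\<omega> \<in> space (init_measure p).
        ennreal (l * p powr - (\<gamma> + \<epsilon>)) \<le> T \<rho> (line_growth r s) \<omega>}) = 0"
      by (intro lim_imp_Limsup) auto
  qed
qed (rule \<gamma>_pos)

text \<open>If \<open>\<gamma>' < \<gamma>\<close>, the midpoint exponent is
  \<open>\<gamma>' + \<epsilon> = \<gamma> - \<epsilon>\<close>. For some \<open>l\<close> and small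
  \<open>p\<close> the origin would then be missed with probability below 1/2 by the assumption and
  hit with probability below 1/2 by \<open>lower_times\<close>, but the two probabilities add up to
  1.\<close>

lemma upper_power_ge:
  assumes "upper_power \<rho> (line_growth r s) \<gamma>'"
  shows "\<gamma> \<le> \<gamma>'"
proof (rule ccontr)
  assume "\<not> \<gamma> \<le> \<gamma>'"
  define \<epsilon> where "\<epsilon> = (\<gamma> - \<gamma>') / 2"
  have \<epsilon>: "0 < \<epsilon>" using \<open>\<not> \<gamma> \<le> \<gamma>'\<close> by (simp add: \<epsilon>_def)
  have eq: "\<gamma>' + \<epsilon> = \<gamma> - \<epsilon>" by (simp add: \<epsilon>_def field_simps)
  let ?P = "\<lambda>l p. emeasure (init_measure p)
      {\<omega> \<in> space (init_measure p). ennreal (l * p powr - (\<gamma>' + \<epsilon>)) \<le> T \<rho> (line_growth r s) \<omega>}"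
  have "((\<lambda>l. Limsup (at_right 0) (?P l)) \<longlongrightarrow> 0) at_top"
    using assms \<epsilon> unfolding upper_power_def prob_lesssim_def by blast
  then have "eventually (\<lambda>l. Limsup (at_right 0) (?P l) < ennreal (1 / 2)) at_top"
    by (rule order_tendstoD) (subst ennreal_less_zero_iff, simp)
  then obtain l where "Limsup (at_right 0) (?P l) < ennreal (1 / 2)"
    by (auto simp: eventually_at_top_linorder)
  then have lt: "eventually (\<lambda>p. ?P l p < ennreal (1 / 2)) (at_right 0)" by (rule Limsup_lessD)
  obtain t where t: "((\<lambda>p. hit_prob p (t p)) \<longlongrightarrow> 0) (at_right 0)"
    "eventually (\<lambda>p. nat \<lfloor>l * p powr - (\<gamma> - \<epsilon>)\<rfloor> \<le> t p) (at_right 0)"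
    using lower_times[OF \<epsilon>] by blast
  have "eventually (\<lambda>p. hit_prob p (t p) < 1 / 2) (at_right 0)"
    by (rule order_tendstoD[OF t(1)]) simp
  then have "eventually (\<lambda>p :: real. False) (at_right 0)"
    using lt t(2) at_right_0_field
  proof eventually_elim
    case (elim p)
    interpret bernoulli_field p using elim by blast
    have "{\<omega>. (0, 0) \<notin> growth \<rho> (line_growth r s) {z. \<omega> z} (t p)} \<subseteq>
        {\<omega> \<in> space \<mu>. ennreal (l * p powr - (\<gamma>' + \<epsilon>)) \<le> T \<rho> (line_growth r s) \<omega>}"
    proof clarsimp
      fix \<omega> assume miss: "(0, 0) \<notin> growth \<rho> (line_growth r s) {z. \<omega> z} (t p)"
      have "(0, 0) \<notin> growth \<rho> (line_growth r s) {z. \<omega> z} (nat \<lfloor>l * p powr - (\<gamma> - \<epsilon>)\<rfloor>)"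
        using growth_mono_time[OF elim(3), of \<rho> "line_growth r s" "{z. \<omega> z}"] miss by blast
      then have "\<not> T \<rho> (line_growth r s) \<omega> \<le> ennreal (l * p powr - (\<gamma>' + \<epsilon>))"
        unfolding T_le_iff eq .
      then show "ennreal (l * p powr (- \<gamma>' - \<epsilon>)) \<le> T \<rho> (line_growth r s) \<omega>" by simp
    qed
    moreover have "{\<omega> \<in> space \<mu>. ennreal (l * p powr - (\<gamma>' + \<epsilon>)) \<le> T \<rho> (line_growth r s) \<omega>} \<in> events"
      using T_ge_event by simp
    ultimately have "emeasure \<mu> {\<omega>. (0, 0) \<notin> growth \<rho> (line_growth r s) {z. \<omega> z} (t p)} < ennreal (1 / 2)"
      using elim(2) by (meson emeasure_mono le_less_trans)
    then have "miss_prob p (t p) < 1 / 2" by (simp add: emeasure_eq_measure ennreal_less_iff del: ennreal_half)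
    with elim(1) prob_hit_add[of \<rho> "line_growth r s" "t p"] show False by linarith
  qed
  then show False by simp
qed

text \<open>The same contradiction at the midpoint from the other side, now with
  \<open>upper_times\<close>. That lemma needs a positive \<open>l\<close>, which is available
  because the limit in \<open>l\<close> is taken at 0 from the right.\<close>

lemma lower_power_le:
  assumes "lower_power \<rho> (line_growth r s) \<gamma>'"
  shows "\<gamma>' \<le> \<gamma>"
proof (rule ccontr)
  assume "\<not> \<gamma>' \<le> \<gamma>"
  define \<epsilon> where "\<epsilon> = (\<gamma>' - \<gamma>) / 2"
  have \<epsilon>: "0 < \<epsilon>" using \<open>\<not> \<gamma>' \<le> \<gamma>\<close> by (simp add: \<epsilon>_def)
  have eq: "\<gamma>' - \<epsilon> = \<gamma> + \<epsilon>" by (simp add: \<epsilon>_def field_simps)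
  let ?P = "\<lambda>l p. emeasure (init_measure p)
      {\<omega> \<in> space (init_measure p). T \<rho> (line_growth r s) \<omega> \<le> ennreal (l * p powr - (\<gamma>' - \<epsilon>))}"
  have "((\<lambda>l. Limsup (at_right 0) (?P l)) \<longlongrightarrow> 0) (at_right 0)"
    using assms \<epsilon> unfolding lower_power_def prob_greatersim_def by blast
  then have "eventually (\<lambda>l. Limsup (at_right 0) (?P l) < ennreal (1 / 2)) (at_right 0)"
    by (rule order_tendstoD) (subst ennreal_less_zero_iff, simp)
  then have "eventually (\<lambda>l. Limsup (at_right 0) (?P l) < ennreal (1 / 2) \<and> 0 < l) (at_right 0)"
    using eventually_at_right_unit by eventually_elim simp
  then obtain l where "Limsup (at_right 0) (?P l) < ennreal (1 / 2)" and l: "0 < l"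
    using eventually_happens'[of "at_right (0 :: real)"] by auto
  then have lt: "eventually (\<lambda>p. ?P l p < ennreal (1 / 2)) (at_right 0)" by (intro Limsup_lessD)
  obtain t where t: "((\<lambda>p. miss_prob p (t p)) \<longlongrightarrow> 0) (at_right 0)"
    "eventually (\<lambda>p. real (t p) < l * p powr - (\<gamma> + \<epsilon>)) (at_right 0)"
    using upper_times[OF \<epsilon> l] by blast
  have "eventually (\<lambda>p. miss_prob p (t p) < 1 / 2) (at_right 0)"
    by (rule order_tendstoD[OF t(1)]) simp
  then have "eventually (\<lambda>p :: real. False) (at_right 0)"
    using lt t(2) at_right_0_field
  proof eventually_elim
    case (elim p)
    interpret bernoulli_field p using elim by blast
    have ev: "{\<omega> \<in> space \<mu>. T \<rho> (line_growth r s) \<omega> \<le> ennreal (l * p powr - (\<gamma>' - \<epsilon>))} \<in> events"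
      unfolding T_le_iff using hit_event by simp
    have "t p \<le> nat \<lfloor>l * p powr - (\<gamma> + \<epsilon>)\<rfloor>" using elim(3) by linarith
    from growth_mono_time[OF this]
    have "{\<omega>. (0, 0) \<in> growth \<rho> (line_growth r s) {z. \<omega> z} (t p)} \<subseteq>
        {\<omega> \<in> space \<mu>. T \<rho> (line_growth r s) \<omega> \<le> ennreal (l * p powr - (\<gamma>' - \<epsilon>))}"
      unfolding T_le_iff eq by auto
    with ev have "emeasure \<mu> {\<omega>. (0, 0) \<in> growth \<rho> (line_growth r s) {z. \<omega> z} (t p)} < ennreal (1 / 2)"
      using elim(2) by (meson emeasure_mono le_less_trans)
    then have "hit_prob p (t p) < 1 / 2" by (simp add: emeasure_eq_measure ennreal_less_iff del: ennreal_half)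
    with elim(1) prob_hit_add[of \<rho> "line_growth r s" "t p"] show False by linarith
  qed
  then show False by simp
qed

end

theorem theorem1p2:
  fixes r s \<rho> :: nat
  assumes "2 \<le> s" and "s \<le> r" and "r \<le> \<rho>"
  shows "\<forall>\<gamma>. is_critical_power \<rho> (line_growth r s) \<gamma> \<longleftrightarrow>
           \<gamma> = (real r - 1) * real s / real r"
proof -
  interpret line_growth_power r s \<rho> using assms by unfold_locales
  show ?thesis
    using lower_power upper_power lower_power_le upper_power_ge
    unfolding is_critical_power_def \<gamma>_def[symmetric] by (meson order_antisym)
qed

end
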